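(* Define $\mathbb{R}$-linear maps as follows. - $c_1:\mathbb{R}\to\mathrm{End}_{\mathbb{R}}(\mathbb{C})$, where $c_1(x)$ is multiplication by $ix$. - $c_2:\mathbb{R}^2\to\mathrm{End}_{\mathbb{R}}(\mathbb{H})$, where $c_2(v)$ is left multiplication by the image of $v$ under the standard inclusion $\mathbb{R}^2\subset\mathbb{R}^3=\mathrm{Im}\,\mathbb{H}$. - $c_3:\mathbb{R}^3\to\mathrm{End}_{\mathbb{R}}(\mathbb{H})$, where $c_3(v)$ is left multiplication by $v\in\mathbb{R}^3=\mathrm{Im}\,\mathbb{H}$. - $c_4:\mathbb{R}^4=\mathbb{H}\to\mathrm{End}^R_{\mathbb{H}}(\wedge_{\mathbb{H}}\mathbb{H})$, $c_4(q)=\varepsilon^L_q-\iota^L_q$, i.e. $c_4(q)(a,b)=(-\overline{q}\,b,\;q\,a)$ on $\wedge_{\mathbb{H}}\mathbb{H}=\mathbb{H}\oplus\mathbb{H}$. Then each $c_i$ satisfies the Clifford condition and makes, respectively, $\mathbb{C}$, $\mathbb{H}$, $\mathbb{H}$, $\wedge_{\mathbb{H}}\mathbb{H}$ an irreducible module over $C\ell_1,C\ell_2,C\ell_3,C\ell_4$. The map $-c_3$ also makes $\mathbb{H}$ an irreducible $C\ell_3$-module, not isomorphic to the one given by $c_3$. The map $c_4$ induces an isomorphism of real algebras $C\ell_4\cong\mathrm{End}^R_{\mathbb{H}}(\wedge_{\mathbb{H}}\mathbb{H})$. Furthermore, for all $k\ge 0$, writing $S_{8k}:=(\wedge_{\mathbb{H}}\mathbb{H}\hat\otimes_{\mathbb{H}}\wedge_{\mathbb{H}}\mathbb{H})^{\hat\otimes^k_{\mathbb{R}}}$,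 the spaces $$S_{8k+1}=S_{8k}\otimes_{\mathbb{R}}\mathbb{C},\quad S_{8k+2}=S_{8k}\otimes_{\mathbb{R}}\mathbb{H},\quad S_{8k+3}=S_{8k}\otimes_{\mathbb{R}}\mathbb{H},\quad S_{8k+4}=S_{8k}\hat\otimes_{\mathbb{R}}\wedge_{\mathbb{H}}\mathbb{H},$$ $$S_{8k+5}=S_{8k+4}\otimes_{\mathbb{C}}\mathbb{C},\quad S_{8k+6}=S_{8k+4}\otimes_{\mathbb{H}}\mathbb{H},\quad S_{8k+7}=S_{8k+4}\otimes_{\mathbb{H}}\mathbb{H},\quad S_{8k+8}=(\wedge_{\mathbb{H}}\mathbb{H}\hat\otimes_{\mathbb{H}}\wedge_{\mathbb{H}}\mathbb{H})^{\hat\otimes^{k+1}_{\mathbb{R}}}$$ with the Clifford actions built from $c_1,\dots,c_4$ as in the context, are irreducible modules over $C\ell_{8k+1},\dots,C\ell_{8k+8}$ respectively.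
   Context: $C\ell_n$ is the unital real Clifford algebra of Euclidean $\mathbb{R}^n$, with $v\cdot w+w\cdot v=-2\langle v,w\rangle$. A linear map $c:\mathbb{R}^n\to\mathrm{End}_{\mathbb{R}}(S)$ satisfies the Clifford condition if $c(v)c(w)+c(w)c(v)=-2\langle v,w\rangle$ for all $v,w$; it then extends uniquely to a $C\ell_n$-module structure on $S$. The quaternionic exterior algebra $\wedge_{\mathbb{H}}\mathbb{H}$ is the quotient of the tensor algebra of the $\mathbb{H}$-bimodule $\mathbb{H}$ (over $\mathbb{H}$) by the two-sided ideal generated by all $m\otimes_{\mathbb{H}}m$. As an $\mathbb{H}$-bimodule, $\wedge_{\mathbb{H}}\mathbb{H}=\wedge^0\oplus\wedge^1=\mathbb{H}\oplus\mathbb{H}$, and it is $\mathbb{Z}_2$-graded by degree. Here $\varepsilon^L_q(a,b)=(0,qa)$ and $\iota^L_q(a,b)=(\overline q\,b,0)$. $\mathrm{End}^R_{\mathbb{H}}$ denotes right $\mathbb{H}$-linear endomorphisms. Put $S_1=\mathbb{C}$, $S_2=S_3=\mathbb{H}$, $S_4=\wedge_{\mathbb{H}}\mathbb{H}$, and $\mathbb{K}_1=\mathbb{C}$, $\mathbb{K}_2=\mathbb{K}_3=\mathbb{K}_4=\mathbb{H}$. The maps $c_i$ above are right $\mathbb{K}_i$-linear and are also denoted $c^R_i$. Using $\mathbb{K}_i\cong\mathbb{K}_i^{op}$ one also regards $S_i$ as a left $\mathbb{K}_i$-module with left $\mathbb{K}_i$-linear Clifford map $c^L_i$. The actions are as follows.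 - $c_8(u,v)=c_4^R(u)\hat\otimes1+1\hat\otimes c_4^L(v)$ on $S_8=S_4\hat\otimes_{\mathbb{H}}S_4$, for $u,v\in\mathbb{R}^4$. - $c_{8k}(u_1,\dots,u_k)=\sum_j I^{\hat\otimes(j-1)}\hat\otimes c_8(u_j)\hat\otimes I^{\hat\otimes(k-j)}$ on $S_{8k}=S_8^{\hat\otimes_{\mathbb{R}}^k}$ ($S_0=\mathbb{R}$ purely even, $c_0=0$). - $c_{8k+r}(u,v)=c_{8k}(u)\otimes I+I\hat\otimes c^R_r(v)$ for $1\le r\le4$. - $c_{8k+r}(u,v)=c_{8k+4}(u)\otimes I+I\hat\otimes c^L_{r-4}(v)$ on $S_{8k+4}\otimes_{\mathbb{K}_{r-4}}S_{r-4}$ for $5\le r\le 7$ (with $\mathbb{C}\subset\mathbb{H}$ a fixed unital embedding when $r=5$). Gradings on tensor products are the usual total gradings, $S_{8k}$ and $S_{8k+4}$ are graded accordingly, and $(T\hat\otimes S)(m\otimes n)=(-1)^{\deg S\deg m}Tm\otimes Sn$. When the last factor is ungraded, $I\hat\otimes c(v)$ means $\pm I\otimes c(v)$ on the part whose first factor has parity $\pm$. *)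

theory Defs
  imports
    "HOL-Analysis.Product_Vector"
    "HOL-Analysis.Finite_Function_Topology"
    "HOL-Algebra.Module"
    "HOL-Algebra.QuotRing"
    "Jordan_Normal_Form.Matrix"
begin

hide_const (open) Modules.module Multiset.mult

section \<open>Quaternions\<close>

datatype quat = Quat (qRe: real) (qI: real) (qJ: real) (qK: real)

instantiation quat :: real_algebra_1
begin

definition "0 = Quat 0 0 0 0"
definition "1 = Quat 1 0 0 0"
definition "x + y = Quat (qRe x + qRe y) (qI x + qI y) (qJ x + qJ y) (qK x + qK y)"
definition "- x = Quat (- qRe x) (- qI x) (- qJ x) (- qK x)"
definition "x - y = Quat (qRe x - qRe y) (qI x - qI y) (qJ x - qJ y) (qK x - qK y)"
definition "r *\<^sub>R x = Quat (r * qRe x) (r * qI x) (r * qJ x) (r * qK x)"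
definition "x * y = Quat
  (qRe x * qRe y - qI x * qI y - qJ x * qJ y - qK x * qK y)
  (qRe x * qI y + qI x * qRe y + qJ x * qK y - qK x * qJ y)
  (qRe x * qJ y - qI x * qK y + qJ x * qRe y + qK x * qI y)
  (qRe x * qK y + qI x * qJ y - qJ x * qI y + qK x * qRe y)"

instance
  by standard (simp_all add: zero_quat_def one_quat_def plus_quat_def uminus_quat_def
      minus_quat_def scaleR_quat_def times_quat_def algebra_simps)

end

definition qcnj :: "quat \<Rightarrow> quat" where
  "qcnj x = Quat (qRe x) (- qI x) (- qJ x) (- qK x)"

definition real_alg_embedding :: "('k::real_algebra_1 \<Rightarrow> 'l::real_algebra_1) \<Rightarrow> bool" where
  "real_alg_embedding e \<longleftrightarrow> linear e \<and> inj e \<and> e 1 = 1 \<and> (\<forall>x y. e (x * y) = e x * e y)"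

text \<open>An isomorphism of real algebras from \<open>K\<close> onto its opposite.\<close>

definition real_alg_opp_iso :: "('k::real_algebra_1 \<Rightarrow> 'k) \<Rightarrow> bool" where
  "real_alg_opp_iso \<phi> \<longleftrightarrow> linear \<phi> \<and> bij \<phi> \<and> \<phi> 1 = 1 \<and> (\<forall>x y. \<phi> (x * y) = \<phi> y * \<phi> x)"

section \<open>Real vector spaces and modules over real algebras\<close>

definition real_ring :: "real ring" where
  "real_ring = \<lparr>carrier = UNIV, monoid.mult = (*), one = 1, zero = 0, add = (+)\<rparr>"

text \<open>Real vector spaces are modules over \<^const>\<open>real_ring\<close>; real algebras use the ring fields of
  the same record, which are left undefined for mere vector spaces.\<close>

definition type_space :: "(real, 'a::real_vector) module" where
  "type_space = \<lparr>carrier = UNIV, monoid.mult = undefined, one = undefined,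
     zero = 0, add = (+), smult = (*\<^sub>R)\<rparr>"

definition real_linear_on ::
    "(real, 'a) module \<Rightarrow> (real, 'b) module \<Rightarrow> ('a \<Rightarrow> 'b) \<Rightarrow> bool" where
  "real_linear_on V W f \<longleftrightarrow>
     f \<in> carrier V \<rightarrow> carrier W \<and>
     (\<forall>x\<in>carrier V. \<forall>y\<in>carrier V. f (x \<oplus>\<^bsub>V\<^esub> y) = f x \<oplus>\<^bsub>W\<^esub> f y) \<and>
     (\<forall>r. \<forall>x\<in>carrier V. f (r \<odot>\<^bsub>V\<^esub> x) = r \<odot>\<^bsub>W\<^esub> f x)"

definition real_algebra :: "(real, 'a) module \<Rightarrow> bool" where
  "real_algebra A \<longleftrightarrow>
     ring A \<and> Module.module real_ring A \<and>
     (\<forall>r. \<forall>a\<in>carrier A. \<forall>b\<in>carrier A.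
        (r \<odot>\<^bsub>A\<^esub> a) \<otimes>\<^bsub>A\<^esub> b = r \<odot>\<^bsub>A\<^esub> (a \<otimes>\<^bsub>A\<^esub> b) \<and> a \<otimes>\<^bsub>A\<^esub> (r \<odot>\<^bsub>A\<^esub> b) = r \<odot>\<^bsub>A\<^esub> (a \<otimes>\<^bsub>A\<^esub> b))"

text \<open>\<open>\<rho>\<close> makes the real vector space \<open>V\<close> a unital left module over the (not necessarily commutative)
  real algebra \<open>A\<close>, extending the real structure of \<open>V\<close>.\<close>

definition left_module ::
    "(real, 'a) module \<Rightarrow> (real, 's) module \<Rightarrow> ('a \<Rightarrow> 's \<Rightarrow> 's) \<Rightarrow> bool" where
  "left_module A V \<rho> \<longleftrightarrow>
     real_algebra A \<and> Module.module real_ring V \<and>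
     (\<forall>a\<in>carrier A. real_linear_on V V (\<rho> a)) \<and>
     (\<forall>s\<in>carrier V. real_linear_on A V (\<lambda>a. \<rho> a s)) \<and>
     (\<forall>a\<in>carrier A. \<forall>b\<in>carrier A. \<forall>s\<in>carrier V. \<rho> (a \<otimes>\<^bsub>A\<^esub> b) s = \<rho> a (\<rho> b s)) \<and>
     (\<forall>s\<in>carrier V. \<rho> \<one>\<^bsub>A\<^esub> s = s)"

definition left_submodule ::
    "(real, 'a) module \<Rightarrow> (real, 's) module \<Rightarrow> ('a \<Rightarrow> 's \<Rightarrow> 's) \<Rightarrow> 's set \<Rightarrow> bool" where
  "left_submodule A V \<rho> W \<longleftrightarrow>
     submodule W real_ring V \<and> (\<forall>a\<in>carrier A. \<forall>s\<in>W. \<rho> a s \<in> W)"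

definition irreducible_module ::
    "(real, 'a) module \<Rightarrow> (real, 's) module \<Rightarrow> ('a \<Rightarrow> 's \<Rightarrow> 's) \<Rightarrow> bool" where
  "irreducible_module A V \<rho> \<longleftrightarrow>
     left_module A V \<rho> \<and> carrier V \<noteq> {\<zero>\<^bsub>V\<^esub>} \<and>
     (\<forall>W. left_submodule A V \<rho> W \<longrightarrow> W = {\<zero>\<^bsub>V\<^esub>} \<or> W = carrier V)"

definition left_module_iso ::
    "(real, 'a) module \<Rightarrow> (real, 's) module \<Rightarrow> ('a \<Rightarrow> 's \<Rightarrow> 's) \<Rightarrow>
     (real, 't) module \<Rightarrow> ('a \<Rightarrow> 't \<Rightarrow> 't) \<Rightarrow> ('s \<Rightarrow> 't) \<Rightarrow> bool" where
  "left_module_iso A V \<rho> W \<sigma> f \<longleftrightarrow>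
     real_linear_on V W f \<and> bij_betw f (carrier V) (carrier W) \<and>
     (\<forall>a\<in>carrier A. \<forall>s\<in>carrier V. f (\<rho> a s) = \<sigma> a (f s))"

section \<open>Free vector spaces and quotients\<close>

text \<open>\<^typ>\<open>'x \<Rightarrow>\<^sub>0 real\<close> is the free real vector space on the type \<^typ>\<open>'x\<close>, with basis
  \<open>gen x\<close>; \<open>free_on X\<close> is the free space on the set \<open>X\<close>.\<close>

abbreviation gen :: "'x \<Rightarrow> 'x \<Rightarrow>\<^sub>0 real" where
  "gen x \<equiv> Poly_Mapping.single x 1"

definition free_on :: "'x set \<Rightarrow> ('x \<Rightarrow>\<^sub>0 real) set" where
  "free_on X = {f. Poly_Mapping.keys f \<subseteq> X}"

definition lin_ext :: "('x \<Rightarrow> 'w::real_vector) \<Rightarrow> ('x \<Rightarrow>\<^sub>0 real) \<Rightarrow> 'w" where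
  "lin_ext g f = (\<Sum>x\<in>Poly_Mapping.keys f. Poly_Mapping.lookup f x *\<^sub>R g x)"

definition coset :: "'v::real_vector set \<Rightarrow> 'v \<Rightarrow> 'v set" where
  "coset N x = (\<lambda>n. x + n) ` N"

text \<open>The quotient \<open>U / N\<close>. An operation on cosets is the union of the cosets of its values on
  representatives; if it is well defined, all these cosets are equal.\<close>

definition quot_space :: "'v::real_vector set \<Rightarrow> 'v set \<Rightarrow> (real, 'v set) module" where
  "quot_space U N = \<lparr>carrier = coset N ` U, monoid.mult = undefined, one = undefined,
     zero = coset N 0,
     add = (\<lambda>X Y. \<Union>x\<in>X. \<Union>y\<in>Y. coset N (x + y)),
     smult = (\<lambda>r X. \<Union>x\<in>X. coset N (r *\<^sub>R x))\<rparr>"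

definition quot_alg :: "'v::{real_vector,ring_1} set \<Rightarrow> 'v set \<Rightarrow> (real, 'v set) module" where
  "quot_alg U N = (quot_space U N)
     \<lparr>monoid.mult := (\<lambda>X Y. \<Union>x\<in>X. \<Union>y\<in>Y. coset N (x * y)), one := coset N 1\<rparr>"

section \<open>Clifford algebras\<close>

text \<open>With concatenation as addition of lists, the convolution product of \<^theory>\<open>HOL-Library.Poly_Mapping\<close>
  turns \<open>'x list \<Rightarrow>\<^sub>0 real\<close> into the free unital associative real algebra on \<^typ>\<open>'x\<close>.\<close>

instantiation list :: (type) monoid_add
begin
definition zero_list :: "'a list" where "zero_list = []"
definition plus_list :: "'a list \<Rightarrow> 'a list \<Rightarrow> 'a list" where "plus_list xs ys = xs @ ys"
instance by standard (simp_all add: zero_list_def plus_list_def)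
end

definition two_sided_ideal :: "'v::{real_vector,ring_1} set \<Rightarrow> 'v set \<Rightarrow> 'v set" where
  "two_sided_ideal U R = span {a * r * b |a r b. a \<in> U \<and> r \<in> R \<and> b \<in> U}"

text \<open>The free algebra on the elements of $\mathbb{R}^n$ modulo the linear relations is the tensor
  algebra of $\mathbb{R}^n$; the last family of relators is the Clifford relation.\<close>

definition clifford_relators :: "nat \<Rightarrow> (real vec list \<Rightarrow>\<^sub>0 real) set" where
  "clifford_relators n =
     {gen [v + w] - gen [v] - gen [w] |v w. v \<in> carrier_vec n \<and> w \<in> carrier_vec n} \<union>
     {gen [r \<cdot>\<^sub>v v] - r *\<^sub>R gen [v] |r v. v \<in> carrier_vec n} \<union>
     {gen [v] * gen [w] + gen [w] * gen [v] + (2 * scalar_prod v w) *\<^sub>R 1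
       |v w. v \<in> carrier_vec n \<and> w \<in> carrier_vec n}"

definition clifford_ideal :: "nat \<Rightarrow> (real vec list \<Rightarrow>\<^sub>0 real) set" where
  "clifford_ideal n = two_sided_ideal (free_on (lists (carrier_vec n))) (clifford_relators n)"

definition Cl :: "nat \<Rightarrow> (real, (real vec list \<Rightarrow>\<^sub>0 real) set) module" where
  "Cl n = quot_alg (free_on (lists (carrier_vec n))) (clifford_ideal n)"

definition Cl_vec :: "nat \<Rightarrow> real vec \<Rightarrow> (real vec list \<Rightarrow>\<^sub>0 real) set" where
  "Cl_vec n v = coset (clifford_ideal n) (gen [v])"

definition clifford_map :: "nat \<Rightarrow> (real, 's) module \<Rightarrow> (real vec \<Rightarrow> 's \<Rightarrow> 's) \<Rightarrow> bool" where
  "clifford_map n V c \<longleftrightarrow>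
     (\<forall>v\<in>carrier_vec n. real_linear_on V V (c v)) \<and>
     (\<forall>s\<in>carrier V. real_linear_on (module_vec TYPE(real) n) V (\<lambda>v. c v s)) \<and>
     (\<forall>v\<in>carrier_vec n. \<forall>w\<in>carrier_vec n. \<forall>s\<in>carrier V.
        c v (c w s) \<oplus>\<^bsub>V\<^esub> c w (c v s) = (- 2 * scalar_prod v w) \<odot>\<^bsub>V\<^esub> s)"

definition extends_to_Cl ::
    "nat \<Rightarrow> (real, 's) module \<Rightarrow> (real vec \<Rightarrow> 's \<Rightarrow> 's) \<Rightarrow>
     ((real vec list \<Rightarrow>\<^sub>0 real) set \<Rightarrow> 's \<Rightarrow> 's) \<Rightarrow> bool" where
  "extends_to_Cl n V c \<rho> \<longleftrightarrow>
     left_module (Cl n) V \<rho> \<and> (\<forall>v\<in>carrier_vec n. \<forall>s\<in>carrier V. \<rho> (Cl_vec n v) s = c v s)"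

text \<open>The extension of \<open>c\<close> to \<open>Cl n\<close> is unique on carriers; the quantification over all
  \<open>\<rho>\<close> only accounts for the arbitrary values outside of them.\<close>

definition irreducible_via ::
    "nat \<Rightarrow> (real, 's) module \<Rightarrow> (real vec \<Rightarrow> 's \<Rightarrow> 's) \<Rightarrow> bool" where
  "irreducible_via n V c \<longleftrightarrow>
     clifford_map n V c \<and> (\<exists>\<rho>. extends_to_Cl n V c \<rho>) \<and>
     (\<forall>\<rho>. extends_to_Cl n V c \<rho> \<longrightarrow> irreducible_module (Cl n) V \<rho>)"

definition isomorphic_via ::
    "nat \<Rightarrow> (real, 's) module \<Rightarrow> (real vec \<Rightarrow> 's \<Rightarrow> 's) \<Rightarrow>
     (real, 't) module \<Rightarrow> (real vec \<Rightarrow> 't \<Rightarrow> 't) \<Rightarrow> bool" where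
  "isomorphic_via n V c W d \<longleftrightarrow>
     (\<exists>\<rho> \<sigma> f. extends_to_Cl n V c \<rho> \<and> extends_to_Cl n W d \<sigma> \<and> left_module_iso (Cl n) V \<rho> W \<sigma> f)"

lemma scaleR_single: "r *\<^sub>R Poly_Mapping.single x (a::real) = Poly_Mapping.single x (r * a)"
  by (rule poly_mapping_eqI)
     (simp add: scaleR_poly_mapping_def lookup_single when_def Abs_poly_mapping_inverse)

lemma poly_mapping_sum_induct [case_names single sum]:
  fixes f :: "'x \<Rightarrow>\<^sub>0 'v::comm_monoid_add"
  assumes "\<And>k v. P (Poly_Mapping.single k v)" and "\<And>f g. P f \<Longrightarrow> P g \<Longrightarrow> P (f + g)"
  shows "P f"
proof (induction f rule: update_induct)
  case const
  show ?case using assms(1)[of undefined 0] by simp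
next
  case (update f a b)
  have "Poly_Mapping.update a b f = f + Poly_Mapping.single a b"
    using update(1) by (intro poly_mapping_eqI) (auto simp: lookup_update lookup_add lookup_single when_def in_keys_iff)
  then show ?case using assms update by simp
qed

lemma scaleR_conv_mult: "r *\<^sub>R (f :: 'x::monoid_add \<Rightarrow>\<^sub>0 real) = Poly_Mapping.single 0 r * f"
proof (induction f rule: poly_mapping_sum_induct)
  case (single k v)
  then show ?case by (simp add: scaleR_single mult_single)
next
  case (sum f g)
  then show ?case by (simp add: scaleR_add_right distrib_left)
qed

lemma scaleR_mult_left: "(r *\<^sub>R f) * g = r *\<^sub>R (f * (g :: 'x::monoid_add \<Rightarrow>\<^sub>0 real))"
  by (simp add: scaleR_conv_mult mult.assoc)

lemma single_0_commute: "f * Poly_Mapping.single 0 r = Poly_Mapping.single 0 r * (f :: 'x::monoid_add \<Rightarrow>\<^sub>0 real)"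
proof (induction f rule: poly_mapping_sum_induct)
  case (single k v)
  then show ?case by (simp add: mult_single mult.commute)
next
  case (sum f g)
  then show ?case by (simp add: distrib_left distrib_right)
qed

lemma scaleR_mult_right: "f * (r *\<^sub>R g) = r *\<^sub>R (f * (g :: 'x::monoid_add \<Rightarrow>\<^sub>0 real))"
  by (simp add: scaleR_conv_mult single_0_commute flip: mult.assoc)

lemma ideal_subspace: "subspace (two_sided_ideal U R)"
  by (simp add: two_sided_ideal_def)

lemma ideal_rel: "r \<in> R \<Longrightarrow> r \<in> two_sided_ideal UNIV R"
  unfolding two_sided_ideal_def by (rule span_base) (metis (mono_tags, lifting) UNIV_I mem_Collect_eq mult_1 mult_1_right)

lemma ideal_mult_left:
  fixes f :: "'x::monoid_add \<Rightarrow>\<^sub>0 real"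
  assumes "x \<in> two_sided_ideal UNIV R" shows "f * x \<in> two_sided_ideal UNIV R"
  using assms unfolding two_sided_ideal_def
proof (induction rule: span_induct_alt)
  case base then show ?case by (simp add: span_zero)
next
  case (step c x y)
  then obtain a r b where "x = a * r * b" "r \<in> R" by auto
  then have "f * x \<in> span {a * r * b |a r b. a \<in> UNIV \<and> r \<in> R \<and> b \<in> UNIV}"
    by (intro span_base CollectI exI[of _ "f * a"] exI[of _ r] exI[of _ b]) (simp add: mult.assoc)
  with step show ?case by (simp add: distrib_left scaleR_mult_right span_add span_scale)
qed

lemma ideal_mult_right:
  fixes f :: "'x::monoid_add \<Rightarrow>\<^sub>0 real"
  assumes "x \<in> two_sided_ideal UNIV R" shows "x * f \<in> two_sided_ideal UNIV R"
  using assms unfolding two_sided_ideal_def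
proof (induction rule: span_induct_alt)
  case base then show ?case by (simp add: span_zero)
next
  case (step c x y)
  then obtain a r b where "x = a * r * b" "r \<in> R" by auto
  then have "x * f \<in> span {a * r * b |a r b. a \<in> UNIV \<and> r \<in> R \<and> b \<in> UNIV}"
    by (intro span_base CollectI exI[of _ a] exI[of _ r] exI[of _ "b * f"]) (simp add: mult.assoc)
  with step show ?case by (simp add: distrib_right scaleR_mult_left span_add span_scale)
qed

lemma coset_eq_iff:
  assumes "subspace N" shows "coset N x = coset N y \<longleftrightarrow> x - y \<in> N"
proof
  assume "coset N x = coset N y"
  moreover have "x \<in> coset N x" unfolding coset_def using subspace_0[OF assms] by force
  ultimately obtain n where "n \<in> N" "x = y + n" unfolding coset_def by auto
  then show "x - y \<in> N" by simp
next
  assume d: "x - y \<in> N"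
  show "coset N x = coset N y" unfolding coset_def
  proof (intro equalityI subsetI)
    fix z assume "z \<in> (+) x ` N"
    then obtain n where n: "n \<in> N" "z = x + n" by auto
    then have "z = y + ((x - y) + n)" by simp
    then show "z \<in> (+) y ` N" using subspace_add[OF assms d n(1)] by blast
  next
    fix z assume "z \<in> (+) y ` N"
    then obtain n where n: "n \<in> N" "z = y + n" by auto
    then have "z = x + (n - (x - y))" by simp
    then show "z \<in> (+) x ` N" using subspace_diff[OF assms n(1) d] by blast
  qed
qed

lemma coset_add:
  assumes "subspace N" shows "(\<Union>u\<in>coset N x. \<Union>v\<in>coset N y. coset N (u + v)) = coset N (x + y)"
proof -
  have "coset N (u + v) = coset N (x + y)" if "u \<in> coset N x" "v \<in> coset N y" for u v
    using that unfolding coset_eq_iff[OF assms] by (auto simp: coset_def algebra_simps subspace_add[OF assms])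
  moreover have "x \<in> coset N x" "y \<in> coset N y"
    unfolding coset_def using subspace_0[OF assms] by force+
  ultimately show ?thesis by blast
qed

lemma coset_scale:
  assumes "subspace N" shows "(\<Union>u\<in>coset N x. coset N (r *\<^sub>R u)) = coset N (r *\<^sub>R x)"
proof -
  have "coset N (r *\<^sub>R u) = coset N (r *\<^sub>R x)" if "u \<in> coset N x" for u
    using that unfolding coset_eq_iff[OF assms] by (auto simp: coset_def algebra_simps subspace_scale[OF assms])
  moreover have "x \<in> coset N x"
    unfolding coset_def using subspace_0[OF assms] by force+
  ultimately show ?thesis by blast
qed

lemma coset_mult:
  fixes x y :: "'x::monoid_add \<Rightarrow>\<^sub>0 real"
  assumes N_def: "N = two_sided_ideal UNIV R"
  shows "(\<Union>u\<in>coset N x. \<Union>v\<in>coset N y. coset N (u * v)) = coset N (x * y)"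
proof -
  have N: "subspace N" by (simp add: N_def ideal_subspace)
  have "coset N (u * v) = coset N (x * y)" if uv: "u \<in> coset N x" "v \<in> coset N y" for u v
  proof -
    from uv obtain m n where mn: "m \<in> N" "n \<in> N" "u = x + m" "v = y + n" by (auto simp: coset_def)
    then have "u * v - x * y = x * n + m * (y + n)" by (simp add: algebra_simps)
    also have "\<dots> \<in> N" using mn unfolding N_def
      by (intro subspace_add[OF ideal_subspace] ideal_mult_left ideal_mult_right)
    finally show ?thesis unfolding coset_eq_iff[OF N] .
  qed
  moreover have "x \<in> coset N x" "y \<in> coset N y"
    unfolding coset_def using subspace_0[OF N] by force+
  ultimately show ?thesis by blast
qed

lemma lin_ext_superset:
  assumes "finite A" "Poly_Mapping.keys f \<subseteq> A"
  shows "lin_ext g f = (\<Sum>x\<in>A. Poly_Mapping.lookup f x *\<^sub>R g x)"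
  unfolding lin_ext_def using assms by (intro sum.mono_neutral_left) (auto simp: in_keys_iff)

lemma lin_ext_add: "lin_ext g (f + h) = lin_ext g f + lin_ext g h"
proof -
  let ?A = "Poly_Mapping.keys f \<union> Poly_Mapping.keys h"
  have "Poly_Mapping.keys (f + h) \<subseteq> ?A" by (rule Poly_Mapping.keys_add)
  then show ?thesis
    by (simp add: lin_ext_superset[of ?A] lookup_add scaleR_add_left sum.distrib)
qed

lemma lin_ext_single: "lin_ext g (Poly_Mapping.single x r) = r *\<^sub>R g x"
  by (simp add: lin_ext_def)

section \<open>Tensor products\<close>

text \<open>\<open>V \<otimes>\<^sub>K W\<close> for a right \<open>K\<close>-action \<open>rm\<close> on \<open>V\<close> and a left \<open>K\<close>-action \<open>lm\<close> on \<open>W\<close>: the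
  free real vector space on \<open>V \<times> W\<close> modulo real bilinearity and \<open>K\<close>-balancedness.\<close>

definition tensor_relators ::
    "(real, 'a) module \<Rightarrow> ('a \<Rightarrow> 'k \<Rightarrow> 'a) \<Rightarrow> (real, 'b) module \<Rightarrow> ('k \<Rightarrow> 'b \<Rightarrow> 'b) \<Rightarrow>
     ('a \<times> 'b \<Rightarrow>\<^sub>0 real) set" where
  "tensor_relators V rm W lm =
     {gen (x \<oplus>\<^bsub>V\<^esub> x', y) - gen (x, y) - gen (x', y)
       |x x' y. x \<in> carrier V \<and> x' \<in> carrier V \<and> y \<in> carrier W} \<union>
     {gen (x, y \<oplus>\<^bsub>W\<^esub> y') - gen (x, y) - gen (x, y')
       |x y y'. x \<in> carrier V \<and> y \<in> carrier W \<and> y' \<in> carrier W} \<union>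
     {gen (r \<odot>\<^bsub>V\<^esub> x, y) - r *\<^sub>R gen (x, y) |r x y. x \<in> carrier V \<and> y \<in> carrier W} \<union>
     {gen (x, r \<odot>\<^bsub>W\<^esub> y) - r *\<^sub>R gen (x, y) |r x y. x \<in> carrier V \<and> y \<in> carrier W} \<union>
     {gen (rm x a, y) - gen (x, lm a y) |x a y. x \<in> carrier V \<and> y \<in> carrier W}"

definition tensor_null ::
    "(real, 'a) module \<Rightarrow> ('a \<Rightarrow> 'k \<Rightarrow> 'a) \<Rightarrow> (real, 'b) module \<Rightarrow> ('k \<Rightarrow> 'b \<Rightarrow> 'b) \<Rightarrow>
     ('a \<times> 'b \<Rightarrow>\<^sub>0 real) set" where
  "tensor_null V rm W lm = span (tensor_relators V rm W lm)"

definition tensor ::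
    "(real, 'a) module \<Rightarrow> ('a \<Rightarrow> 'k \<Rightarrow> 'a) \<Rightarrow> (real, 'b) module \<Rightarrow> ('k \<Rightarrow> 'b \<Rightarrow> 'b) \<Rightarrow>
     (real, ('a \<times> 'b \<Rightarrow>\<^sub>0 real) set) module" where
  "tensor V rm W lm = quot_space (free_on (carrier V \<times> carrier W)) (tensor_null V rm W lm)"

text \<open>For \<open>\<otimes>\<^sub>\<real>\<close> the actions are the scalar multiplications.\<close>

definition right_real :: "(real, 'a) module \<Rightarrow> 'a \<Rightarrow> real \<Rightarrow> 'a" where
  "right_real V x r = r \<odot>\<^bsub>V\<^esub> x"

text \<open>\<open>T \<otimes> S\<close>, where \<open>N\<close> is the null space of the tensor product.\<close>

definition tensor_map ::
    "('a \<times> 'b \<Rightarrow>\<^sub>0 real) set \<Rightarrow> ('a \<Rightarrow> 'a) \<Rightarrow> ('b \<Rightarrow> 'b) \<Rightarrow>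
     ('a \<times> 'b \<Rightarrow>\<^sub>0 real) set \<Rightarrow> ('a \<times> 'b \<Rightarrow>\<^sub>0 real) set" where
  "tensor_map N T S X = (\<Union>f\<in>X. coset N (lin_ext (\<lambda>(x, y). gen (T x, S y)) f))"

text \<open>A \<open>\<int>\<^sub>2\<close>-grading is given by its even part \<open>G False\<close> and its odd part \<open>G True\<close>.\<close>

type_synonym 'a grading = "bool \<Rightarrow> 'a set"

text \<open>The map acting as \<open>+1\<close> on the even and as \<open>-1\<close> on the odd part.\<close>

definition parity_map :: "(real, 'a) module \<Rightarrow> 'a grading \<Rightarrow> 'a \<Rightarrow> 'a" where
  "parity_map V G x = (THE z. \<exists>x0\<in>G False. \<exists>x1\<in>G True. x = x0 \<oplus>\<^bsub>V\<^esub> x1 \<and> z = x0 \<ominus>\<^bsub>V\<^esub> x1)"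

definition tensor_grading ::
    "('a \<times> 'b \<Rightarrow>\<^sub>0 real) set \<Rightarrow> 'a grading \<Rightarrow> 'b grading \<Rightarrow> ('a \<times> 'b \<Rightarrow>\<^sub>0 real) set grading" where
  "tensor_grading N G H d =
     coset N ` span {gen (x, y) |x y p q. x \<in> G p \<and> y \<in> H q \<and> (p \<noteq> q) = d}"

text \<open>The graded tensor product \<open>I \<otimes> S\<close> for \<open>S\<close> of degree \<open>d\<close>, i.e.
  $m \otimes n \mapsto (-1)^{d \deg m}\, m \otimes S n$.\<close>

definition id_graded_tensor ::
    "(real, 'a) module \<Rightarrow> 'a grading \<Rightarrow> ('a \<times> 'b \<Rightarrow>\<^sub>0 real) set \<Rightarrow> bool \<Rightarrow> ('b \<Rightarrow> 'b) \<Rightarrow>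
     ('a \<times> 'b \<Rightarrow>\<^sub>0 real) set \<Rightarrow> ('a \<times> 'b \<Rightarrow>\<^sub>0 real) set" where
  "id_graded_tensor V G N d S = tensor_map N (if d then parity_map V G else id) S"

text \<open>\<open>(u, v) \<mapsto> c u \<otimes> I + I \<otimes> c' v\<close> (graded tensor product) for \<open>u\<close> in $\mathbb{R}^m$, \<open>v\<close> in
  $\mathbb{R}^r$, on \<open>V \<otimes>\<^sub>K W\<close> with \<open>V\<close> graded by \<open>G\<close>. The maps \<open>c' v\<close> count as odd, also when \<open>W\<close> is
  ungraded.\<close>

definition tensor_clifford ::
    "(real, 'a) module \<Rightarrow> 'a grading \<Rightarrow> ('a \<Rightarrow> 'k \<Rightarrow> 'a) \<Rightarrow> (real, 'b) module \<Rightarrow> ('k \<Rightarrow> 'b \<Rightarrow> 'b) \<Rightarrow>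
     nat \<Rightarrow> (real vec \<Rightarrow> 'a \<Rightarrow> 'a) \<Rightarrow> nat \<Rightarrow> (real vec \<Rightarrow> 'b \<Rightarrow> 'b) \<Rightarrow>
     real vec \<Rightarrow> ('a \<times> 'b \<Rightarrow>\<^sub>0 real) set \<Rightarrow> ('a \<times> 'b \<Rightarrow>\<^sub>0 real) set" where
  "tensor_clifford V G rm W lm m c r c' w X =
     (let N = tensor_null V rm W lm in
      tensor_map N (c (vec_first w m)) id X
      \<oplus>\<^bsub>tensor V rm W lm\<^esub> id_graded_tensor V G N True (c' (vec_last w r)) X)"

text \<open>The \<open>k\<close>-fold tensor power over the reals, as the free real vector space on \<open>k\<close>-tuples modulo
  multilinearity. For \<open>k = 0\<close> there is the single generator \<open>[]\<close> and no relation.\<close>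

definition power_relators :: "(real, 'a) module \<Rightarrow> nat \<Rightarrow> ('a list \<Rightarrow>\<^sub>0 real) set" where
  "power_relators V k =
     {gen (xs[i := x \<oplus>\<^bsub>V\<^esub> y]) - gen (xs[i := x]) - gen (xs[i := y])
       |xs i x y. xs \<in> lists (carrier V) \<and> length xs = k \<and> i < k \<and> x \<in> carrier V \<and> y \<in> carrier V} \<union>
     {gen (xs[i := r \<odot>\<^bsub>V\<^esub> x]) - r *\<^sub>R gen (xs[i := x])
       |xs i r x. xs \<in> lists (carrier V) \<and> length xs = k \<and> i < k \<and> x \<in> carrier V}"

definition power_null :: "(real, 'a) module \<Rightarrow> nat \<Rightarrow> ('a list \<Rightarrow>\<^sub>0 real) set" where
  "power_null V k = span (power_relators V k)"

definition tensor_power ::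
    "(real, 'a) module \<Rightarrow> nat \<Rightarrow> (real, ('a list \<Rightarrow>\<^sub>0 real) set) module" where
  "tensor_power V k =
     quot_space (free_on {xs \<in> lists (carrier V). length xs = k}) (power_null V k)"

definition power_grading ::
    "(real, 'a) module \<Rightarrow> nat \<Rightarrow> 'a grading \<Rightarrow> ('a list \<Rightarrow>\<^sub>0 real) set grading" where
  "power_grading V k G d = coset (power_null V k) `
     span {gen xs |xs ps. length xs = k \<and> list_all2 (\<lambda>x p. x \<in> G p) xs ps \<and>
                         odd (count_list ps True) = d}"

text \<open>\<open>T\<^sub>1 \<otimes> \<dots> \<otimes> T\<^sub>k\<close> for a list of maps.\<close>

definition power_map ::
    "('a list \<Rightarrow>\<^sub>0 real) set \<Rightarrow> ('a \<Rightarrow> 'a) list \<Rightarrow> ('a list \<Rightarrow>\<^sub>0 real) set \<Rightarrow> ('a list \<Rightarrow>\<^sub>0 real) set" where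
  "power_map N Ts X = (\<Union>f\<in>X. coset N (lin_ext (\<lambda>xs. gen (map2 (\<lambda>T x. T x) Ts xs)) f))"

text \<open>\<open>u \<mapsto> \<Sum>\<^sub>j I \<otimes> \<dots> \<otimes> c u\<^sub>j \<otimes> \<dots> \<otimes> I\<close> (graded tensor products) with \<open>u\<^sub>j\<close> the \<open>j\<close>-th block of \<open>n\<close>
  coordinates. As \<open>c u\<^sub>j\<close> is odd, the sign rule puts a parity map on each factor before it.\<close>

definition power_clifford ::
    "(real, 'a) module \<Rightarrow> 'a grading \<Rightarrow> nat \<Rightarrow> (real vec \<Rightarrow> 'a \<Rightarrow> 'a) \<Rightarrow> nat \<Rightarrow>
     real vec \<Rightarrow> ('a list \<Rightarrow>\<^sub>0 real) set \<Rightarrow> ('a list \<Rightarrow>\<^sub>0 real) set" where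
  "power_clifford V G n c k u X =
     (\<Oplus>\<^bsub>tensor_power V k\<^esub>j\<in>{..<k}.
        power_map (power_null V k)
          (replicate j (parity_map V G) @ [c (vec n (\<lambda>i. u $ (n * j + i)))] @ replicate (k - Suc j) id) X)"

section \<open>The basic modules\<close>

definition c1 :: "real vec \<Rightarrow> complex \<Rightarrow> complex" where
  "c1 v s = \<i> * complex_of_real (v $ 0) * s"

definition c2 :: "real vec \<Rightarrow> quat \<Rightarrow> quat" where
  "c2 v s = Quat 0 (v $ 0) (v $ 1) 0 * s"

definition c3 :: "real vec \<Rightarrow> quat \<Rightarrow> quat" where
  "c3 v s = Quat 0 (v $ 0) (v $ 1) (v $ 2) * s"

text \<open>The quaternionic exterior algebra of \<open>\<bbbH>\<close> in the form $\wedge^0 \oplus \wedge^1$; the theorem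
  \<open>quat_exterior_iso\<close> below identifies it with the quotient of the tensor algebra.\<close>

type_synonym ext = "quat \<times> quat"

definition ext_right :: "ext \<Rightarrow> quat \<Rightarrow> ext" where
  "ext_right s q = (fst s * q, snd s * q)"

definition ext_grading :: "ext grading" where
  "ext_grading d = (if d then {0} \<times> UNIV else UNIV \<times> {0})"

definition eps_L :: "quat \<Rightarrow> ext \<Rightarrow> ext" where
  "eps_L q s = (0, q * fst s)"

definition iota_L :: "quat \<Rightarrow> ext \<Rightarrow> ext" where
  "iota_L q s = (qcnj q * snd s, 0)"

definition quat_of_vec :: "real vec \<Rightarrow> quat" where
  "quat_of_vec v = Quat (v $ 0) (v $ 1) (v $ 2) (v $ 3)"

text \<open>The quaternionic exterior algebra, as a real algebra. The letters \<open>Inl a\<close> are the scalars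
  from \<open>\<bbbH>\<close>, the letters \<open>Inr m\<close> the elements of the \<open>\<bbbH>\<close>-bimodule \<open>\<bbbH>\<close>; all relators but the
  last family present the tensor algebra over \<open>\<bbbH>\<close> of that bimodule.\<close>

definition ext_relators :: "((quat + quat) list \<Rightarrow>\<^sub>0 real) set" where
  "ext_relators =
     {gen [Inl 1] - 1} \<union>
     {gen [Inl (a + b)] - gen [Inl a] - gen [Inl b] |a b. True} \<union>
     {gen [Inl (r *\<^sub>R a)] - r *\<^sub>R gen [Inl a] |r a. True} \<union>
     {gen [Inl (a * b)] - gen [Inl a] * gen [Inl b] |a b. True} \<union>
     {gen [Inr (m + n)] - gen [Inr m] - gen [Inr n] |m n. True} \<union>
     {gen [Inr (r *\<^sub>R m)] - r *\<^sub>R gen [Inr m] |r m. True} \<union>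
     {gen [Inr (a * m)] - gen [Inl a] * gen [Inr m] |a m. True} \<union>
     {gen [Inr (m * a)] - gen [Inr m] * gen [Inl a] |m a. True} \<union>
     {gen [Inr m] * gen [Inr m] |m. True}"

definition ext_ideal :: "((quat + quat) list \<Rightarrow>\<^sub>0 real) set" where
  "ext_ideal = two_sided_ideal UNIV ext_relators"

definition quat_exterior :: "(real, ((quat + quat) list \<Rightarrow>\<^sub>0 real) set) module" where
  "quat_exterior = quot_alg UNIV ext_ideal"

definition ext_class :: "ext \<Rightarrow> ((quat + quat) list \<Rightarrow>\<^sub>0 real) set" where
  "ext_class s = coset ext_ideal (gen [Inl (fst s)] + gen [Inr (snd s)])"

abbreviation ext_rep :: "ext \<Rightarrow> ((quat + quat) list \<Rightarrow>\<^sub>0 real)" where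
  "ext_rep s \<equiv> gen [Inl (fst s)] + gen [Inr (snd s)]"

text \<open>The action of the free algebra on $\wedge^0 \oplus \wedge^1$, which kills the ideal.\<close>

fun ext_letter :: "quat + quat \<Rightarrow> ext \<Rightarrow> ext" where
  "ext_letter (Inl a) s = (a * fst s, a * snd s)"
| "ext_letter (Inr m) s = eps_L m s"

fun ext_word_act :: "(quat + quat) list \<Rightarrow> ext \<Rightarrow> ext" where
  "ext_word_act [] s = s"
| "ext_word_act (x # w) s = ext_letter x (ext_word_act w s)"

lemma ext_letter_linear: "ext_letter x (s + t) = ext_letter x s + ext_letter x t" "ext_letter x (r *\<^sub>R s) = r *\<^sub>R ext_letter x s"
  by (cases x; simp add: eps_L_def algebra_simps prod_eq_iff)+

lemma ext_word_act_linear: "ext_word_act w (s + t) = ext_word_act w s + ext_word_act w t" "ext_word_act w (r *\<^sub>R s) = r *\<^sub>R ext_word_act w s"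
  by (induction w) (simp_all add: ext_letter_linear)

lemma ext_word_act_append: "ext_word_act (v @ w) s = ext_word_act v (ext_word_act w s)"
  by (induction v) simp_all

definition ext_act :: "((quat + quat) list \<Rightarrow>\<^sub>0 real) \<Rightarrow> ext \<Rightarrow> ext" where
  "ext_act f s = lin_ext (\<lambda>w. ext_word_act w s) f"

lemma ext_act_add: "ext_act (f + h) s = ext_act f s + ext_act h s"
  by (simp add: ext_act_def lin_ext_add)

lemma ext_act_0: "ext_act 0 s = 0" by (simp add: ext_act_def lin_ext_def)

lemma ext_act_single: "ext_act (Poly_Mapping.single w r) s = r *\<^sub>R ext_word_act w s"
  by (simp add: ext_act_def lin_ext_single)

lemma ext_act_linear: "ext_act f (s + t) = ext_act f s + ext_act f t" "ext_act f (r *\<^sub>R s) = r *\<^sub>R ext_act f s"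
  by (simp_all add: ext_act_def lin_ext_def ext_word_act_linear scaleR_add_right sum.distrib scaleR_sum_right mult.commute)

lemma ext_act_minus: "ext_act (f - h) s = ext_act f s - ext_act h s"
  using ext_act_add[of "f - h" h s] by simp

lemma ext_act_mult: "ext_act (f * h) s = ext_act f (ext_act h s)"
proof (induction f rule: poly_mapping_sum_induct)
  case (single v a)
  show ?case
  proof (induction h rule: poly_mapping_sum_induct)
    case (single w b)
    then show ?case
      by (simp add: mult_single ext_act_single plus_list_def ext_word_act_append ext_word_act_linear)
  next
    case (sum f g)
    then show ?case by (simp add: distrib_left ext_act_add ext_act_linear)
  qed
next
  case (sum f g)
  then show ?case by (simp add: distrib_right ext_act_add)
qed

lemma ext_act_scale: "ext_act (r *\<^sub>R f) s = r *\<^sub>R ext_act f s"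
  by (simp add: scaleR_conv_mult ext_act_mult ext_act_single zero_list_def)

lemma ext_act_one: "ext_act 1 s = s"
proof -
  have "ext_act 1 s = ext_act (gen []) s" by (simp flip: zero_list_def)
  then show ?thesis unfolding ext_act_single by simp
qed

lemma ext_act_linear0: "ext_act f 0 = 0"
  using ext_act_linear(2)[of f 0 0] by simp

lemma ext_act_relator: "r \<in> ext_relators \<Longrightarrow> ext_act r s = 0"
  unfolding ext_relators_def
  by (elim UnE CollectE exE conjE singletonE;
      simp only: ext_act_minus ext_act_mult ext_act_single ext_act_one ext_act_scale;
      simp add: eps_L_def algebra_simps prod_eq_iff)

lemma ext_act_ideal: "x \<in> ext_ideal \<Longrightarrow> ext_act x s = 0"
  unfolding ext_ideal_def two_sided_ideal_def
proof (induction rule: span_induct_alt)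
  case base then show ?case by (simp add: ext_act_0)
next
  case (step c x y)
  then obtain a r b where "x = a * r * b" "r \<in> ext_relators" by auto
  with step show ?case by (simp add: ext_act_add ext_act_scale ext_act_mult ext_act_relator ext_act_linear0)
qed

lemmas ext_subspace = ideal_subspace[of UNIV ext_relators, folded ext_ideal_def]
lemmas ext_mult_left = ideal_mult_left[of _ ext_relators, folded ext_ideal_def]
lemmas ext_mult_right = ideal_mult_right[of _ ext_relators, folded ext_ideal_def]
lemmas ext_rel = ideal_rel[of _ ext_relators, folded ext_ideal_def]

definition ext_cong :: "((quat + quat) list \<Rightarrow>\<^sub>0 real) \<Rightarrow> ((quat + quat) list \<Rightarrow>\<^sub>0 real) \<Rightarrow> bool" (infix "\<equiv>\<^sub>E" 50) where
  "f \<equiv>\<^sub>E g \<longleftrightarrow> f - g \<in> ext_ideal"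

lemma ext_cong_coset: "f \<equiv>\<^sub>E g \<longleftrightarrow> coset ext_ideal f = coset ext_ideal g"
  by (simp add: ext_cong_def coset_eq_iff[OF ext_subspace])

lemma ext_cong_refl: "f \<equiv>\<^sub>E f" and ext_cong_sym: "f \<equiv>\<^sub>E g \<Longrightarrow> g \<equiv>\<^sub>E f" and ext_cong_trans [trans]: "f \<equiv>\<^sub>E g \<Longrightarrow> g \<equiv>\<^sub>E h \<Longrightarrow> f \<equiv>\<^sub>E h"
  by (simp_all add: ext_cong_coset)

lemma ext_cong_add: "f \<equiv>\<^sub>E g \<Longrightarrow> f' \<equiv>\<^sub>E g' \<Longrightarrow> f + f' \<equiv>\<^sub>E g + g'"
  unfolding ext_cong_def using subspace_add[OF ext_subspace, of "f - g" "f' - g'"] by (simp add: algebra_simps)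

lemma ext_cong_scale: "f \<equiv>\<^sub>E g \<Longrightarrow> r *\<^sub>R f \<equiv>\<^sub>E r *\<^sub>R g"
  unfolding ext_cong_def using subspace_scale[OF ext_subspace, of "f - g" r] by (simp add: algebra_simps)

lemma ext_cong_mult: "f \<equiv>\<^sub>E g \<Longrightarrow> f' \<equiv>\<^sub>E g' \<Longrightarrow> f * f' \<equiv>\<^sub>E g * g'"
  unfolding ext_cong_def
proof -
  assume "f - g \<in> ext_ideal" "f' - g' \<in> ext_ideal"
  then have "(f - g) * f' + g * (f' - g') \<in> ext_ideal"
    by (intro subspace_add[OF ext_subspace] ext_mult_left ext_mult_right)
  then show "f * f' - g * g' \<in> ext_ideal" by (simp add: algebra_simps)
qed

lemma ext_cong_rels:
  "gen [Inl 1] \<equiv>\<^sub>E 1"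
  "gen [Inl (a + b)] \<equiv>\<^sub>E gen [Inl a] + gen [Inl b]"
  "gen [Inl (r *\<^sub>R a)] \<equiv>\<^sub>E r *\<^sub>R gen [Inl a]"
  "gen [Inl (a * b)] \<equiv>\<^sub>E gen [Inl a] * gen [Inl b]"
  "gen [Inr (m + n)] \<equiv>\<^sub>E gen [Inr m] + gen [Inr n]"
  "gen [Inr (r *\<^sub>R m)] \<equiv>\<^sub>E r *\<^sub>R gen [Inr m]"
  "gen [Inr (a * m)] \<equiv>\<^sub>E gen [Inl a] * gen [Inr m]"
  "gen [Inr (m * a)] \<equiv>\<^sub>E gen [Inr m] * gen [Inl a]"
  "gen [Inr m] * gen [Inr m] \<equiv>\<^sub>E 0"
  unfolding ext_cong_def
  by (rule ext_rel; unfold ext_relators_def diff_diff_add[symmetric] diff_0_right; blast)+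

lemma ext_cong_Inr_Inr: "gen [Inr m] * gen [Inr n] \<equiv>\<^sub>E 0"
proof -
  have "gen [Inr m] * gen [Inr n] \<equiv>\<^sub>E (gen [Inl m] * gen [Inr 1]) * (gen [Inr 1] * gen [Inl n])"
    using ext_cong_rels(7)[of m 1] ext_cong_rels(8)[of 1 n] by (intro ext_cong_mult) simp_all
  also have "\<dots> = gen [Inl m] * (gen [Inr 1] * gen [Inr 1]) * gen [Inl n]"
    by (simp only: mult.assoc)
  also have "\<dots> \<equiv>\<^sub>E gen [Inl m] * 0 * gen [Inl n]"
    by (intro ext_cong_mult ext_cong_refl ext_cong_rels)
  finally show ?thesis by simp
qed

lemma ext_rep_0: "ext_rep 0 \<equiv>\<^sub>E 0"
  using ext_cong_add[OF ext_cong_rels(3)[of 0 0] ext_cong_rels(6)[of 0 0]] by simp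

lemma ext_rep_add: "ext_rep (s + t) \<equiv>\<^sub>E ext_rep s + ext_rep t"
  using ext_cong_add[OF ext_cong_rels(2)[of "fst s" "fst t"] ext_cong_rels(5)[of "snd s" "snd t"]]
  by (simp add: algebra_simps)

lemma ext_rep_scale: "ext_rep (r *\<^sub>R s) \<equiv>\<^sub>E r *\<^sub>R ext_rep s"
  using ext_cong_add[OF ext_cong_rels(3)[of r "fst s"] ext_cong_rels(6)[of r "snd s"]]
  by (simp add: algebra_simps)

lemma ext_rep_letter: "gen [x] * ext_rep s \<equiv>\<^sub>E ext_rep (ext_letter x s)"
proof (cases x)
  case (Inl a)
  then show ?thesis
    using ext_cong_add[OF ext_cong_rels(4)[of a "fst s"] ext_cong_rels(7)[of a "snd s"]]
    by (simp add: distrib_left ext_cong_sym)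
next
  case (Inr m)
  have "gen [Inr m] * ext_rep s \<equiv>\<^sub>E gen [Inr (m * fst s)] + 0"
    unfolding distrib_left by (intro ext_cong_add ext_cong_Inr_Inr ext_cong_sym[OF ext_cong_rels(8)])
  also have "\<dots> \<equiv>\<^sub>E ext_rep (0, m * fst s)"
    using ext_cong_add[OF ext_cong_sym[OF ext_cong_rels(3)[of 0 0]] ext_cong_refl[of "gen [Inr (m * fst s)]"]] by simp
  finally show ?thesis using Inr by (simp add: eps_L_def)
qed

lemma ext_rep_right: "ext_rep s * gen [Inl q] \<equiv>\<^sub>E ext_rep (ext_right s q)"
  using ext_cong_add[OF ext_cong_rels(4)[of "fst s" q] ext_cong_rels(8)[of "snd s" q]]
  by (simp add: distrib_right ext_cong_sym ext_right_def)

lemma ext_rep_word: "gen w \<equiv>\<^sub>E ext_rep (ext_word_act w (1, 0))"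
proof (induction w)
  case Nil
  have "gen [] = (1 :: (quat + quat) list \<Rightarrow>\<^sub>0 real)" by (simp flip: zero_list_def)
  moreover have "1 + 0 \<equiv>\<^sub>E ext_rep (1, 0)"
    using ext_cong_add[OF ext_cong_sym[OF ext_cong_rels(1)] ext_cong_sym[OF ext_cong_rels(6)[of 0 0]]] by simp
  ultimately show ?case by simp
next
  case (Cons x w)
  have "gen (x # w) = gen [x] * gen w" by (simp add: mult_single plus_list_def)
  also have "\<dots> \<equiv>\<^sub>E gen [x] * ext_rep (ext_word_act w (1, 0))" by (intro ext_cong_mult ext_cong_refl Cons)
  also have "\<dots> \<equiv>\<^sub>E ext_rep (ext_word_act (x # w) (1, 0))" using ext_rep_letter by simp
  finally show ?case .
qed

lemma ext_rep_all: "f \<equiv>\<^sub>E ext_rep (ext_act f (1, 0))"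
proof (induction f rule: poly_mapping_sum_induct)
  case (single w r)
  have "Poly_Mapping.single w r = r *\<^sub>R gen w" by (simp add: scaleR_single)
  also have "\<dots> \<equiv>\<^sub>E r *\<^sub>R ext_rep (ext_word_act w (1, 0))" by (intro ext_cong_scale ext_rep_word)
  also have "\<dots> \<equiv>\<^sub>E ext_rep (r *\<^sub>R ext_word_act w (1, 0))" by (rule ext_cong_sym[OF ext_rep_scale])
  finally show ?case by (simp only: ext_act_single)
next
  case (sum f g)
  then have "f + g \<equiv>\<^sub>E ext_rep (ext_act f (1, 0)) + ext_rep (ext_act g (1, 0))" by (intro ext_cong_add)
  also have "\<dots> \<equiv>\<^sub>E ext_rep (ext_act (f + g) (1, 0))" unfolding ext_act_add by (rule ext_cong_sym[OF ext_rep_add])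
  finally show ?case .
qed

lemma ext_act_rep: "ext_act (ext_rep s) (1, 0) = s"
  by (simp add: ext_act_add ext_act_single eps_L_def prod_eq_iff)

text \<open>The identification of the quotient algebra with $\wedge^0 \oplus \wedge^1$, including the
  bimodule structure and left exterior multiplication.\<close>

theorem quat_exterior_iso:
  "bij_betw ext_class UNIV (carrier quat_exterior)"
  "ext_class (s + t) = ext_class s \<oplus>\<^bsub>quat_exterior\<^esub> ext_class t"
  "ext_class (r *\<^sub>R s) = r \<odot>\<^bsub>quat_exterior\<^esub> ext_class s"
  "ext_class (q * fst s, q * snd s) = ext_class (q, 0) \<otimes>\<^bsub>quat_exterior\<^esub> ext_class s"
  "ext_class (ext_right s q) = ext_class s \<otimes>\<^bsub>quat_exterior\<^esub> ext_class (q, 0)"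
  "ext_class (eps_L q s) = ext_class (0, q) \<otimes>\<^bsub>quat_exterior\<^esub> ext_class s"
proof -
  have l: "ext_rep (q, 0) \<equiv>\<^sub>E gen [Inl q]" for q
    using ext_cong_add[OF ext_cong_refl[of "gen [Inl q]"] ext_cong_rels(6)[of 0 0]] by simp
  have r: "ext_rep (0, q) \<equiv>\<^sub>E gen [Inr q]" for q
    using ext_cong_add[OF ext_cong_rels(3)[of 0 0] ext_cong_refl[of "gen [Inr q]"]] by simp
  have mult: "ext_class u = ext_class s \<otimes>\<^bsub>quat_exterior\<^esub> ext_class t" if "ext_rep s * ext_rep t \<equiv>\<^sub>E ext_rep u" for s t u
    using that coset_mult[OF ext_ideal_def]
    by (simp add: ext_class_def quat_exterior_def quot_alg_def ext_cong_coset)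
  show "bij_betw ext_class UNIV (carrier quat_exterior)"
  proof (rule bij_betw_imageI)
    show "inj_on ext_class UNIV"
    proof (rule injI)
      fix s t assume "ext_class s = ext_class t"
      then have "ext_act (ext_rep s - ext_rep t) (1, 0) = 0"
        unfolding ext_class_def coset_eq_iff[OF ext_subspace] by (rule ext_act_ideal)
      then show "s = t" by (simp only: ext_act_minus ext_act_rep) simp
    qed
    show "ext_class ` UNIV = carrier quat_exterior"
      using ext_rep_all by (auto simp: ext_class_def quat_exterior_def quot_alg_def quot_space_def ext_cong_coset)
  qed
  show "ext_class (s + t) = ext_class s \<oplus>\<^bsub>quat_exterior\<^esub> ext_class t"
    using ext_rep_add[of s t] unfolding ext_cong_coset
    by (simp add: ext_class_def quat_exterior_def quot_alg_def quot_space_def coset_add[OF ext_subspace])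
  show "ext_class (r *\<^sub>R s) = r \<odot>\<^bsub>quat_exterior\<^esub> ext_class s"
    using ext_rep_scale[of r s] unfolding ext_cong_coset
    by (simp add: ext_class_def quat_exterior_def quot_alg_def quot_space_def coset_scale[OF ext_subspace])
  show "ext_class (q * fst s, q * snd s) = ext_class (q, 0) \<otimes>\<^bsub>quat_exterior\<^esub> ext_class s"
    using ext_cong_trans[OF ext_cong_mult[OF l ext_cong_refl] ext_rep_letter[of "Inl q" s]] by (intro mult) simp
  show "ext_class (ext_right s q) = ext_class s \<otimes>\<^bsub>quat_exterior\<^esub> ext_class (q, 0)"
    using ext_cong_trans[OF ext_cong_mult[OF ext_cong_refl l] ext_rep_right[of s q]] by (intro mult) simp
  show "ext_class (eps_L q s) = ext_class (0, q) \<otimes>\<^bsub>quat_exterior\<^esub> ext_class s"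
    using ext_cong_trans[OF ext_cong_mult[OF r ext_cong_refl] ext_rep_letter[of "Inr q" s]] by (intro mult) simp
qed

definition c4 :: "real vec \<Rightarrow> ext \<Rightarrow> ext" where
  "c4 v s = eps_L (quat_of_vec v) s - iota_L (quat_of_vec v) s"

text \<open>The real algebra of right \<open>\<bbbH>\<close>-linear endomorphisms.\<close>

definition End_ext :: "(real, ext \<Rightarrow> ext) module" where
  "End_ext = \<lparr>carrier = {f. linear f \<and> (\<forall>s q. f (ext_right s q) = ext_right (f s) q)},
     monoid.mult = (\<circ>), one = id, zero = (\<lambda>s. 0), add = (\<lambda>f g s. f s + g s),
     smult = (\<lambda>r f s. r *\<^sub>R f s)\<rparr>"

section \<open>The periodic family\<close>

text \<open>\<open>\<phi>\<close> and \<open>\<psi>\<close> are the identifications of \<open>\<bbbH>\<close> and \<open>\<complex>\<close> with their opposites: a right module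
  becomes a left module by \<open>q \<cdot> s = s \<phi>(q)\<close>, on the same space and with the same Clifford map.
  \<open>e\<close> is the embedding of \<open>\<complex>\<close> into \<open>\<bbbH>\<close>. \<open>spin_r\<close> stands for \<open>S\<^bsub>8k+r\<^esub>\<close> and \<open>act_r\<close> for its Clifford map.\<close>

definition ext_left :: "(quat \<Rightarrow> quat) \<Rightarrow> quat \<Rightarrow> ext \<Rightarrow> ext" where
  "ext_left \<phi> q s = ext_right s (\<phi> q)"

type_synonym ext2 = "(ext \<times> ext \<Rightarrow>\<^sub>0 real) set"

definition S8 :: "(quat \<Rightarrow> quat) \<Rightarrow> (real, ext2) module" where
  "S8 \<phi> = tensor type_space ext_right type_space (ext_left \<phi>)"

definition S8_grading :: "(quat \<Rightarrow> quat) \<Rightarrow> ext2 grading" where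
  "S8_grading \<phi> =
     tensor_grading (tensor_null type_space ext_right type_space (ext_left \<phi>)) ext_grading ext_grading"

definition c8 :: "(quat \<Rightarrow> quat) \<Rightarrow> real vec \<Rightarrow> ext2 \<Rightarrow> ext2" where
  "c8 \<phi> = tensor_clifford type_space ext_grading ext_right type_space (ext_left \<phi>) 4 c4 4 c4"

type_synonym spin_0_elt = "(ext2 list \<Rightarrow>\<^sub>0 real) set"

definition spin_0 :: "(quat \<Rightarrow> quat) \<Rightarrow> nat \<Rightarrow> (real, spin_0_elt) module" where
  "spin_0 \<phi> k = tensor_power (S8 \<phi>) k"

definition grading_0 :: "(quat \<Rightarrow> quat) \<Rightarrow> nat \<Rightarrow> spin_0_elt grading" where
  "grading_0 \<phi> k = power_grading (S8 \<phi>) k (S8_grading \<phi>)"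

definition act_0 :: "(quat \<Rightarrow> quat) \<Rightarrow> nat \<Rightarrow> real vec \<Rightarrow> spin_0_elt \<Rightarrow> spin_0_elt" where
  "act_0 \<phi> k = power_clifford (S8 \<phi>) (S8_grading \<phi>) 8 (c8 \<phi>) k"

definition spin_0_tensor ::
    "(quat \<Rightarrow> quat) \<Rightarrow> nat \<Rightarrow> (real, ((spin_0_elt \<times> 'b::real_vector) \<Rightarrow>\<^sub>0 real) set) module" where
  "spin_0_tensor \<phi> k = tensor (spin_0 \<phi> k) (right_real (spin_0 \<phi> k)) type_space (*\<^sub>R)"

definition act_0_tensor ::
    "(quat \<Rightarrow> quat) \<Rightarrow> nat \<Rightarrow> nat \<Rightarrow> (real vec \<Rightarrow> 'b::real_vector \<Rightarrow> 'b) \<Rightarrow>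
     real vec \<Rightarrow> ((spin_0_elt \<times> 'b) \<Rightarrow>\<^sub>0 real) set \<Rightarrow> ((spin_0_elt \<times> 'b) \<Rightarrow>\<^sub>0 real) set" where
  "act_0_tensor \<phi> k r c =
     tensor_clifford (spin_0 \<phi> k) (grading_0 \<phi> k) (right_real (spin_0 \<phi> k)) type_space (*\<^sub>R)
       (8 * k) (act_0 \<phi> k) r c"

definition spin_1 :: "(quat \<Rightarrow> quat) \<Rightarrow> nat \<Rightarrow> (real, (spin_0_elt \<times> complex \<Rightarrow>\<^sub>0 real) set) module" where
  "spin_1 \<phi> k = spin_0_tensor \<phi> k"

definition "act_1 \<phi> k = act_0_tensor \<phi> k 1 c1"

definition spin_2 :: "(quat \<Rightarrow> quat) \<Rightarrow> nat \<Rightarrow> (real, (spin_0_elt \<times> quat \<Rightarrow>\<^sub>0 real) set) module" where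
  "spin_2 \<phi> k = spin_0_tensor \<phi> k"

definition "act_2 \<phi> k = act_0_tensor \<phi> k 2 c2"

definition spin_3 :: "(quat \<Rightarrow> quat) \<Rightarrow> nat \<Rightarrow> (real, (spin_0_elt \<times> quat \<Rightarrow>\<^sub>0 real) set) module" where
  "spin_3 \<phi> k = spin_0_tensor \<phi> k"

definition "act_3 \<phi> k = act_0_tensor \<phi> k 3 c3"

type_synonym spin_4_elt = "(spin_0_elt \<times> ext \<Rightarrow>\<^sub>0 real) set"

definition spin_4 :: "(quat \<Rightarrow> quat) \<Rightarrow> nat \<Rightarrow> (real, spin_4_elt) module" where
  "spin_4 \<phi> k = spin_0_tensor \<phi> k"

definition act_4 :: "(quat \<Rightarrow> quat) \<Rightarrow> nat \<Rightarrow> real vec \<Rightarrow> spin_4_elt \<Rightarrow> spin_4_elt" where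
  "act_4 \<phi> k = act_0_tensor \<phi> k 4 c4"

definition spin_4_null :: "(quat \<Rightarrow> quat) \<Rightarrow> nat \<Rightarrow> spin_4_elt" where
  "spin_4_null \<phi> k = tensor_null (spin_0 \<phi> k) (right_real (spin_0 \<phi> k)) type_space (*\<^sub>R)"

definition grading_4 :: "(quat \<Rightarrow> quat) \<Rightarrow> nat \<Rightarrow> spin_4_elt grading" where
  "grading_4 \<phi> k = tensor_grading (spin_4_null \<phi> k) (grading_0 \<phi> k) ext_grading"

definition spin_4_right :: "(quat \<Rightarrow> quat) \<Rightarrow> nat \<Rightarrow> spin_4_elt \<Rightarrow> quat \<Rightarrow> spin_4_elt" where
  "spin_4_right \<phi> k X q = tensor_map (spin_4_null \<phi> k) id (\<lambda>s. ext_right s q) X"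

definition spin_5 ::
    "(quat \<Rightarrow> quat) \<Rightarrow> (complex \<Rightarrow> complex) \<Rightarrow> (complex \<Rightarrow> quat) \<Rightarrow> nat \<Rightarrow>
     (real, (spin_4_elt \<times> complex \<Rightarrow>\<^sub>0 real) set) module" where
  "spin_5 \<phi> \<psi> e k =
     tensor (spin_4 \<phi> k) (\<lambda>X z. spin_4_right \<phi> k X (e z)) type_space (\<lambda>z s. s * \<psi> z)"

definition "act_5 \<phi> \<psi> e k =
  tensor_clifford (spin_4 \<phi> k) (grading_4 \<phi> k) (\<lambda>X z. spin_4_right \<phi> k X (e z))
    type_space (\<lambda>z s. s * \<psi> z) (8 * k + 4) (act_4 \<phi> k) 1 c1"

definition spin_6 ::
    "(quat \<Rightarrow> quat) \<Rightarrow> nat \<Rightarrow> (real, (spin_4_elt \<times> quat \<Rightarrow>\<^sub>0 real) set) module" where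
  "spin_6 \<phi> k = tensor (spin_4 \<phi> k) (spin_4_right \<phi> k) type_space (\<lambda>q s. s * \<phi> q)"

definition "act_6 \<phi> k =
  tensor_clifford (spin_4 \<phi> k) (grading_4 \<phi> k) (spin_4_right \<phi> k)
    type_space (\<lambda>q s. s * \<phi> q) (8 * k + 4) (act_4 \<phi> k) 2 c2"

definition spin_7 ::
    "(quat \<Rightarrow> quat) \<Rightarrow> nat \<Rightarrow> (real, (spin_4_elt \<times> quat \<Rightarrow>\<^sub>0 real) set) module" where
  "spin_7 \<phi> k = tensor (spin_4 \<phi> k) (spin_4_right \<phi> k) type_space (\<lambda>q s. s * \<phi> q)"

definition "act_7 \<phi> k =
  tensor_clifford (spin_4 \<phi> k) (grading_4 \<phi> k) (spin_4_right \<phi> k)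
    type_space (\<lambda>q s. s * \<phi> q) (8 * k + 4) (act_4 \<phi> k) 3 c3"

end

theory Submission
  imports Defs
begin

text \<open>
  That the composite maps satisfy the Clifford condition is the sign rule: an odd operator
  anticommutes with the parity map that is put in front of the operators on later factors, so the
  mixed terms cancel (\<open>act_clifford\<close>, \<open>term_anticommute\<close>, \<open>partial_act_clifford\<close>). What remains is
  irreducibility, and for this only the algebra of operators generated by the Clifford map matters
  (\<open>opalg\<close>, \<open>irreducible_viaI\<close>).

  The periodicity comes from the fact that the operators generated on \<open>S\<^sub>8\<close> are all real-linear
  ones. This is used in a form without bases: the algebra contains an operator \<open>p = \<beta>(\<cdot>) b\<close> of rank
  one, and the two-sided ideal of \<open>p\<close> contains \<open>1\<close> (\<open>full_real\<close>). The equation \<open>1 = \<Sum> a p a'\<close> then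
  plays the role of a pair of dual bases. It shows, as in Morita theory, that a stable subspace of
  \<open>V \<otimes> W\<close> is determined by its intersection with \<open>b \<otimes> W\<close>, so that irreducibility of \<open>W\<close> is inherited
  by \<open>V \<otimes> W\<close> (\<open>tensor_irreducible\<close>); here the operators \<open>1 \<otimes> c' v\<close> are available because the parity
  of \<open>V\<close> is itself generated. The property passes to tensor powers with \<open>p \<otimes> \<dots> \<otimes> p\<close> in place of \<open>p\<close>
  (\<open>power_full\<close>). Hence \<open>S\<^bsub>8k\<^esub>\<close> is irreducible, and so is its tensor product with \<open>S\<^sub>1, \<dots>, S\<^sub>4\<close>.

  On \<open>S\<^sub>4\<close> the map \<open>c4\<close> generates all two by two matrices over \<open>\<bbbH>\<close> (\<open>mat2_in_A4\<close>). The tensor product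
  \<open>S\<^sub>8 = S\<^sub>4 \<otimes>\<^sub>\<bbbH> S\<^sub>4\<close> is a copy of the two by two matrices over \<open>\<bbbH>\<close>, with operators of the first factor
  acting from the left and, by the identification of \<open>\<bbbH>\<close> with its opposite, those of the second from
  the right. The matrix units cut out a corner \<open>\<bbbH> \<otimes>\<^sub>\<bbbH> \<bbbH> = \<bbbH>\<close> on which both multiplications act, and
  \<open>z - izi - jzj - kzk = 4 Re z\<close> provides the operator of rank one (\<open>S8_full\<close>).

  In \<open>S\<^bsub>8k+5\<^esub>\<close>, \<open>S\<^bsub>8k+6\<^esub>\<close>, \<open>S\<^bsub>8k+7\<^esub>\<close> every tensor has the form \<open>X \<otimes> 1\<close>, so these are quotients of the
  irreducible \<open>S\<^bsub>8k+4\<^esub>\<close> (\<open>tensor_irreducible_quotient\<close>), and \<open>\<beta>\<close> provides a functional that shows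
  that they do not vanish.

  The description of \<open>Cl 4\<close> is separate: the sixteen ordered products of basis vectors span it, and
  their coefficients can be read off from the images of \<open>(1, 0)\<close> and \<open>(0, 1)\<close> (\<open>Cl_4_iso_End\<close>).
\<close>

section \<open>Real vector spaces as records\<close>

lemma real_ring_sel [simp]:
  "carrier real_ring = UNIV" "x \<otimes>\<^bsub>real_ring\<^esub> y = x * y" "\<one>\<^bsub>real_ring\<^esub> = 1"
  "\<zero>\<^bsub>real_ring\<^esub> = 0" "x \<oplus>\<^bsub>real_ring\<^esub> y = x + y"
  by (simp_all add: real_ring_def)

lemma cring_real_ring: "cring real_ring"
proof (rule cringI)
  show "abelian_group real_ring"
    by (rule abelian_groupI) (auto intro: exI[of _ "- x" for x])
  show "comm_monoid real_ring"
    by (rule comm_monoidI) auto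
qed (auto simp: algebra_simps)

locale real_space = Module.module real_ring V for V :: "(real, 'a) module" (structure)

lemma real_spaceI:
  fixes V :: "(real, 'a) module" (structure)
  assumes "\<zero> \<in> carrier V"
    and "\<And>x y. x \<in> carrier V \<Longrightarrow> y \<in> carrier V \<Longrightarrow> x \<oplus> y \<in> carrier V"
    and "\<And>r x. x \<in> carrier V \<Longrightarrow> r \<odot>\<^bsub>V\<^esub> x \<in> carrier V"
    and "\<And>x y z. x \<in> carrier V \<Longrightarrow> y \<in> carrier V \<Longrightarrow> z \<in> carrier V \<Longrightarrow> (x \<oplus> y) \<oplus> z = x \<oplus> (y \<oplus> z)"
    and "\<And>x y. x \<in> carrier V \<Longrightarrow> y \<in> carrier V \<Longrightarrow> x \<oplus> y = y \<oplus> x"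
    and "\<And>x. x \<in> carrier V \<Longrightarrow> \<zero> \<oplus> x = x"
    and "\<And>x. x \<in> carrier V \<Longrightarrow> (- 1) \<odot>\<^bsub>V\<^esub> x \<oplus> x = \<zero>"
    and "\<And>a b x. x \<in> carrier V \<Longrightarrow> (a + b) \<odot>\<^bsub>V\<^esub> x = a \<odot>\<^bsub>V\<^esub> x \<oplus> b \<odot>\<^bsub>V\<^esub> x"
    and "\<And>a x y. x \<in> carrier V \<Longrightarrow> y \<in> carrier V \<Longrightarrow> a \<odot>\<^bsub>V\<^esub> (x \<oplus> y) = a \<odot>\<^bsub>V\<^esub> x \<oplus> a \<odot>\<^bsub>V\<^esub> y"
    and "\<And>a b x. x \<in> carrier V \<Longrightarrow> (a * b) \<odot>\<^bsub>V\<^esub> x = a \<odot>\<^bsub>V\<^esub> (b \<odot>\<^bsub>V\<^esub> x)"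
    and "\<And>x. x \<in> carrier V \<Longrightarrow> 1 \<odot>\<^bsub>V\<^esub> x = x"
  shows "real_space V"
proof -
  have "\<exists>y\<in>carrier V. y \<oplus> x = \<zero>" if "x \<in> carrier V" for x
    using assms(3,7) that by blast
  then have "abelian_group V" by (intro abelian_groupI assms(1,2,4-6))
  then show ?thesis unfolding real_space_def
    by (intro moduleI cring_real_ring) (use assms in auto)
qed

context real_space
begin

lemma smult_in [simp, intro]: "x \<in> carrier V \<Longrightarrow> r \<odot> x \<in> carrier V"
  using smult_closed by simp

lemma smult_add_left: "x \<in> carrier V \<Longrightarrow> (a + b) \<odot> x = a \<odot> x \<oplus> b \<odot> x"
  using smult_l_distr[of a b x] by simp

lemma smult_add_right: "x \<in> carrier V \<Longrightarrow> y \<in> carrier V \<Longrightarrow> a \<odot> (x \<oplus> y) = a \<odot> x \<oplus> a \<odot> y"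
  using smult_r_distr[of a x y] by simp

lemma smult_smult: "x \<in> carrier V \<Longrightarrow> a \<odot> (b \<odot> x) = (a * b) \<odot> x"
  using smult_assoc1[of a b x] by simp

lemma smult_1 [simp]: "x \<in> carrier V \<Longrightarrow> 1 \<odot> x = x"
  using smult_one[of x] by simp

lemma smult_0 [simp]: "x \<in> carrier V \<Longrightarrow> 0 \<odot> x = \<zero>"
  using smult_l_null[of x] by simp

lemma smult_zero [simp]: "r \<odot> \<zero> = \<zero>"
  using smult_r_null[of r] by simp

lemma minus_1_smult: "x \<in> carrier V \<Longrightarrow> (- 1) \<odot> x = \<ominus> x"
  using smult_add_left[of x "- 1" 1] by (simp add: M.minus_equality)

lemma minus_zero [simp]: "\<ominus> \<zero> = \<zero>"
  using minus_1_smult[of \<zero>] by simp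

lemma cancel_cross_terms:
  assumes "a \<in> carrier V" "b \<in> carrier V" "d \<in> carrier V" "e \<in> carrier V" "f \<in> carrier V" "g \<in> carrier V"
  shows "(a \<oplus> \<ominus> b \<oplus> (d \<oplus> e)) \<oplus> (f \<oplus> \<ominus> d \<oplus> (b \<oplus> g)) = (a \<oplus> f) \<oplus> (e \<oplus> g)"
proof -
  have "(a \<oplus> \<ominus> b \<oplus> (d \<oplus> e)) \<oplus> (f \<oplus> \<ominus> d \<oplus> (b \<oplus> g)) = (a \<oplus> f) \<oplus> (e \<oplus> g) \<oplus> (b \<oplus> \<ominus> b) \<oplus> (d \<oplus> \<ominus> d)"
    using assms by (simp only: a_ac a_closed M.a_inv_closed)
  then show ?thesis using assms by (simp add: M.r_neg)
qed

lemma subspaceD: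
  assumes "submodule W real_ring V"
  shows "W \<subseteq> carrier V" "\<zero> \<in> W" "x \<in> W \<Longrightarrow> y \<in> W \<Longrightarrow> x \<oplus> y \<in> W" "x \<in> W \<Longrightarrow> r \<odot> x \<in> W"
  using submoduleE[OF assms] by auto
    (metis assms add.subgroupE(2) ex_in_conv submodule.axioms(1) subgroup.one_closed monoid.select_convs(2) partial_object.select_convs(1))

lemma subspaceI:
  assumes "W \<subseteq> carrier V" "\<zero> \<in> W" "\<And>x y. x \<in> W \<Longrightarrow> y \<in> W \<Longrightarrow> x \<oplus> y \<in> W" "\<And>r x. x \<in> W \<Longrightarrow> r \<odot> x \<in> W"
  shows "submodule W real_ring V"
proof (rule submoduleI)
  show "\<ominus> x \<in> W" if "x \<in> W" for x using assms(4)[OF that, of "-1"] assms(1) that by (auto simp: minus_1_smult)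
qed (use assms in auto)

end

lemma type_space_sel [simp]:
  "carrier type_space = UNIV" "\<zero>\<^bsub>type_space\<^esub> = 0" "x \<oplus>\<^bsub>type_space\<^esub> y = x + y" "r \<odot>\<^bsub>type_space\<^esub> x = r *\<^sub>R x"
  by (simp_all add: type_space_def)

lemma real_space_type_space: "real_space type_space"
  by (rule real_spaceI) (auto simp: algebra_simps)

lemma type_space_minus [simp]: "\<ominus>\<^bsub>type_space\<^esub> x = - x"
  using real_space.minus_1_smult[OF real_space_type_space, of x] by simp

lemma real_linear_onD:
  assumes "real_linear_on V W f"
  shows "x \<in> carrier V \<Longrightarrow> f x \<in> carrier W"
    "x \<in> carrier V \<Longrightarrow> y \<in> carrier V \<Longrightarrow> f (x \<oplus>\<^bsub>V\<^esub> y) = f x \<oplus>\<^bsub>W\<^esub> f y"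
    "x \<in> carrier V \<Longrightarrow> f (r \<odot>\<^bsub>V\<^esub> x) = r \<odot>\<^bsub>W\<^esub> f x"
  using assms by (auto simp: real_linear_on_def)

lemma real_linear_onI:
  assumes "\<And>x. x \<in> carrier V \<Longrightarrow> f x \<in> carrier W"
    "\<And>x y. x \<in> carrier V \<Longrightarrow> y \<in> carrier V \<Longrightarrow> f (x \<oplus>\<^bsub>V\<^esub> y) = f x \<oplus>\<^bsub>W\<^esub> f y"
    "\<And>r x. x \<in> carrier V \<Longrightarrow> f (r \<odot>\<^bsub>V\<^esub> x) = r \<odot>\<^bsub>W\<^esub> f x"
  shows "real_linear_on V W f"
  using assms by (auto simp: real_linear_on_def)

lemma real_linear_on_zero:
  assumes "real_space V" "real_space W" "real_linear_on V W f" shows "f \<zero>\<^bsub>V\<^esub> = \<zero>\<^bsub>W\<^esub>"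
proof -
  interpret V: real_space V by fact
  interpret W: real_space W by fact
  have "f (0 \<odot>\<^bsub>V\<^esub> \<zero>\<^bsub>V\<^esub>) = 0 \<odot>\<^bsub>W\<^esub> f \<zero>\<^bsub>V\<^esub>" using assms(3) by (simp only: real_linear_onD V.M.zero_closed)
  then show ?thesis using real_linear_onD(1)[OF assms(3)] by simp
qed

lemma real_linear_on_comp:
  "real_linear_on V W f \<Longrightarrow> real_linear_on U V g \<Longrightarrow> real_linear_on U W (\<lambda>x. f (g x))"
  by (auto simp: real_linear_on_def Pi_iff)

lemma real_linear_on_id: "real_linear_on V V (\<lambda>x. x)" "real_linear_on V V id"
  by (auto simp: real_linear_on_def)

lemma real_linear_on_cong:
  assumes "real_space V" "real_linear_on V W f" "\<And>x. x \<in> carrier V \<Longrightarrow> g x = f x"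
  shows "real_linear_on V W g"
proof -
  interpret real_space V by fact
  show ?thesis using assms(2,3) by (auto simp: real_linear_on_def Pi_iff)
qed

lemma real_linear_on_add:
  assumes "real_space W" "real_linear_on V W f" "real_linear_on V W g"
  shows "real_linear_on V W (\<lambda>x. f x \<oplus>\<^bsub>W\<^esub> g x)"
proof -
  interpret W: real_space W by fact
  show ?thesis
    by (rule real_linear_onI)
      (auto simp: real_linear_onD[OF assms(2)] real_linear_onD[OF assms(3)] W.M.a_ac W.smult_add_right)
qed

lemma real_linear_on_smult:
  assumes "real_space W" "real_linear_on V W f"
  shows "real_linear_on V W (\<lambda>x. r \<odot>\<^bsub>W\<^esub> f x)"
proof -
  interpret W: real_space W by fact
  show ?thesis
    by (rule real_linear_onI)
      (auto simp: real_linear_onD[OF assms(2)] W.smult_add_right W.smult_smult mult.commute)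
qed

lemma real_linear_on_minus:
  assumes "real_space W" "real_linear_on V W f" shows "real_linear_on V W (\<lambda>x. \<ominus>\<^bsub>W\<^esub> f x)"
proof -
  interpret W: real_space W by fact
  show ?thesis
  proof (rule real_linear_onI)
    show "\<ominus>\<^bsub>W\<^esub> f (r \<odot>\<^bsub>V\<^esub> x) = r \<odot>\<^bsub>W\<^esub> (\<ominus>\<^bsub>W\<^esub> f x)" if "x \<in> carrier V" for r x
      using real_linear_onD[OF assms(2)] that by (simp add: W.smult_smult flip: W.minus_1_smult)
  qed (simp_all add: real_linear_onD[OF assms(2)] W.M.minus_add)
qed

lemma real_linear_on_type_space [simp]: "real_linear_on type_space type_space f \<longleftrightarrow> linear f"
  by (auto simp: real_linear_on_def linear_iff)

text \<open>The counterpart of \<^const>\<open>lin_ext\<close> for values in a record; it defines the action of \<open>Cl n\<close> on a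
  module whose carrier is a set of cosets.\<close>

definition lin_ext_on :: "(real, 'a) module \<Rightarrow> ('x \<Rightarrow> 'a) \<Rightarrow> ('x \<Rightarrow>\<^sub>0 real) \<Rightarrow> 'a" where
  "lin_ext_on V g f = (\<Oplus>\<^bsub>V\<^esub>x\<in>Poly_Mapping.keys f. Poly_Mapping.lookup f x \<odot>\<^bsub>V\<^esub> g x)"

context real_space
begin

lemma lin_ext_on_superset:
  assumes "finite A" "Poly_Mapping.keys f \<subseteq> A" "g \<in> A \<rightarrow> carrier V"
  shows "lin_ext_on V g f = (\<Oplus>x\<in>A. Poly_Mapping.lookup f x \<odot> g x)"
  unfolding lin_ext_on_def using assms
  by (intro M.add.finprod_mono_neutral_cong_left) (auto simp: in_keys_iff Pi_iff subset_iff)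

lemma lin_ext_on_closed [simp]: "g \<in> Poly_Mapping.keys f \<rightarrow> carrier V \<Longrightarrow> lin_ext_on V g f \<in> carrier V"
  unfolding lin_ext_on_def by (rule M.finsum_closed) auto

lemma lin_ext_on_add:
  assumes "g \<in> Poly_Mapping.keys f \<rightarrow> carrier V" "g \<in> Poly_Mapping.keys h \<rightarrow> carrier V"
  shows "lin_ext_on V g (f + h) = lin_ext_on V g f \<oplus> lin_ext_on V g h"
proof -
  let ?A = "Poly_Mapping.keys f \<union> Poly_Mapping.keys h"
  have g: "g \<in> ?A \<rightarrow> carrier V" using assms by auto
  have "Poly_Mapping.keys (f + h) \<subseteq> ?A" by (rule Poly_Mapping.keys_add)
  then have "lin_ext_on V g (f + h) = (\<Oplus>x\<in>?A. Poly_Mapping.lookup f x \<odot> g x \<oplus> Poly_Mapping.lookup h x \<odot> g x)"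
    using g by (subst lin_ext_on_superset[of ?A])
      (simp_all del: M.finsum_addf, intro M.finsum_cong', auto simp: lookup_add smult_add_left Pi_iff)
  also have "\<dots> = lin_ext_on V g f \<oplus> lin_ext_on V g h"
    using g lin_ext_on_superset[of ?A f g] lin_ext_on_superset[of ?A h g] by (simp add: Pi_iff M.finsum_addf)
  finally show ?thesis .
qed

lemma lin_ext_on_zero [simp]: "lin_ext_on V g 0 = \<zero>"
  by (simp add: lin_ext_on_def)

lemma lin_ext_on_single [simp]: "g x \<in> carrier V \<Longrightarrow> lin_ext_on V g (Poly_Mapping.single x r) = r \<odot> g x"
  by (simp add: lin_ext_on_def)

end

section \<open>Free spaces and quotients\<close>

lemma linear_lin_ext: "linear (lin_ext g)"
proof (rule linearI)
  show "lin_ext g (r *\<^sub>R f) = r *\<^sub>R lin_ext g f" for r f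
  proof (induction f rule: poly_mapping_sum_induct)
    case (single k v)
    then show ?case by (simp add: scaleR_single lin_ext_single)
  next
    case (sum f h)
    then show ?case by (simp add: lin_ext_add scaleR_add_right)
  qed
qed (rule lin_ext_add)

lemma subspace_free_on: "subspace (free_on X)"
proof (rule subspaceI)
  show "r *\<^sub>R f \<in> free_on X" if "f \<in> free_on X" for r f
    using that by (auto simp: free_on_def in_keys_iff scaleR_poly_mapping_def Abs_poly_mapping_inverse)
qed (use Poly_Mapping.keys_add in \<open>force simp: free_on_def\<close>)+

lemma single_in_free_on [simp]: "x \<in> X \<Longrightarrow> Poly_Mapping.single x r \<in> free_on X"
  by (auto simp: free_on_def)

lemma free_on_induct [consumes 1, case_names zero single add]:
  assumes "f \<in> free_on X" "P 0" "\<And>x r. x \<in> X \<Longrightarrow> P (Poly_Mapping.single x r)"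
    and "\<And>f g. f \<in> free_on X \<Longrightarrow> g \<in> free_on X \<Longrightarrow> P f \<Longrightarrow> P g \<Longrightarrow> P (f + g)"
  shows "P f"
  using assms(1)
proof (induction f rule: update_induct)
  case const
  show ?case by (rule assms(2))
next
  case (update f a b)
  have e: "Poly_Mapping.update a b f = f + Poly_Mapping.single a b"
    using update(1) by (intro poly_mapping_eqI) (auto simp: lookup_update lookup_add lookup_single when_def in_keys_iff)
  have k: "Poly_Mapping.keys (Poly_Mapping.update a b f) = insert a (Poly_Mapping.keys f)"
    using update(2) by (auto simp: in_keys_iff lookup_update split: if_splits)
  with update(4) have "a \<in> X" "f \<in> free_on X" by (auto simp: free_on_def)
  then show ?case unfolding e using update(3) by (intro assms(3,4)) auto
qed

lemma quot_space_sel [simp]: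
  "carrier (quot_space U N) = coset N ` U" "\<zero>\<^bsub>quot_space U N\<^esub> = coset N 0"
  by (simp_all add: quot_space_def)

lemma quot_space_add [simp]:
  "subspace N \<Longrightarrow> coset N x \<oplus>\<^bsub>quot_space U N\<^esub> coset N y = coset N (x + y)"
  by (simp add: quot_space_def coset_add)

lemma quot_space_smult [simp]:
  "subspace N \<Longrightarrow> r \<odot>\<^bsub>quot_space U N\<^esub> coset N x = coset N (r *\<^sub>R x)"
  by (simp add: quot_space_def coset_scale)

lemma real_space_quot_space:
  assumes "subspace U" "subspace N" shows "real_space (quot_space U N)"
  by (rule real_spaceI)
    (use assms in \<open>auto simp: algebra_simps intro!: imageI subspace_0 subspace_add subspace_scale\<close>)

lemma quot_space_minus [simp]:
  assumes "subspace U" "subspace N" "x \<in> U" shows "\<ominus>\<^bsub>quot_space U N\<^esub> coset N x = coset N (- x)"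
  using real_space.minus_1_smult[OF real_space_quot_space[OF assms(1,2)], of "coset N x"] assms by simp

lemma coset_lift:
  assumes "subspace N" "linear L" "L ` N \<subseteq> N"
  shows "(\<Union>f\<in>coset N x. coset N (L f)) = coset N (L x)"
proof -
  have "coset N (L u) = coset N (L x)" if "u \<in> coset N x" for u
  proof -
    from that obtain n where "n \<in> N" "u = x + n" by (auto simp: coset_def)
    with assms(2,3) have "L u - L x \<in> N" by (auto simp: linear_add)
    then show ?thesis using coset_eq_iff[OF assms(1)] by blast
  qed
  moreover have "x \<in> coset N x" unfolding coset_def using subspace_0[OF assms(1)] by force
  ultimately show ?thesis by blast
qed

text \<open>The choice of the representative is immaterial as soon as \<open>F\<close> is constant on cosets.\<close>

definition quot_lift :: "('v::real_vector \<Rightarrow> 'w) \<Rightarrow> 'v set \<Rightarrow> 'w" where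
  "quot_lift F X = F (SOME x. x \<in> X)"

lemma quot_lift:
  assumes "subspace N" "N \<subseteq> U" "subspace U" "x \<in> U"
    and "\<And>x n. x \<in> U \<Longrightarrow> n \<in> N \<Longrightarrow> F (x + n) = F x"
  shows "quot_lift F (coset N x) = F x"
proof -
  have "x \<in> coset N x" unfolding coset_def using subspace_0[OF assms(1)] by force
  then have "(SOME y. y \<in> coset N x) \<in> coset N x" by (rule someI)
  then show ?thesis using assms(4,5) by (auto simp: quot_lift_def coset_def)
qed

lemma quot_lift_linear:
  assumes "subspace N" "N \<subseteq> U" "subspace U" "linear L" "\<And>n. n \<in> N \<Longrightarrow> L n = 0"
  shows "real_linear_on (quot_space U N) type_space (quot_lift L)"
    and "x \<in> U \<Longrightarrow> quot_lift L (coset N x) = L x"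
proof -
  have q: "quot_lift L (coset N x) = L x" if "x \<in> U" for x
    using that assms by (intro quot_lift) (auto simp: linear_add)
  then show "x \<in> U \<Longrightarrow> quot_lift L (coset N x) = L x" .
  show "real_linear_on (quot_space U N) type_space (quot_lift L)"
    by (rule real_linear_onI)
      (use assms(1,3,4) in \<open>auto simp: q subspace_add subspace_scale linear_add linear_scale\<close>)
qed

lemma quot_free_induct [consumes 2, case_names zero gen add smult]:
  assumes "subspace N" "X \<in> carrier (quot_space (free_on A) N)"
    and "P \<zero>\<^bsub>quot_space (free_on A) N\<^esub>" "\<And>a. a \<in> A \<Longrightarrow> P (coset N (gen a))"
    and "\<And>x y. x \<in> carrier (quot_space (free_on A) N) \<Longrightarrow> y \<in> carrier (quot_space (free_on A) N) \<Longrightarrow>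
           P x \<Longrightarrow> P y \<Longrightarrow> P (x \<oplus>\<^bsub>quot_space (free_on A) N\<^esub> y)"
    and "\<And>r x. x \<in> carrier (quot_space (free_on A) N) \<Longrightarrow> P x \<Longrightarrow> P (r \<odot>\<^bsub>quot_space (free_on A) N\<^esub> x)"
  shows "P X"
proof -
  from assms(2) obtain f where f: "f \<in> free_on A" "X = coset N f" by auto
  from f(1) have "P (coset N f)"
  proof (induction rule: free_on_induct)
    case zero
    then show ?case using assms(3) by simp
  next
    case (single x r)
    then show ?case using assms(6)[OF _ assms(4)[of x], of r] assms(1) by (simp add: scaleR_single)
  next
    case (add f g)
    then show ?case using assms(5)[of "coset N f" "coset N g"] assms(1) by simp
  qed
  with f show ?thesis by simp
qed

lemma quot_free_linear_eq:
  assumes "subspace N" "real_space Z"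
    and "real_linear_on (quot_space (free_on A) N) Z f" "real_linear_on (quot_space (free_on A) N) Z g"
    and "\<And>a. a \<in> A \<Longrightarrow> f (coset N (gen a)) = g (coset N (gen a))"
    and "X \<in> carrier (quot_space (free_on A) N)"
  shows "f X = g X"
  using assms(1,6)
proof (induction X rule: quot_free_induct)
  case zero
  then show ?case
    using real_linear_on_zero[OF real_space_quot_space[OF subspace_free_on assms(1)] assms(2)] assms(3,4) by metis
next
  case (gen a)
  then show ?case by (rule assms(5))
next
  case (add x y)
  then show ?case using real_linear_onD(2)[OF assms(3)] real_linear_onD(2)[OF assms(4)] by simp
next
  case (smult r x)
  then show ?case using real_linear_onD(3)[OF assms(3)] real_linear_onD(3)[OF assms(4)] by simp
qed

section \<open>The Clifford algebra and its modules\<close>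

lemma free_on_lists_mult:
  assumes "f \<in> free_on (lists A)" "g \<in> free_on (lists A)" shows "f * g \<in> free_on (lists A)"
  using assms(1)
proof (induction rule: free_on_induct)
  case zero
  then show ?case using subspace_0[OF subspace_free_on] by simp
next
  case (single v r)
  show ?case using assms(2)
  proof (induction rule: free_on_induct)
    case zero
    then show ?case using subspace_0[OF subspace_free_on] by simp
  next
    case (single w s)
    then show ?case using \<open>v \<in> lists A\<close> by (simp add: mult_single plus_list_def)
  next
    case (add f g)
    then show ?case by (simp add: distrib_left subspace_add[OF subspace_free_on])
  qed
next
  case (add f g)
  then show ?case by (simp add: distrib_right subspace_add[OF subspace_free_on])
qed

lemma one_eq_gen_Nil: "(1 :: 'x list \<Rightarrow>\<^sub>0 real) = gen []"
  by (simp flip: zero_list_def)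

lemma one_in_free_on_lists: "1 \<in> free_on (lists A)"
  by (simp add: one_eq_gen_Nil)

abbreviation clifford_words :: "nat \<Rightarrow> (real vec list \<Rightarrow>\<^sub>0 real) set" where
  "clifford_words n \<equiv> free_on (lists (carrier_vec n))"

lemma clifford_relators_words: "clifford_relators n \<subseteq> clifford_words n"
  unfolding clifford_relators_def
  by (auto simp: one_eq_gen_Nil mult_single plus_list_def
      intro!: subspace_diff[OF subspace_free_on] subspace_add[OF subspace_free_on] subspace_scale[OF subspace_free_on])

lemma subspace_clifford_ideal: "subspace (clifford_ideal n)"
  by (simp add: clifford_ideal_def two_sided_ideal_def)

lemma clifford_ideal_words: "clifford_ideal n \<subseteq> clifford_words n"
  unfolding clifford_ideal_def two_sided_ideal_def
  by (rule span_minimal) (use clifford_relators_words in \<open>auto intro!: subspace_free_on free_on_lists_mult\<close>)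

lemma clifford_ideal_mult:
  assumes "f \<in> clifford_words n" "x \<in> clifford_ideal n" shows "f * x \<in> clifford_ideal n" "x * f \<in> clifford_ideal n"
proof -
  let ?G = "{a * r * b |a r b. a \<in> clifford_words n \<and> r \<in> clifford_relators n \<and> b \<in> clifford_words n}"
  have "f * x \<in> span ?G \<and> x * f \<in> span ?G"
    using assms(2) unfolding clifford_ideal_def two_sided_ideal_def
  proof (induction rule: span_induct_alt)
    case base
    then show ?case by (simp add: span_zero)
  next
    case (step c x y)
    then obtain a r b where x: "x = a * r * b" "a \<in> clifford_words n" "r \<in> clifford_relators n" "b \<in> clifford_words n"
      by auto
    have "f * x \<in> ?G"
      using x assms(1) by (intro CollectI exI[of _ "f * a"] exI[of _ r] exI[of _ b]) (simp add: mult.assoc free_on_lists_mult)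
    moreover have "x * f \<in> ?G"
      using x assms(1) by (intro CollectI exI[of _ a] exI[of _ r] exI[of _ "b * f"]) (simp add: mult.assoc free_on_lists_mult)
    ultimately show ?case using step
      by (auto simp: distrib_left distrib_right scaleR_mult_right scaleR_mult_left intro!: span_add span_scale intro: span_base)
  qed
  then show "f * x \<in> clifford_ideal n" "x * f \<in> clifford_ideal n"
    by (auto simp: clifford_ideal_def two_sided_ideal_def)
qed

lemma clifford_relator_in_ideal: "r \<in> clifford_relators n \<Longrightarrow> r \<in> clifford_ideal n"
  unfolding clifford_ideal_def two_sided_ideal_def
  by (rule span_base, intro CollectI exI[of _ 1] exI[of _ r]) (simp add: one_in_free_on_lists)

lemma Cl_sel:
  "carrier (Cl n) = coset (clifford_ideal n) ` clifford_words n" "\<zero>\<^bsub>Cl n\<^esub> = coset (clifford_ideal n) 0"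
  "\<one>\<^bsub>Cl n\<^esub> = coset (clifford_ideal n) 1"
  "coset (clifford_ideal n) x \<oplus>\<^bsub>Cl n\<^esub> coset (clifford_ideal n) y = coset (clifford_ideal n) (x + y)"
  "r \<odot>\<^bsub>Cl n\<^esub> coset (clifford_ideal n) x = coset (clifford_ideal n) (r *\<^sub>R x)"
  using coset_add[OF subspace_clifford_ideal] coset_scale[OF subspace_clifford_ideal]
  by (simp_all add: Cl_def quot_alg_def quot_space_def)

lemma Cl_mult:
  assumes "x \<in> clifford_words n" "y \<in> clifford_words n"
  shows "coset (clifford_ideal n) x \<otimes>\<^bsub>Cl n\<^esub> coset (clifford_ideal n) y = coset (clifford_ideal n) (x * y)"
proof -
  let ?N = "clifford_ideal n"
  note N = subspace_clifford_ideal[of n]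
  have "coset ?N (u * v) = coset ?N (x * y)" if uv: "u \<in> coset ?N x" "v \<in> coset ?N y" for u v
  proof -
    from uv obtain m k where mk: "m \<in> ?N" "k \<in> ?N" "u = x + m" "v = y + k" by (auto simp: coset_def)
    then have "k \<in> clifford_words n" using clifford_ideal_words by auto
    then have "y + k \<in> clifford_words n" using assms subspace_add[OF subspace_free_on] by blast
    moreover have "u * v - x * y = x * k + m * (y + k)" using mk by (simp add: algebra_simps)
    ultimately have "u * v - x * y \<in> ?N"
      using subspace_add[OF N clifford_ideal_mult(1)[OF assms(1) mk(2)] clifford_ideal_mult(2)[of "y + k" n m]] mk(1) by simp
    then show ?thesis unfolding coset_eq_iff[OF N] .
  qed
  moreover have "x \<in> coset ?N x" "y \<in> coset ?N y"
    unfolding coset_def using subspace_0[OF N] by force+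
  ultimately have "(\<Union>u\<in>coset ?N x. \<Union>v\<in>coset ?N y. coset ?N (u * v)) = coset ?N (x * y)" by blast
  then show ?thesis by (simp add: Cl_def quot_alg_def)
qed

lemma real_space_Cl: "real_space (Cl n)"
  by (rule real_spaceI)
    (auto simp: Cl_sel algebra_simps
      intro!: imageI subspace_0 subspace_add subspace_scale subspace_free_on)

lemma real_algebra_Cl: "real_algebra (Cl n)"
proof -
  have "ring (Cl n)"
  proof (rule ringI)
    show "abelian_group (Cl n)" using real_space_Cl[of n]
      by (simp add: real_space_def Module.module_def)
    show "monoid (Cl n)"
      by (rule monoidI) (auto simp: Cl_sel Cl_mult free_on_lists_mult one_in_free_on_lists mult.assoc)
  qed (auto simp: Cl_sel Cl_mult free_on_lists_mult subspace_add[OF subspace_free_on] algebra_simps)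
  then show ?thesis using real_space_Cl[of n]
    by (auto simp: real_algebra_def real_space_def Cl_sel Cl_mult free_on_lists_mult
        subspace_scale[OF subspace_free_on] scaleR_mult_left scaleR_mult_right)
qed

lemma clifford_mapD:
  assumes "clifford_map n V c"
  shows "v \<in> carrier_vec n \<Longrightarrow> real_linear_on V V (c v)"
    "v \<in> carrier_vec n \<Longrightarrow> w \<in> carrier_vec n \<Longrightarrow> s \<in> carrier V \<Longrightarrow> c (v + w) s = c v s \<oplus>\<^bsub>V\<^esub> c w s"
    "v \<in> carrier_vec n \<Longrightarrow> s \<in> carrier V \<Longrightarrow> c (r \<cdot>\<^sub>v v) s = r \<odot>\<^bsub>V\<^esub> c v s"
    "v \<in> carrier_vec n \<Longrightarrow> w \<in> carrier_vec n \<Longrightarrow> s \<in> carrier V \<Longrightarrow>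
        c v (c w s) \<oplus>\<^bsub>V\<^esub> c w (c v s) = (- 2 * scalar_prod v w) \<odot>\<^bsub>V\<^esub> s"
  using assms by (auto simp: clifford_map_def real_linear_on_def module_vec_simps)

lemma clifford_mapI:
  assumes "\<And>v. v \<in> carrier_vec n \<Longrightarrow> real_linear_on V V (c v)"
    "\<And>v w s. v \<in> carrier_vec n \<Longrightarrow> w \<in> carrier_vec n \<Longrightarrow> s \<in> carrier V \<Longrightarrow> c (v + w) s = c v s \<oplus>\<^bsub>V\<^esub> c w s"
    "\<And>r v s. v \<in> carrier_vec n \<Longrightarrow> s \<in> carrier V \<Longrightarrow> c (r \<cdot>\<^sub>v v) s = r \<odot>\<^bsub>V\<^esub> c v s"
    "\<And>v w s. v \<in> carrier_vec n \<Longrightarrow> w \<in> carrier_vec n \<Longrightarrow> s \<in> carrier V \<Longrightarrow>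
        c v (c w s) \<oplus>\<^bsub>V\<^esub> c w (c v s) = (- 2 * scalar_prod v w) \<odot>\<^bsub>V\<^esub> s"
  shows "clifford_map n V c"
  using assms unfolding clifford_map_def real_linear_on_def[of "module_vec TYPE(real) n"]
  by (auto simp: module_vec_simps dest: real_linear_onD(1))

definition word_act :: "(real vec \<Rightarrow> 's \<Rightarrow> 's) \<Rightarrow> real vec list \<Rightarrow> 's \<Rightarrow> 's" where
  "word_act c w s = foldr c w s"

definition poly_act ::
    "(real, 's) module \<Rightarrow> (real vec \<Rightarrow> 's \<Rightarrow> 's) \<Rightarrow> (real vec list \<Rightarrow>\<^sub>0 real) \<Rightarrow> 's \<Rightarrow> 's" where
  "poly_act V c f s = lin_ext_on V (\<lambda>w. word_act c w s) f"

definition Cl_act ::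
    "(real, 's) module \<Rightarrow> (real vec \<Rightarrow> 's \<Rightarrow> 's) \<Rightarrow> (real vec list \<Rightarrow>\<^sub>0 real) set \<Rightarrow> 's \<Rightarrow> 's" where
  "Cl_act V c X s = quot_lift (\<lambda>f. poly_act V c f s) X"

locale clifford_space = real_space V for V :: "(real, 's) module" (structure) +
  fixes n :: nat and c :: "real vec \<Rightarrow> 's \<Rightarrow> 's"
  assumes clifford: "clifford_map n V c"
begin

lemmas c_linear = clifford_mapD(1)[OF clifford]
lemmas c_smult = real_linear_onD(3)[OF clifford_mapD(1)[OF clifford]]
lemmas c_vadd = clifford_mapD(2)[OF clifford]
lemmas c_vsmult = clifford_mapD(3)[OF clifford]
lemmas c_rel = clifford_mapD(4)[OF clifford]

lemma c_closed [simp]: "v \<in> carrier_vec n \<Longrightarrow> s \<in> carrier V \<Longrightarrow> c v s \<in> carrier V"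
  by (rule real_linear_onD(1)[OF c_linear])

lemma c_zero: "s \<in> carrier V \<Longrightarrow> c (0\<^sub>v n) s = \<zero>"
  using c_vsmult[of "0\<^sub>v n" s 0] by (simp add: smult_vec_def zero_vec_def)

lemma word_act_linear:
  "w \<in> lists (carrier_vec n) \<Longrightarrow> real_linear_on V V (word_act c w)"
proof (induction w)
  case Nil
  then show ?case by (simp add: word_act_def real_linear_on_def)
next
  case (Cons v w)
  then have "real_linear_on V V (\<lambda>s. c v (word_act c w s))"
    by (intro real_linear_on_comp[OF c_linear]) auto
  then show ?case by (simp add: word_act_def)
qed

lemmas word_act_closed [simp] = real_linear_onD(1)[OF word_act_linear]

lemma word_act_pi: "s \<in> carrier V \<Longrightarrow> f \<in> clifford_words n \<Longrightarrow> (\<lambda>w. word_act c w s) \<in> Poly_Mapping.keys f \<rightarrow> carrier V"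
  unfolding free_on_def by (intro Pi_I word_act_closed) blast+

lemma poly_act_closed [simp]: "s \<in> carrier V \<Longrightarrow> f \<in> clifford_words n \<Longrightarrow> poly_act V c f s \<in> carrier V"
  unfolding poly_act_def by (intro lin_ext_on_closed word_act_pi)

lemma poly_act_add:
  "s \<in> carrier V \<Longrightarrow> f \<in> clifford_words n \<Longrightarrow> g \<in> clifford_words n \<Longrightarrow>
    poly_act V c (f + g) s = poly_act V c f s \<oplus> poly_act V c g s"
  unfolding poly_act_def by (intro lin_ext_on_add word_act_pi)

lemma poly_act_0: "poly_act V c 0 s = \<zero>"
  by (simp add: poly_act_def)

lemma poly_act_single:
  "s \<in> carrier V \<Longrightarrow> w \<in> lists (carrier_vec n) \<Longrightarrow> poly_act V c (Poly_Mapping.single w r) s = r \<odot> word_act c w s"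
  unfolding poly_act_def by (intro lin_ext_on_single word_act_closed)

lemma poly_act_one: "s \<in> carrier V \<Longrightarrow> poly_act V c 1 s = s"
  by (simp add: one_eq_gen_Nil poly_act_single word_act_def)

lemma poly_act_gen: "s \<in> carrier V \<Longrightarrow> v \<in> carrier_vec n \<Longrightarrow> poly_act V c (gen [v]) s = c v s"
  by (simp add: poly_act_single word_act_def)

lemma poly_act_scaleR:
  assumes "f \<in> clifford_words n" "s \<in> carrier V" shows "poly_act V c (r *\<^sub>R f) s = r \<odot> poly_act V c f s"
  using assms(1)
proof (induction rule: free_on_induct)
  case zero
  then show ?case by (simp add: poly_act_0)
next
  case (single w a)
  then show ?case using assms(2) by (simp add: scaleR_single poly_act_single smult_smult)
next
  case (add f g)
  then show ?case using assms(2)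
    by (simp add: scaleR_add_right poly_act_add smult_add_right subspace_scale[OF subspace_free_on])
qed

lemma poly_act_linear:
  assumes "f \<in> clifford_words n" shows "real_linear_on V V (poly_act V c f)"
  using assms
proof (induction rule: free_on_induct)
  case zero
  then show ?case by (auto simp: poly_act_0 real_linear_on_def)
next
  case (single w r)
  then show ?case
    by (intro real_linear_on_cong[OF _ real_linear_on_smult[OF _ word_act_linear]])
      (auto simp: poly_act_single real_space_axioms)
next
  case (add f g)
  show ?case
    by (rule real_linear_on_cong[OF _ real_linear_on_add[OF _ add(3,4)]])
      (auto simp: add(1,2) poly_act_add real_space_axioms)
qed

lemma poly_act_mult:
  assumes "f \<in> clifford_words n" "g \<in> clifford_words n" "s \<in> carrier V"
  shows "poly_act V c (f * g) s = poly_act V c f (poly_act V c g s)"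
  using assms(1)
proof (induction rule: free_on_induct)
  case zero
  then show ?case by (simp add: poly_act_0)
next
  case (single v a)
  note v = single
  show ?case using assms(2)
  proof (induction rule: free_on_induct)
    case zero
    then show ?case using real_linear_on_zero[OF real_space_axioms real_space_axioms poly_act_linear[of "Poly_Mapping.single v a"]] v
      by (simp add: poly_act_0)
  next
    case (single w b)
    have "v @ w \<in> lists (carrier_vec n)" using v single by simp
    then have "poly_act V c (Poly_Mapping.single v a * Poly_Mapping.single w b) s = (a * b) \<odot> word_act c v (word_act c w s)"
      using assms(3) by (simp add: mult_single plus_list_def poly_act_single) (simp add: word_act_def)
    also have "\<dots> = poly_act V c (Poly_Mapping.single v a) (b \<odot> word_act c w s)"
      using v single assms(3) real_linear_onD(3)[OF word_act_linear[OF v] word_act_closed[OF single assms(3)], of b]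
      by (simp add: poly_act_single smult_smult)
    finally show ?case using single assms(3) by (simp add: poly_act_single)
  next
    case (add f g)
    then show ?case using v assms(3) real_linear_onD(2)[OF poly_act_linear, of "Poly_Mapping.single v a" "poly_act V c f s" "poly_act V c g s"]
      by (simp add: distrib_left poly_act_add free_on_lists_mult)
  qed
next
  case (add f h)
  then show ?case using assms(2,3) by (simp add: distrib_right poly_act_add free_on_lists_mult)
qed

lemma poly_act_minus:
  assumes "s \<in> carrier V" "f \<in> clifford_words n" "g \<in> clifford_words n"
  shows "poly_act V c (f - g) s = poly_act V c f s \<ominus> poly_act V c g s"
  using poly_act_add[of s f "- g"] poly_act_scaleR[of g s "- 1"] assms subspace_neg[OF subspace_free_on, of g]
  by (simp add: minus_1_smult a_minus_def)

lemma poly_act_relator: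
  assumes "r \<in> clifford_relators n" "s \<in> carrier V" shows "poly_act V c r s = \<zero>"
proof -
  note intros = subspace_diff[OF subspace_free_on] subspace_add[OF subspace_free_on]
      subspace_scale[OF subspace_free_on] free_on_lists_mult one_in_free_on_lists
  consider v w where "v \<in> carrier_vec n" "w \<in> carrier_vec n" "r = gen [v + w] - gen [v] - gen [w]"
    | a v where "v \<in> carrier_vec n" "r = gen [a \<cdot>\<^sub>v v] - a *\<^sub>R gen [v]"
    | v w where "v \<in> carrier_vec n" "w \<in> carrier_vec n"
        "r = gen [v] * gen [w] + gen [w] * gen [v] + (2 * scalar_prod v w) *\<^sub>R 1"
    using assms(1) unfolding clifford_relators_def by blast
  then show ?thesis
  proof cases
    case 1
    then have "poly_act V c r s = c v s \<oplus> c w s \<ominus> c v s \<ominus> c w s"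
      using assms(2) by (simp add: poly_act_minus poly_act_gen c_vadd intros)
    also have "\<dots> = (c v s \<oplus> c w s) \<ominus> (c v s \<oplus> c w s)"
      using 1 assms(2) by (simp add: a_minus_def a_assoc M.minus_add)
    also have "\<dots> = \<zero>" using 1 assms(2) by (simp add: a_minus_def M.r_neg)
    finally show ?thesis .
  next
    case 2
    then show ?thesis
      using assms(2) by (simp add: poly_act_minus poly_act_scaleR poly_act_gen c_vsmult intros M.r_neg a_minus_def)
  next
    case 3
    then have "poly_act V c r s = (- 2 * scalar_prod v w) \<odot> s \<oplus> (2 * scalar_prod v w) \<odot> s"
      using assms(2) c_rel[OF 3(1,2)]
      by (simp add: poly_act_add poly_act_mult poly_act_scaleR poly_act_gen poly_act_one intros)
    then show ?thesis using assms(2) by (simp flip: smult_add_left)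
  qed
qed

lemma poly_act_ideal:
  assumes "x \<in> clifford_ideal n" "s \<in> carrier V" shows "poly_act V c x s = \<zero>"
proof -
  let ?G = "{a * r * b |a r b. a \<in> clifford_words n \<and> r \<in> clifford_relators n \<and> b \<in> clifford_words n}"
  have "x \<in> clifford_words n \<and> poly_act V c x s = \<zero>"
    using assms(1) unfolding clifford_ideal_def two_sided_ideal_def
  proof (induction rule: span_induct_alt)
    case base
    then show ?case by (simp add: poly_act_0 subspace_0[OF subspace_free_on])
  next
    case (step k x y)
    then obtain a r b where x: "x = a * r * b" "a \<in> clifford_words n" "r \<in> clifford_relators n" "b \<in> clifford_words n"
      by auto
    have r: "r \<in> clifford_words n" using x(3) clifford_relators_words by auto
    then have xw: "x \<in> clifford_words n" using x by (simp add: free_on_lists_mult)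
    have "poly_act V c x s = \<zero>"
      using x r assms(2) real_linear_on_zero[OF real_space_axioms real_space_axioms poly_act_linear[OF x(2)]]
      by (simp add: mult.assoc poly_act_mult poly_act_relator free_on_lists_mult)
    then show ?case using step xw assms(2)
      by (simp add: poly_act_add poly_act_scaleR subspace_add[OF subspace_free_on] subspace_scale[OF subspace_free_on])
  qed
  then show ?thesis ..
qed

lemma Cl_act_coset:
  assumes "f \<in> clifford_words n" "s \<in> carrier V"
  shows "Cl_act V c (coset (clifford_ideal n) f) s = poly_act V c f s"
  unfolding Cl_act_def
proof (rule quot_lift[OF subspace_clifford_ideal clifford_ideal_words subspace_free_on assms(1)])
  fix x k assume "x \<in> clifford_words n" "k \<in> clifford_ideal n"
  then show "poly_act V c (x + k) s = poly_act V c x s"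
    using assms(2) clifford_ideal_words poly_act_add[of s x k] by (auto simp: poly_act_ideal)
qed

lemma left_module_Cl_act: "left_module (Cl n) V (Cl_act V c)"
  unfolding left_module_def
proof (intro conjI ballI)
  show "real_algebra (Cl n)" by (rule real_algebra_Cl)
  show "Module.module real_ring V" by (rule module_axioms[unfolded real_space_def]) unfold_locales
  show "real_linear_on V V (Cl_act V c a)" if "a \<in> carrier (Cl n)" for a
    using that by (auto simp: Cl_sel intro!: real_linear_on_cong[OF real_space_axioms poly_act_linear] Cl_act_coset)
  show "real_linear_on (Cl n) V (\<lambda>a. Cl_act V c a s)" if "s \<in> carrier V" for s
    using that by (intro real_linear_onI)
      (auto simp: Cl_sel Cl_act_coset poly_act_add poly_act_scaleR subspace_add[OF subspace_free_on] subspace_scale[OF subspace_free_on])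
  show "Cl_act V c (a \<otimes>\<^bsub>Cl n\<^esub> b) s = Cl_act V c a (Cl_act V c b s)"
    if "a \<in> carrier (Cl n)" "b \<in> carrier (Cl n)" "s \<in> carrier V" for a b s
    using that by (auto simp: Cl_sel Cl_mult Cl_act_coset poly_act_mult free_on_lists_mult)
  show "Cl_act V c \<one>\<^bsub>Cl n\<^esub> s = s" if "s \<in> carrier V" for s
    using that by (simp add: Cl_sel Cl_act_coset one_in_free_on_lists poly_act_one)
qed

lemma extends_Cl_act: "extends_to_Cl n V c (Cl_act V c)"
  unfolding extends_to_Cl_def Cl_vec_def using left_module_Cl_act by (simp add: Cl_act_coset poly_act_gen)

end

lemma Cl_vec_in [simp]: "v \<in> carrier_vec n \<Longrightarrow> Cl_vec n v \<in> carrier (Cl n)"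
  by (simp add: Cl_vec_def Cl_sel)

text \<open>Submodules over the Clifford algebra are stable under the operators \<open>c v\<close>, so irreducibility can
  be tested on stable subspaces; the algebra itself no longer appears.\<close>

definition stable :: "'v set \<Rightarrow> ('v \<Rightarrow> 'a \<Rightarrow> 'a) \<Rightarrow> 'a set \<Rightarrow> bool" where
  "stable A c W \<longleftrightarrow> (\<forall>v\<in>A. \<forall>s\<in>W. c v s \<in> W)"

definition irreducible_under :: "(real, 'a) module \<Rightarrow> nat \<Rightarrow> (real vec \<Rightarrow> 'a \<Rightarrow> 'a) \<Rightarrow> bool" where
  "irreducible_under V n c \<longleftrightarrow>
     (\<forall>W. submodule W real_ring V \<longrightarrow> stable (carrier_vec n) c W \<longrightarrow> W \<noteq> {\<zero>\<^bsub>V\<^esub>} \<longrightarrow> W = carrier V)"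

lemma irreducible_viaI:
  assumes "real_space V" "clifford_map n V c" "carrier V \<noteq> {\<zero>\<^bsub>V\<^esub>}" and irr: "irreducible_under V n c"
  shows "irreducible_via n V c"
proof -
  interpret clifford_space V n c using assms(1,2) by (simp add: clifford_space_def clifford_space_axioms_def)
  have "irreducible_module (Cl n) V \<rho>" if "extends_to_Cl n V c \<rho>" for \<rho>
    unfolding irreducible_module_def
  proof (intro conjI allI impI)
    show "left_module (Cl n) V \<rho>" using that by (simp add: extends_to_Cl_def)
    fix W assume W: "left_submodule (Cl n) V \<rho> W"
    have sub: "submodule W real_ring V" and inv: "\<And>a s. a \<in> carrier (Cl n) \<Longrightarrow> s \<in> W \<Longrightarrow> \<rho> a s \<in> W"
      using W unfolding left_submodule_def by auto
    have ext: "\<And>v s. v \<in> carrier_vec n \<Longrightarrow> s \<in> carrier V \<Longrightarrow> \<rho> (Cl_vec n v) s = c v s"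
      using conjunct2[OF that[unfolded extends_to_Cl_def]] by simp
    have "c v s \<in> W" if "v \<in> carrier_vec n" "s \<in> W" for v s
      using inv[OF Cl_vec_in[OF that(1)] that(2)] ext[OF that(1)] that(2) subspaceD(1)[OF sub] by auto
    then show "W = {\<zero>\<^bsub>V\<^esub>} \<or> W = carrier V"
      using sub irr unfolding stable_def irreducible_under_def by blast
  qed (rule assms(3))
  then show ?thesis unfolding irreducible_via_def using assms(2) extends_Cl_act by blast
qed

section \<open>Operator algebras\<close>

text \<open>The rule \<open>cong\<close> makes membership a question about values on the carrier only; the operators below
  are arbitrary outside of it.\<close>

inductive_set opalg :: "(real, 'a) module \<Rightarrow> ('a \<Rightarrow> 'a) set \<Rightarrow> ('a \<Rightarrow> 'a) set"
  for V :: "(real, 'a) module" and C :: "('a \<Rightarrow> 'a) set" where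
  gen: "f \<in> C \<Longrightarrow> f \<in> opalg V C"
| one: "(\<lambda>x. x) \<in> opalg V C"
| comp: "f \<in> opalg V C \<Longrightarrow> g \<in> opalg V C \<Longrightarrow> (\<lambda>x. f (g x)) \<in> opalg V C"
| add: "f \<in> opalg V C \<Longrightarrow> g \<in> opalg V C \<Longrightarrow> (\<lambda>x. f x \<oplus>\<^bsub>V\<^esub> g x) \<in> opalg V C"
| smult: "f \<in> opalg V C \<Longrightarrow> (\<lambda>x. r \<odot>\<^bsub>V\<^esub> f x) \<in> opalg V C"
| cong: "f \<in> opalg V C \<Longrightarrow> (\<And>x. x \<in> carrier V \<Longrightarrow> g x = f x) \<Longrightarrow> g \<in> opalg V C"

inductive_set opideal :: "(real, 'a) module \<Rightarrow> ('a \<Rightarrow> 'a) set \<Rightarrow> ('a \<Rightarrow> 'a) \<Rightarrow> ('a \<Rightarrow> 'a) set"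
  for V :: "(real, 'a) module" and A :: "('a \<Rightarrow> 'a) set" and p :: "'a \<Rightarrow> 'a" where
  base: "p \<in> opideal V A p"
| left: "a \<in> A \<Longrightarrow> f \<in> opideal V A p \<Longrightarrow> (\<lambda>x. a (f x)) \<in> opideal V A p"
| right: "f \<in> opideal V A p \<Longrightarrow> a \<in> A \<Longrightarrow> (\<lambda>x. f (a x)) \<in> opideal V A p"
| add: "f \<in> opideal V A p \<Longrightarrow> g \<in> opideal V A p \<Longrightarrow> (\<lambda>x. f x \<oplus>\<^bsub>V\<^esub> g x) \<in> opideal V A p"
| cong: "f \<in> opideal V A p \<Longrightarrow> (\<And>x. x \<in> carrier V \<Longrightarrow> g x = f x) \<Longrightarrow> g \<in> opideal V A p"

text \<open>Equivalently, \<open>V\<close> is nonzero and finite-dimensional and \<open>C\<close> generates all real-linear operators on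
  it. The last conjunct replaces a pair of dual bases.\<close>

definition full_real :: "(real, 'a) module \<Rightarrow> ('a \<Rightarrow> 'a) set \<Rightarrow> bool" where
  "full_real V C \<longleftrightarrow> (\<exists>b\<in>carrier V. \<exists>\<beta>. \<exists>p\<in>opalg V C.
     real_linear_on V type_space \<beta> \<and> \<beta> b = (1 :: real) \<and>
     (\<forall>x\<in>carrier V. p x = \<beta> x \<odot>\<^bsub>V\<^esub> b) \<and> (\<lambda>x. x) \<in> opideal V (opalg V C) p)"

lemma opalg_linear:
  assumes "real_space V" "\<And>f. f \<in> C \<Longrightarrow> real_linear_on V V f" "f \<in> opalg V C"
  shows "real_linear_on V V f"
  using assms(3)
  by (induction rule: opalg.induct)
    (auto intro: assms(2) real_linear_on_id real_linear_on_comp real_linear_on_add[OF assms(1)]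
      real_linear_on_smult[OF assms(1)] real_linear_on_cong[OF assms(1)])

lemma opideal_opalg:
  assumes "p \<in> opalg V C" "f \<in> opideal V (opalg V C) p" shows "f \<in> opalg V C"
  using assms(2) by (induction rule: opideal.induct) (auto intro: assms(1) opalg.intros)

lemma (in real_space) opalg_stable:
  assumes "submodule W real_ring V" "\<And>f x. f \<in> C \<Longrightarrow> x \<in> W \<Longrightarrow> f x \<in> W"
    and "f \<in> opalg V C" "x \<in> W"
  shows "f x \<in> W"
  using assms(3,4)
proof (induction arbitrary: x rule: opalg.induct)
  case (cong f g)
  then show ?case using subspaceD(1)[OF assms(1)] by auto
qed (auto simp: subspaceD[OF assms(1)] assms(2))

lemma opideal_trans:
  assumes "f \<in> opideal V A q" "q \<in> opideal V A p" shows "f \<in> opideal V A p"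
  using assms(1)
proof (induction rule: opideal.induct)
  case (cong f g)
  show ?case by (rule opideal.cong[OF cong(3,2)])
qed (rule assms(2) opideal.left opideal.right opideal.add; assumption)+

text \<open>A representation of the algebra generated by \<open>C\<close>. The instances are \<open>f \<mapsto> f \<otimes> 1\<close>,
  \<open>f \<mapsto> 1 \<otimes> f\<close>, the operators on one factor of a tensor power, and the tautological one.\<close>

locale operator_rep = V: real_space V + U: real_space U
  for V :: "(real, 'a) module" and C :: "('a \<Rightarrow> 'a) set"
    and U :: "(real, 'b) module" and \<theta> :: "('a \<Rightarrow> 'a) \<Rightarrow> 'b \<Rightarrow> 'b" +
  assumes rep_linear: "f \<in> opalg V C \<Longrightarrow> real_linear_on U U (\<theta> f)"
    and rep_one: "X \<in> carrier U \<Longrightarrow> \<theta> (\<lambda>x. x) X = X"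
    and rep_comp: "f \<in> opalg V C \<Longrightarrow> g \<in> opalg V C \<Longrightarrow> X \<in> carrier U \<Longrightarrow> \<theta> (\<lambda>x. f (g x)) X = \<theta> f (\<theta> g X)"
    and rep_add: "f \<in> opalg V C \<Longrightarrow> g \<in> opalg V C \<Longrightarrow> X \<in> carrier U \<Longrightarrow>
        \<theta> (\<lambda>x. f x \<oplus>\<^bsub>V\<^esub> g x) X = \<theta> f X \<oplus>\<^bsub>U\<^esub> \<theta> g X"
    and rep_smult: "f \<in> opalg V C \<Longrightarrow> X \<in> carrier U \<Longrightarrow> \<theta> (\<lambda>x. r \<odot>\<^bsub>V\<^esub> f x) X = r \<odot>\<^bsub>U\<^esub> \<theta> f X"
    and rep_cong: "f \<in> opalg V C \<Longrightarrow> g \<in> opalg V C \<Longrightarrow> (\<And>x. x \<in> carrier V \<Longrightarrow> g x = f x) \<Longrightarrow> X \<in> carrier U \<Longrightarrow> \<theta> g X = \<theta> f X"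
begin

abbreviation "A \<equiv> opalg V C"

lemma rep_in_opalg:
  assumes gen: "\<And>f. f \<in> C \<Longrightarrow> \<theta> f \<in> opalg U C'" and f: "f \<in> A"
  shows "\<theta> f \<in> opalg U C'"
  using f
proof (induction rule: opalg.induct)
  case one
  show ?case by (rule opalg.cong[OF opalg.one]) (rule rep_one)
next
  case (comp f g)
  show ?case by (rule opalg.cong[OF opalg.comp[OF comp(3,4)]]) (rule rep_comp[OF comp(1,2)])
next
  case (add f g)
  show ?case by (rule opalg.cong[OF opalg.add[OF add(3,4)]]) (rule rep_add[OF add(1,2)])
next
  case (smult f r)
  show ?case by (rule opalg.cong[OF opalg.smult[OF smult(2)]]) (rule rep_smult[OF smult(1)])
next
  case (cong f g)
  have "g \<in> A" by (rule opalg.cong[OF cong(1,2)])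
  then show ?case by (intro opalg.cong[OF cong(3)] rep_cong[OF cong(1) _ cong(2)])
qed (rule gen)

text \<open>If \<open>1\<close> lies in the ideal of \<open>p\<close>, then \<open>1 = \<Sum> a p a'\<close>. So no nonzero vector is killed by all
  \<open>p a\<close>, and a stable subspace that contains the image of \<open>p\<close> is everything.\<close>

lemma slice_nonzero:
  assumes p: "p \<in> A" and id: "(\<lambda>x. x) \<in> opideal V A p" and w: "w \<in> carrier U" "w \<noteq> \<zero>\<^bsub>U\<^esub>"
  shows "\<exists>a\<in>A. \<theta> p (\<theta> a w) \<noteq> \<zero>\<^bsub>U\<^esub>"
proof (rule ccontr)
  assume neg: "\<not> ?thesis"
  have "\<forall>a\<in>A. \<theta> f (\<theta> a w) = \<zero>\<^bsub>U\<^esub>" if "f \<in> opideal V A p" for f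
    using that
  proof (induction rule: opideal.induct)
    case base
    then show ?case using neg by blast
  next
    case (left g f)
    then show ?case using w(1) opideal_opalg[OF p] real_linear_onD(1)[OF rep_linear]
        real_linear_on_zero[OF U.real_space_axioms U.real_space_axioms rep_linear[OF left(1)]]
      by (simp add: rep_comp)
  next
    case (right f g)
    show ?case
    proof
      fix a assume a: "a \<in> A"
      have "\<theta> (\<lambda>x. f (g x)) (\<theta> a w) = \<theta> f (\<theta> (\<lambda>x. g (a x)) w)"
        using a right w(1) opideal_opalg[OF p] real_linear_onD(1)[OF rep_linear] by (simp add: rep_comp)
      then show "\<theta> (\<lambda>x. f (g x)) (\<theta> a w) = \<zero>\<^bsub>U\<^esub>" using bspec[OF right(3) opalg.comp[OF right(2) a]] by simp
    qed
  next
    case (add f g)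
    then show ?case using w(1) opideal_opalg[OF p] real_linear_onD(1)[OF rep_linear] by (simp add: rep_add)
  next
    case (cong f g)
    have "g \<in> A" by (rule opalg.cong[OF opideal_opalg[OF p cong(1)] cong(2)])
    then have "\<theta> g X = \<theta> f X" if "X \<in> carrier U" for X
      by (rule rep_cong[OF opideal_opalg[OF p cong(1)] _ cong(2) that])
    then show ?case using cong(3) w(1) real_linear_onD(1)[OF rep_linear] by simp
  qed
  from bspec[OF this[OF id] opalg.one] show False using w by (simp add: rep_one)
qed

lemma slice_generates:
  assumes p: "p \<in> A" and id: "(\<lambda>x. x) \<in> opideal V A p" and S: "submodule S real_ring U"
    and stable: "\<And>f X. f \<in> A \<Longrightarrow> X \<in> S \<Longrightarrow> \<theta> f X \<in> S" and slice: "\<And>X. X \<in> carrier U \<Longrightarrow> \<theta> p X \<in> S"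
  shows "S = carrier U"
proof -
  have "\<forall>X\<in>carrier U. \<theta> f X \<in> S" if "f \<in> opideal V A p" for f
    using that
  proof (induction rule: opideal.induct)
    case base
    then show ?case using slice by blast
  next
    case (left g f)
    then show ?case using stable opideal_opalg[OF p] by (simp add: rep_comp)
  next
    case (right f g)
    then show ?case using opideal_opalg[OF p] real_linear_onD(1)[OF rep_linear] by (simp add: rep_comp)
  next
    case (add f g)
    then show ?case using U.subspaceD(3)[OF S] opideal_opalg[OF p] by (simp add: rep_add)
  next
    case (cong f g)
    have "g \<in> A" by (rule opalg.cong[OF opideal_opalg[OF p cong(1)] cong(2)])
    then have "\<theta> g X = \<theta> f X" if "X \<in> carrier U" for X
      by (rule rep_cong[OF opideal_opalg[OF p cong(1)] _ cong(2) that])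
    then show ?case using cong(3) by simp
  qed
  from this[OF id] show ?thesis using U.subspaceD(1)[OF S] by (auto simp: rep_one)
qed

text \<open>With \<open>f = 1\<close> this expands \<open>P\<close> in the ideal of \<open>P \<theta>(p)\<close>; in a tensor power it turns the factor \<open>1\<close> in
  one more place into \<open>p\<close>.\<close>

lemma ideal_transport:
  assumes p: "p \<in> A" and f: "f \<in> opideal V A p" and B: "\<And>a. a \<in> A \<Longrightarrow> \<theta> a \<in> B"
    and P: "real_linear_on U U P" "\<And>a X. a \<in> A \<Longrightarrow> X \<in> carrier U \<Longrightarrow> P (\<theta> a X) = \<theta> a (P X)"
  shows "(\<lambda>X. P (\<theta> f X)) \<in> opideal U B (\<lambda>X. P (\<theta> p X))"
  using f
proof (induction rule: opideal.induct)
  case base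
  show ?case by (rule opideal.base)
next
  case (left a f)
  show ?case
    by (rule opideal.cong[OF opideal.left[OF B[OF left(1)] left(3)]])
      (use left opideal_opalg[OF p] real_linear_onD(1)[OF rep_linear] in \<open>simp add: rep_comp P(2)\<close>)
next
  case (right f a)
  show ?case
    by (rule opideal.cong[OF opideal.right[OF right(3) B[OF right(2)]]])
      (use right opideal_opalg[OF p] in \<open>simp add: rep_comp\<close>)
next
  case (add f g)
  show ?case
    by (rule opideal.cong[OF opideal.add[OF add(3,4)]])
      (use add opideal_opalg[OF p] real_linear_onD(1)[OF rep_linear] in \<open>simp add: rep_add real_linear_onD(2)[OF P(1)]\<close>)
next
  case (cong f g)
  have "g \<in> A" by (rule opalg.cong[OF opideal_opalg[OF p cong(1)] cong(2)])
  then have "\<theta> g X = \<theta> f X" if "X \<in> carrier U" for X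
    by (rule rep_cong[OF opideal_opalg[OF p cong(1)] _ cong(2) that])
  then show ?case by (intro opideal.cong[OF cong(3)]) simp
qed

end

section \<open>Gradings\<close>

definition psign :: "bool \<Rightarrow> real" where
  "psign d = (if d then - 1 else 1)"

lemma psign_square [simp]: "psign p * psign p = 1"
  by (simp add: psign_def)

locale graded_space = real_space V for V :: "(real, 'a) module" (structure) +
  fixes G :: "'a grading"
  assumes grading_sub: "G d \<subseteq> carrier V"
    and grading_decomp: "x \<in> carrier V \<Longrightarrow> \<exists>x0\<in>G False. \<exists>x1\<in>G True. x = x0 \<oplus> x1"
    and grading_parity: "\<exists>\<epsilon>. real_linear_on V V \<epsilon> \<and> (\<forall>d. \<forall>x\<in>G d. \<epsilon> x = psign d \<odot> x)"
begin

abbreviation "par \<equiv> parity_map V G"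

text \<open>Any linear map with the right signs on the two parts settles the definite description in
  \<^const>\<open>parity_map\<close>.\<close>

lemma parity_eqI:
  assumes "real_linear_on V V \<epsilon>" "\<And>d x. x \<in> G d \<Longrightarrow> \<epsilon> x = psign d \<odot> x" "x \<in> carrier V"
  shows "par x = \<epsilon> x"
proof -
  have e: "x0 \<ominus> x1 = \<epsilon> (x0 \<oplus> x1)" if "x0 \<in> G False" "x1 \<in> G True" for x0 x1
    using that grading_sub[of False] grading_sub[of True]
    by (auto simp: real_linear_onD(2)[OF assms(1)] assms(2)[OF that(1)] assms(2)[OF that(2)] psign_def minus_1_smult a_minus_def subset_iff)
  obtain x0 x1 where x: "x0 \<in> G False" "x1 \<in> G True" "x = x0 \<oplus> x1"
    using grading_decomp[OF assms(3)] by blast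
  show ?thesis unfolding parity_map_def
  proof (rule the_equality)
    show "\<exists>x0\<in>G False. \<exists>x1\<in>G True. x = x0 \<oplus> x1 \<and> \<epsilon> x = x0 \<ominus> x1"
      using x e[OF x(1,2)] by metis
    show "z = \<epsilon> x" if "\<exists>x0\<in>G False. \<exists>x1\<in>G True. x = x0 \<oplus> x1 \<and> z = x0 \<ominus> x1" for z
      using that e by metis
  qed
qed

lemma par_props: "real_linear_on V V par" "x \<in> G d \<Longrightarrow> par x = psign d \<odot> x"
proof -
  obtain \<epsilon> where e: "real_linear_on V V \<epsilon>" "\<And>d x. x \<in> G d \<Longrightarrow> \<epsilon> x = psign d \<odot> x"
    using grading_parity by blast
  show "real_linear_on V V par"
    by (rule real_linear_on_cong[OF real_space_axioms e(1)]) (rule parity_eqI[OF e])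
  show "x \<in> G d \<Longrightarrow> par x = psign d \<odot> x"
    using parity_eqI[OF e] e(2) grading_sub by (metis subsetD)
qed

lemmas par_linear = par_props(1)
lemmas par_homogeneous = par_props(2)

lemma par_closed [simp]: "x \<in> carrier V \<Longrightarrow> par x \<in> carrier V"
  by (rule real_linear_onD(1)[OF par_linear])

lemma par_par [simp]:
  assumes "x \<in> carrier V" shows "par (par x) = x"
proof -
  obtain x0 x1 where x: "x0 \<in> G False" "x1 \<in> G True" "x = x0 \<oplus> x1"
    using grading_decomp[OF assms] by blast
  then have "x0 \<in> carrier V" "x1 \<in> carrier V" using grading_sub by blast+
  then show ?thesis using x
    by (simp add: real_linear_onD[OF par_linear] par_homogeneous smult_smult)
qed

end

text \<open>In a quotient of a free space the homogeneous parts are spanned by classes of homogeneous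
  elements; decomposition and signs only have to be checked on generators.\<close>

lemma graded_quotI:
  fixes A :: "'x set" and N :: "('x \<Rightarrow>\<^sub>0 real) set"
  defines "U \<equiv> quot_space (free_on A) N"
  assumes N: "subspace N" and H: "\<And>d. H d \<subseteq> free_on A" and G: "\<And>d. G d = coset N ` span (H d)"
    and \<epsilon>: "real_linear_on U U \<epsilon>"
    and hom: "\<And>d h. h \<in> H d \<Longrightarrow> \<epsilon> (coset N h) = psign d \<odot>\<^bsub>U\<^esub> coset N h"
    and dec: "\<And>a. a \<in> A \<Longrightarrow> \<exists>X0\<in>G False. \<exists>X1\<in>G True. coset N (gen a) = X0 \<oplus>\<^bsub>U\<^esub> X1"
  shows "graded_space U G" "X \<in> G d \<Longrightarrow> \<epsilon> X = psign d \<odot>\<^bsub>U\<^esub> X"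
proof -
  interpret U: real_space U unfolding U_def by (rule real_space_quot_space[OF subspace_free_on N])
  have G_zero: "\<zero>\<^bsub>U\<^esub> \<in> G d" for d
    by (simp add: U_def G span_zero)
  have G_add: "X \<oplus>\<^bsub>U\<^esub> Y \<in> G d" if "X \<in> G d" "Y \<in> G d" for X Y d
    using that N by (auto simp: U_def G intro: span_add)
  have G_smult: "t \<odot>\<^bsub>U\<^esub> X \<in> G d" if "X \<in> G d" for t X d
    using that N by (auto simp: U_def G intro: span_scale)
  have sub: "G d \<subseteq> carrier U" for d
    using span_minimal[OF H subspace_free_on] by (auto simp: U_def G)
  have "coset N f \<in> carrier U \<and> \<epsilon> (coset N f) = psign d \<odot>\<^bsub>U\<^esub> coset N f" if "f \<in> span (H d)" for f d
    using that
  proof (induction rule: span_induct_alt)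
    case base
    have "coset N 0 = \<zero>\<^bsub>U\<^esub>" by (simp add: U_def)
    then show ?case using real_linear_on_zero[OF U.real_space_axioms U.real_space_axioms \<epsilon>] by simp
  next
    case (step t f g)
    have f: "coset N f \<in> carrier U" using step(1) H by (auto simp: U_def)
    have "coset N (t *\<^sub>R f + g) = t \<odot>\<^bsub>U\<^esub> coset N f \<oplus>\<^bsub>U\<^esub> coset N g" using N by (simp add: U_def)
    then show ?case using step(2) f hom[OF step(1)]
      by (simp add: real_linear_onD[OF \<epsilon>] U.smult_add_right U.smult_smult mult.commute)
  qed
  then show par: "\<epsilon> X = psign d \<odot>\<^bsub>U\<^esub> X" if "X \<in> G d" for X d using that by (auto simp: G)
  note ind = quot_free_induct[OF N, of _ A, folded U_def, consumes 1, case_names zero gen add smult]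
  have decomp: "\<exists>X0\<in>G False. \<exists>X1\<in>G True. X = X0 \<oplus>\<^bsub>U\<^esub> X1" if "X \<in> carrier U" for X
    using that
  proof (induction X rule: ind)
    case zero
    show ?case by (rule bexI[OF _ G_zero], rule bexI[OF _ G_zero]) simp
  next
    case (gen a)
    then show ?case by (rule dec)
  next
    case (add X Y)
    then obtain X0 X1 Y0 Y1 where d: "X0 \<in> G False" "X1 \<in> G True" "X = X0 \<oplus>\<^bsub>U\<^esub> X1"
      "Y0 \<in> G False" "Y1 \<in> G True" "Y = Y0 \<oplus>\<^bsub>U\<^esub> Y1" by blast
    then have "X0 \<in> carrier U" "X1 \<in> carrier U" "Y0 \<in> carrier U" "Y1 \<in> carrier U" using sub by blast+
    then have "X \<oplus>\<^bsub>U\<^esub> Y = (X0 \<oplus>\<^bsub>U\<^esub> Y0) \<oplus>\<^bsub>U\<^esub> (X1 \<oplus>\<^bsub>U\<^esub> Y1)" unfolding d by (simp add: U.M.a_ac)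
    then show ?case using G_add d by blast
  next
    case (smult t X)
    then obtain X0 X1 where d: "X0 \<in> G False" "X1 \<in> G True" "X = X0 \<oplus>\<^bsub>U\<^esub> X1" by blast
    then have "X0 \<in> carrier U" "X1 \<in> carrier U" using sub by blast+
    then have "t \<odot>\<^bsub>U\<^esub> X = (t \<odot>\<^bsub>U\<^esub> X0) \<oplus>\<^bsub>U\<^esub> (t \<odot>\<^bsub>U\<^esub> X1)" unfolding d by (simp add: U.smult_add_right)
    then show ?case using G_smult d by blast
  qed
  show "graded_space U G"
    by unfold_locales (use sub decomp \<epsilon> par in blast)+
qed

locale graded_clifford = graded_space V G + clifford_space V n c
  for V :: "(real, 'a) module" (structure) and G n c +
  assumes odd: "v \<in> carrier_vec n \<Longrightarrow> x \<in> carrier V \<Longrightarrow> par (c v x) = \<ominus> c v (par x)"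

section \<open>Tensor products\<close>

locale tensor_space = V: real_space V + W: real_space W
  for V :: "(real, 'a) module" and rm :: "'a \<Rightarrow> 'k \<Rightarrow> 'a"
    and W :: "(real, 'b) module" and lm :: "'k \<Rightarrow> 'b \<Rightarrow> 'b" +
  assumes rm_linear: "real_linear_on V V (\<lambda>x. rm x a)"
    and lm_linear: "real_linear_on W W (lm a)"
begin

abbreviation "N \<equiv> tensor_null V rm W lm"
abbreviation "U \<equiv> tensor V rm W lm"
abbreviation "pt x y \<equiv> coset N (gen (x, y))"

definition "end_l T \<longleftrightarrow> real_linear_on V V T \<and> (\<forall>x\<in>carrier V. \<forall>a. T (rm x a) = rm (T x) a)"
definition "end_r S \<longleftrightarrow> real_linear_on W W S \<and> (\<forall>y\<in>carrier W. \<forall>a. S (lm a y) = lm a (S y))"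

lemma rm_closed [simp]: "x \<in> carrier V \<Longrightarrow> rm x a \<in> carrier V"
  by (rule real_linear_onD(1)[OF rm_linear])

lemma lm_closed [simp]: "y \<in> carrier W \<Longrightarrow> lm a y \<in> carrier W"
  by (rule real_linear_onD(1)[OF lm_linear])

lemma subspace_N: "subspace N"
  by (simp add: tensor_null_def)

lemma N_free: "N \<subseteq> free_on (carrier V \<times> carrier W)"
  unfolding tensor_null_def
proof (rule span_minimal[OF _ subspace_free_on])
  show "tensor_relators V rm W lm \<subseteq> free_on (carrier V \<times> carrier W)"
    unfolding tensor_relators_def
    by (auto intro!: subspace_diff[OF subspace_free_on] subspace_scale[OF subspace_free_on])
qed

lemma real_space_U: "real_space U"
  unfolding tensor_def by (rule real_space_quot_space[OF subspace_free_on subspace_N])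

sublocale U: real_space U by (rule real_space_U)

lemma U_sel:
  "carrier U = coset N ` free_on (carrier V \<times> carrier W)" "\<zero>\<^bsub>U\<^esub> = coset N 0"
  "coset N f \<oplus>\<^bsub>U\<^esub> coset N g = coset N (f + g)" "r \<odot>\<^bsub>U\<^esub> coset N f = coset N (r *\<^sub>R f)"
  "f \<in> free_on (carrier V \<times> carrier W) \<Longrightarrow> \<ominus>\<^bsub>U\<^esub> coset N f = coset N (- f)"
  by (simp_all add: tensor_def subspace_N subspace_free_on)

lemma pt_closed [simp]: "x \<in> carrier V \<Longrightarrow> y \<in> carrier W \<Longrightarrow> pt x y \<in> carrier U"
  by (simp add: U_sel)

lemma in_N: "f \<in> tensor_relators V rm W lm \<Longrightarrow> f \<in> N"
  by (simp add: tensor_null_def span_base)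

lemma pt_add_left:
  assumes "x \<in> carrier V" "x' \<in> carrier V" "y \<in> carrier W"
  shows "pt (x \<oplus>\<^bsub>V\<^esub> x') y = pt x y \<oplus>\<^bsub>U\<^esub> pt x' y"
proof -
  have "gen (x \<oplus>\<^bsub>V\<^esub> x', y) - gen (x, y) - gen (x', y) \<in> N"
    by (rule in_N) (use assms in \<open>unfold tensor_relators_def, blast\<close>)
  then show ?thesis by (simp add: U_sel coset_eq_iff[OF subspace_N] diff_diff_add)
qed

lemma pt_add_right:
  assumes "x \<in> carrier V" "y \<in> carrier W" "y' \<in> carrier W"
  shows "pt x (y \<oplus>\<^bsub>W\<^esub> y') = pt x y \<oplus>\<^bsub>U\<^esub> pt x y'"
proof -
  have "gen (x, y \<oplus>\<^bsub>W\<^esub> y') - gen (x, y) - gen (x, y') \<in> N"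
    by (rule in_N) (use assms in \<open>unfold tensor_relators_def, blast\<close>)
  then show ?thesis by (simp add: U_sel coset_eq_iff[OF subspace_N] diff_diff_add)
qed

lemma pt_smult_left:
  assumes "x \<in> carrier V" "y \<in> carrier W" shows "pt (r \<odot>\<^bsub>V\<^esub> x) y = r \<odot>\<^bsub>U\<^esub> pt x y"
proof -
  have "gen (r \<odot>\<^bsub>V\<^esub> x, y) - r *\<^sub>R gen (x, y) \<in> N"
    by (rule in_N) (use assms in \<open>unfold tensor_relators_def, blast\<close>)
  then show ?thesis by (simp add: U_sel coset_eq_iff[OF subspace_N])
qed

lemma pt_smult_right:
  assumes "x \<in> carrier V" "y \<in> carrier W" shows "pt x (r \<odot>\<^bsub>W\<^esub> y) = r \<odot>\<^bsub>U\<^esub> pt x y"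
proof -
  have "gen (x, r \<odot>\<^bsub>W\<^esub> y) - r *\<^sub>R gen (x, y) \<in> N"
    by (rule in_N) (use assms in \<open>unfold tensor_relators_def, blast\<close>)
  then show ?thesis by (simp add: U_sel coset_eq_iff[OF subspace_N])
qed

lemma pt_balanced:
  assumes "x \<in> carrier V" "y \<in> carrier W" shows "pt (rm x a) y = pt x (lm a y)"
proof -
  have "gen (rm x a, y) - gen (x, lm a y) \<in> N"
    by (rule in_N) (use assms in \<open>unfold tensor_relators_def, blast\<close>)
  then show ?thesis by (simp add: coset_eq_iff[OF subspace_N])
qed

lemma pt_minus_left: "x \<in> carrier V \<Longrightarrow> y \<in> carrier W \<Longrightarrow> pt (\<ominus>\<^bsub>V\<^esub> x) y = \<ominus>\<^bsub>U\<^esub> pt x y"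
  using pt_smult_left[of x y "- 1"] by (simp add: V.minus_1_smult U.minus_1_smult)

lemma pt_minus_right: "x \<in> carrier V \<Longrightarrow> y \<in> carrier W \<Longrightarrow> pt x (\<ominus>\<^bsub>W\<^esub> y) = \<ominus>\<^bsub>U\<^esub> pt x y"
  using pt_smult_right[of x y "- 1"] by (simp add: W.minus_1_smult U.minus_1_smult)

lemma pt_zero_right: "x \<in> carrier V \<Longrightarrow> pt x \<zero>\<^bsub>W\<^esub> = \<zero>\<^bsub>U\<^esub>"
  using pt_smult_right[of x "\<zero>\<^bsub>W\<^esub>" 0] by simp

lemma pt_zero_left: "y \<in> carrier W \<Longrightarrow> pt \<zero>\<^bsub>V\<^esub> y = \<zero>\<^bsub>U\<^esub>"
  using pt_smult_left[of "\<zero>\<^bsub>V\<^esub>" y 0] by simp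

lemma U_induct [consumes 1, case_names zero pt add smult]:
  assumes "X \<in> carrier U" "P \<zero>\<^bsub>U\<^esub>" "\<And>x y. x \<in> carrier V \<Longrightarrow> y \<in> carrier W \<Longrightarrow> P (pt x y)"
    and "\<And>X Y. X \<in> carrier U \<Longrightarrow> Y \<in> carrier U \<Longrightarrow> P X \<Longrightarrow> P Y \<Longrightarrow> P (X \<oplus>\<^bsub>U\<^esub> Y)"
    and "\<And>r X. X \<in> carrier U \<Longrightarrow> P X \<Longrightarrow> P (r \<odot>\<^bsub>U\<^esub> X)"
  shows "P X"
  using subspace_N assms(1) unfolding tensor_def
  by (induction rule: quot_free_induct) (use assms(2-5) in \<open>auto simp: tensor_def\<close>)

lemma U_linear_eq:
  assumes "real_space Z" "real_linear_on U Z f" "real_linear_on U Z g"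
    and "\<And>x y. x \<in> carrier V \<Longrightarrow> y \<in> carrier W \<Longrightarrow> f (pt x y) = g (pt x y)" "X \<in> carrier U"
  shows "f X = g X"
  by (rule quot_free_linear_eq[OF subspace_N assms(1), of "carrier V \<times> carrier W"])
    (use assms in \<open>auto simp: tensor_def\<close>)

lemma tensor_map_coset:
  assumes "end_l T" "end_r S"
  shows "tensor_map N T S (coset N f) = coset N (lin_ext (\<lambda>(x, y). gen (T x, S y)) f)"
  unfolding tensor_map_def
proof (rule coset_lift[OF subspace_N linear_lin_ext])
  let ?L = "lin_ext (\<lambda>(x, y). gen (T x, S y))"
  note L = linear_diff[OF linear_lin_ext] linear_scale[OF linear_lin_ext]
  have T: "real_linear_on V V T" "\<And>x a. x \<in> carrier V \<Longrightarrow> T (rm x a) = rm (T x) a"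
    and S: "real_linear_on W W S" "\<And>y a. y \<in> carrier W \<Longrightarrow> S (lm a y) = lm a (S y)"
    using assms by (auto simp: end_l_def end_r_def)
  note [simp] = real_linear_onD[OF T(1)] real_linear_onD[OF S(1)] T(2) S(2)
  have rel: "?L r \<in> N" if "r \<in> tensor_relators V rm W lm" for r
  proof -
    have "?L r \<in> tensor_relators V rm W lm"
      using that unfolding tensor_relators_def
      by (elim UnE CollectE exE conjE; hypsubst; simp only: L; simp add: lin_ext_single; (use real_linear_onD(1)[OF T(1)] real_linear_onD(1)[OF S(1)] in blast))
    then show ?thesis by (rule in_N)
  qed
  have "?L f \<in> N" if "f \<in> N" for f
    using that unfolding tensor_null_def
  proof (induction rule: span_induct_alt)
    case base
    then show ?case by (simp add: linear_0[OF linear_lin_ext] span_zero)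
  next
    case (step c x y)
    then show ?case using rel[of x]
      by (auto simp: linear_add[OF linear_lin_ext] L tensor_null_def intro: span_add span_scale)
  qed
  then show "?L ` N \<subseteq> N" by blast
qed

lemma tensor_map_pt [simp]: "end_l T \<Longrightarrow> end_r S \<Longrightarrow> tensor_map N T S (pt x y) = pt (T x) (S y)"
  by (simp add: tensor_map_coset lin_ext_single)

lemma tensor_map_linear:
  assumes "end_l T" "end_r S" shows "real_linear_on U U (tensor_map N T S)"
proof (rule real_linear_onI)
  have T: "real_linear_on V V T" and S: "real_linear_on W W S"
    using assms by (auto simp: end_l_def end_r_def)
  have "lin_ext (\<lambda>(x, y). gen (T x, S y)) f \<in> free_on (carrier V \<times> carrier W)"
    if "f \<in> free_on (carrier V \<times> carrier W)" for f
    using that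
  proof (induction rule: free_on_induct)
    case (single x r)
    then show ?case using real_linear_onD(1)[OF T] real_linear_onD(1)[OF S]
      by (cases x) (simp add: lin_ext_single scaleR_single)
  qed (auto simp: linear_0[OF linear_lin_ext] linear_add[OF linear_lin_ext]
      intro: subspace_0[OF subspace_free_on] subspace_add[OF subspace_free_on])
  then show "tensor_map N T S X \<in> carrier U" if "X \<in> carrier U" for X
    using that by (auto simp: U_sel tensor_map_coset[OF assms])
qed (auto simp: U_sel tensor_map_coset[OF assms] linear_add[OF linear_lin_ext] linear_scale[OF linear_lin_ext])

lemma end_id [simp]: "end_l (\<lambda>x. x)" "end_l id" "end_r (\<lambda>x. x)" "end_r id"
  by (auto simp: end_l_def end_r_def real_linear_on_id)

lemma end_l_linear: "end_l T \<Longrightarrow> real_linear_on V V T" and end_r_linear: "end_r S \<Longrightarrow> real_linear_on W W S"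
  by (auto simp: end_l_def end_r_def)

lemma end_l_comp: "end_l T \<Longrightarrow> end_l T' \<Longrightarrow> end_l (\<lambda>x. T (T' x))"
  by (auto simp: end_l_def real_linear_on_def Pi_iff)

lemma end_r_comp: "end_r T \<Longrightarrow> end_r T' \<Longrightarrow> end_r (\<lambda>x. T (T' x))"
  by (auto simp: end_r_def real_linear_on_def Pi_iff)

lemma tensor_map_comp:
  assumes "end_l T" "end_r S" "end_l T'" "end_r S'" "X \<in> carrier U"
  shows "tensor_map N T S (tensor_map N T' S' X) = tensor_map N (\<lambda>x. T (T' x)) (\<lambda>y. S (S' y)) X"
  by (rule U_linear_eq[OF real_space_U real_linear_on_comp[OF tensor_map_linear tensor_map_linear] tensor_map_linear _ assms(5)])
    (simp_all add: assms end_l_comp end_r_comp)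

lemma tensor_map_cong:
  assumes "end_l T" "end_r S" "end_l T'" "end_r S'" "X \<in> carrier U"
    and "\<And>x. x \<in> carrier V \<Longrightarrow> T x = T' x" "\<And>y. y \<in> carrier W \<Longrightarrow> S y = S' y"
  shows "tensor_map N T S X = tensor_map N T' S' X"
  by (rule U_linear_eq[OF real_space_U tensor_map_linear tensor_map_linear _ assms(5)])
    (use assms in auto)

lemma tensor_map_id [simp]: "X \<in> carrier U \<Longrightarrow> tensor_map N (\<lambda>x. x) (\<lambda>x. x) X = X" "X \<in> carrier U \<Longrightarrow> tensor_map N id id X = X"
  by (rule U_linear_eq[OF real_space_U tensor_map_linear real_linear_on_id(1)]; simp)+

text \<open>The universal property, for values in a type.\<close>

lemma tensor_functional:
  assumes "\<And>x x' y. x \<in> carrier V \<Longrightarrow> x' \<in> carrier V \<Longrightarrow> y \<in> carrier W \<Longrightarrow> g (x \<oplus>\<^bsub>V\<^esub> x') y = g x y + g x' y"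
    and "\<And>x y y'. x \<in> carrier V \<Longrightarrow> y \<in> carrier W \<Longrightarrow> y' \<in> carrier W \<Longrightarrow> g x (y \<oplus>\<^bsub>W\<^esub> y') = g x y + g x y'"
    and "\<And>r x y. x \<in> carrier V \<Longrightarrow> y \<in> carrier W \<Longrightarrow> g (r \<odot>\<^bsub>V\<^esub> x) y = r *\<^sub>R g x y"
    and "\<And>r x y. x \<in> carrier V \<Longrightarrow> y \<in> carrier W \<Longrightarrow> g x (r \<odot>\<^bsub>W\<^esub> y) = r *\<^sub>R g x y"
    and "\<And>x a y. x \<in> carrier V \<Longrightarrow> y \<in> carrier W \<Longrightarrow> g (rm x a) y = g x (lm a y)"
  obtains \<gamma> where "real_linear_on U type_space \<gamma>"
    "\<And>x y. x \<in> carrier V \<Longrightarrow> y \<in> carrier W \<Longrightarrow> \<gamma> (pt x y) = (g x y :: 'w::real_vector)"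
proof -
  let ?L = "lin_ext (\<lambda>(x, y). g x y)"
  note L = linear_diff[OF linear_lin_ext] linear_scale[OF linear_lin_ext]
  have rel: "?L r = 0" if "r \<in> tensor_relators V rm W lm" for r
    using that unfolding tensor_relators_def
    by (elim UnE CollectE exE conjE; hypsubst; simp only: L; simp add: lin_ext_single assms)
  have "?L f = 0" if "f \<in> N" for f
    using that unfolding tensor_null_def
  proof (induction rule: span_induct_alt)
    case base
    then show ?case by (rule linear_0[OF linear_lin_ext])
  next
    case (step c x y)
    then show ?case using rel[of x] by (simp add: linear_add[OF linear_lin_ext] L)
  qed
  note q = quot_lift_linear[OF subspace_N N_free subspace_free_on linear_lin_ext this]
  show ?thesis
    by (rule that[of "quot_lift ?L"]) (use q in \<open>auto simp: tensor_def lin_ext_single\<close>)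
qed

end

text \<open>The sign rule refers to the parity of the first factor. The second factor may be ungraded, like
  \<open>\<complex>\<close> and \<open>\<bbbH>\<close>; with a grading of it, the tensor product is graded again and can be tensored further.\<close>

locale tensor_clifford_space = tensor_space V rm W lm + V: graded_clifford V G m c + W: clifford_space W r c'
  for V :: "(real, 'a) module" and G m c and rm :: "'a \<Rightarrow> 'k \<Rightarrow> 'a"
    and W :: "(real, 'b) module" and r c' and lm :: "'k \<Rightarrow> 'b \<Rightarrow> 'b" +
  assumes par_rm: "x \<in> carrier V \<Longrightarrow> V.par (rm x a) = rm (V.par x) a"
    and c_rm: "u \<in> carrier_vec m \<Longrightarrow> x \<in> carrier V \<Longrightarrow> c u (rm x a) = rm (c u x) a"
    and c'_lm: "v \<in> carrier_vec r \<Longrightarrow> y \<in> carrier W \<Longrightarrow> c' v (lm a y) = lm a (c' v y)"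
begin

abbreviation "act \<equiv> tensor_clifford V G rm W lm m c r c'"

lemma end_par [simp]: "end_l V.par"
  by (auto simp: end_l_def V.par_linear par_rm)

lemma end_c [simp]: "u \<in> carrier_vec m \<Longrightarrow> end_l (c u)"
  by (auto simp: end_l_def V.c_linear c_rm)

lemma end_c' [simp]: "v \<in> carrier_vec r \<Longrightarrow> end_r (c' v)"
  by (auto simp: end_r_def W.c_linear c'_lm)

lemma first_in [simp]: "w \<in> carrier_vec (m + r) \<Longrightarrow> vec_first w m \<in> carrier_vec m"
  and last_in [simp]: "w \<in> carrier_vec (m + r) \<Longrightarrow> vec_last w r \<in> carrier_vec r"
  by simp_all

lemma act_eq:
  "act w X = tensor_map N (c (vec_first w m)) id X \<oplus>\<^bsub>U\<^esub> tensor_map N V.par (c' (vec_last w r)) X"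
  by (simp add: tensor_clifford_def id_graded_tensor_def Let_def)

lemma act_linear: "w \<in> carrier_vec (m + r) \<Longrightarrow> real_linear_on U U (act w)"
  unfolding act_eq[abs_def] by (intro real_linear_on_add[OF real_space_U] tensor_map_linear) simp_all

lemma act_closed [simp]: "w \<in> carrier_vec (m + r) \<Longrightarrow> X \<in> carrier U \<Longrightarrow> act w X \<in> carrier U"
  by (rule real_linear_onD(1)[OF act_linear])

lemma act_pt:
  assumes "w \<in> carrier_vec (m + r)"
  shows "act w (pt x y) = pt (c (vec_first w m) x) y \<oplus>\<^bsub>U\<^esub> pt (V.par x) (c' (vec_last w r) y)"
  using assms by (simp add: act_eq)

text \<open>In the product of two operators the mixed terms are \<open>\<epsilon> c u' \<otimes> c' v\<close> and \<open>c u \<epsilon> \<otimes> c' v'\<close>; since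
  \<open>c\<close> is odd, they are the negatives of those in the product in the other order.\<close>

lemma act_clifford:
  assumes w: "w \<in> carrier_vec (m + r)" "w' \<in> carrier_vec (m + r)" and X: "X \<in> carrier U"
  shows "act w (act w' X) \<oplus>\<^bsub>U\<^esub> act w' (act w X) = (- 2 * scalar_prod w w') \<odot>\<^bsub>U\<^esub> X"
proof (rule U_linear_eq[OF real_space_U _ _ _ X])
  show "real_linear_on U U (\<lambda>X. act w (act w' X) \<oplus>\<^bsub>U\<^esub> act w' (act w X))"
    using w by (intro real_linear_on_add[OF real_space_U] real_linear_on_comp[OF act_linear act_linear])
  show "real_linear_on U U (\<lambda>X. (- 2 * scalar_prod w w') \<odot>\<^bsub>U\<^esub> X)"
    by (intro real_linear_on_smult[OF real_space_U] real_linear_on_id)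
  fix x y assume xy: "x \<in> carrier V" "y \<in> carrier W"
  let ?u = "vec_first w m" and ?v = "vec_last w r" and ?u' = "vec_first w' m" and ?v' = "vec_last w' r"
  have sp: "scalar_prod w w' = scalar_prod ?u ?u' + scalar_prod ?v ?v'"
    using scalar_prod_append[of ?u m ?v r ?u' ?v'] w by (simp add: vec_first_last_append)
  have prod: "act z (act z' (pt x y)) = pt (c (vec_first z m) (c (vec_first z' m) x)) y
        \<oplus>\<^bsub>U\<^esub> \<ominus>\<^bsub>U\<^esub> pt (c (vec_first z' m) (V.par x)) (c' (vec_last z r) y)
        \<oplus>\<^bsub>U\<^esub> (pt (c (vec_first z m) (V.par x)) (c' (vec_last z' r) y)
        \<oplus>\<^bsub>U\<^esub> pt x (c' (vec_last z r) (c' (vec_last z' r) y)))"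
    if "z \<in> carrier_vec (m + r)" "z' \<in> carrier_vec (m + r)" for z z'
    using that xy by (simp add: act_pt real_linear_onD(2)[OF act_linear] V.odd pt_minus_left)
  have e1: "pt (c ?u (c ?u' x)) y \<oplus>\<^bsub>U\<^esub> pt (c ?u' (c ?u x)) y = (- 2 * scalar_prod ?u ?u') \<odot>\<^bsub>U\<^esub> pt x y"
    using w xy by (simp flip: pt_add_left add: V.c_rel pt_smult_left)
  have e2: "pt x (c' ?v (c' ?v' y)) \<oplus>\<^bsub>U\<^esub> pt x (c' ?v' (c' ?v y)) = (- 2 * scalar_prod ?v ?v') \<odot>\<^bsub>U\<^esub> pt x y"
    using w xy by (simp flip: pt_add_right add: W.c_rel pt_smult_right)
  have "act w (act w' (pt x y)) \<oplus>\<^bsub>U\<^esub> act w' (act w (pt x y)) =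
     (pt (c ?u (c ?u' x)) y \<oplus>\<^bsub>U\<^esub> pt (c ?u' (c ?u x)) y) \<oplus>\<^bsub>U\<^esub>
     (pt x (c' ?v (c' ?v' y)) \<oplus>\<^bsub>U\<^esub> pt x (c' ?v' (c' ?v y)))"
    unfolding prod[OF w] prod[OF w(2,1)] using w xy
    by (simp add: U_sel algebra_simps)
  also have "\<dots> = (- 2 * scalar_prod w w') \<odot>\<^bsub>U\<^esub> pt x y"
    unfolding e1 e2 using xy by (simp add: sp algebra_simps flip: U.smult_add_left)
  finally show "act w (act w' (pt x y)) \<oplus>\<^bsub>U\<^esub> act w' (act w (pt x y)) = (- 2 * scalar_prod w w') \<odot>\<^bsub>U\<^esub> pt x y" .
qed

lemma vec_first_add: "w \<in> carrier_vec (m + r) \<Longrightarrow> w' \<in> carrier_vec (m + r) \<Longrightarrow> vec_first (w + w') m = vec_first w m + vec_first w' m"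
  and vec_last_add: "w \<in> carrier_vec (m + r) \<Longrightarrow> w' \<in> carrier_vec (m + r) \<Longrightarrow> vec_last (w + w') r = vec_last w r + vec_last w' r"
  and vec_first_smult: "w \<in> carrier_vec (m + r) \<Longrightarrow> vec_first (t \<cdot>\<^sub>v w) m = t \<cdot>\<^sub>v vec_first w m"
  and vec_last_smult: "w \<in> carrier_vec (m + r) \<Longrightarrow> vec_last (t \<cdot>\<^sub>v w) r = t \<cdot>\<^sub>v vec_last w r"
  for w w' :: "real vec"
  by (auto simp: vec_first_def vec_last_def)

lemma clifford_map_act: "clifford_map (m + r) U act"
proof (rule clifford_mapI)
  show "real_linear_on U U (act w)" if "w \<in> carrier_vec (m + r)" for w
    using that by (rule act_linear)
  show "act (w + w') X = act w X \<oplus>\<^bsub>U\<^esub> act w' X"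
    if w: "w \<in> carrier_vec (m + r)" "w' \<in> carrier_vec (m + r)" and X: "X \<in> carrier U" for w w' X
  proof (rule U_linear_eq[OF real_space_U _ _ _ X])
    fix x y assume xy: "x \<in> carrier V" "y \<in> carrier W"
    show "act (w + w') (pt x y) = act w (pt x y) \<oplus>\<^bsub>U\<^esub> act w' (pt x y)"
      using w xy by (simp add: act_pt vec_first_add vec_last_add V.c_vadd W.c_vadd pt_add_left pt_add_right U.M.a_ac)
  qed (use w in \<open>auto intro!: act_linear real_linear_on_add[OF real_space_U]\<close>)
  show "act (t \<cdot>\<^sub>v w) X = t \<odot>\<^bsub>U\<^esub> act w X" if w: "w \<in> carrier_vec (m + r)" and X: "X \<in> carrier U" for w t X
  proof (rule U_linear_eq[OF real_space_U _ _ _ X])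
    fix x y assume xy: "x \<in> carrier V" "y \<in> carrier W"
    show "act (t \<cdot>\<^sub>v w) (pt x y) = t \<odot>\<^bsub>U\<^esub> act w (pt x y)"
      using w xy by (simp add: act_pt vec_first_smult vec_last_smult V.c_vsmult W.c_vsmult pt_smult_left pt_smult_right U.smult_add_right)
  qed (use w in \<open>auto intro!: act_linear real_linear_on_smult[OF real_space_U]\<close>)
qed (rule act_clifford)

sublocale U: clifford_space U "m + r" act
  by unfold_locales (rule clifford_map_act)

end

locale tensor_graded_clifford = tensor_clifford_space V G m c rm W r c' lm + W: graded_clifford W H r c'
  for V :: "(real, 'a) module" and G m c and rm :: "'a \<Rightarrow> 'k \<Rightarrow> 'a"
    and W :: "(real, 'b) module" and H r c' and lm :: "'k \<Rightarrow> 'b \<Rightarrow> 'b" +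
  assumes par_lm: "y \<in> carrier W \<Longrightarrow> W.par (lm a y) = lm a (W.par y)"
begin

lemma end_par' [simp]: "end_r W.par"
  by (auto simp: end_r_def W.par_linear par_lm)

abbreviation "UG \<equiv> tensor_grading N G H"

lemma graded_U:
  "graded_space U UG" "X \<in> UG d \<Longrightarrow> tensor_map N V.par W.par X = psign d \<odot>\<^bsub>U\<^esub> X"
proof -
  let ?H = "\<lambda>d. {gen (x, y) |x y p q. x \<in> G p \<and> y \<in> H q \<and> (p \<noteq> q) = d}"
  have in_UG: "pt x y \<in> UG (p \<noteq> q)" if "x \<in> G p" "y \<in> H q" for x y p q
    unfolding tensor_grading_def using that by (intro imageI span_base) blast
  have add_UG: "X \<oplus>\<^bsub>U\<^esub> Y \<in> UG d" if "X \<in> UG d" "Y \<in> UG d" for X Y d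
    using that unfolding tensor_grading_def by (auto simp: U_sel intro: span_add)
  have free: "?H d \<subseteq> free_on (carrier V \<times> carrier W)" for d
    using V.grading_sub W.grading_sub by (clarify, intro single_in_free_on SigmaI; blast)
  have hom: "tensor_map N V.par W.par (coset N h) = psign d \<odot>\<^bsub>U\<^esub> coset N h" if h: "h \<in> ?H d" for h d
  proof -
    obtain x y p q where f: "h = gen (x, y)" "x \<in> G p" "y \<in> H q" "(p \<noteq> q) = d" using h by blast
    then have c: "x \<in> carrier V" "y \<in> carrier W" using V.grading_sub W.grading_sub by blast+
    have "psign q * psign p = psign d" "psign p * psign q = psign d"
      using f(4) by (auto simp: psign_def)
    then show ?thesis
      using c by (simp add: f(1) V.par_homogeneous[OF f(2)] W.par_homogeneous[OF f(3)] pt_smult_left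
          pt_smult_right U.smult_smult)
  qed
  have dec: "\<exists>X0\<in>UG False. \<exists>X1\<in>UG True. pt x y = X0 \<oplus>\<^bsub>U\<^esub> X1" if xy: "x \<in> carrier V" "y \<in> carrier W" for x y
  proof -
    obtain x0 x1 y0 y1 where d: "x0 \<in> G False" "x1 \<in> G True" "x = x0 \<oplus>\<^bsub>V\<^esub> x1"
      "y0 \<in> H False" "y1 \<in> H True" "y = y0 \<oplus>\<^bsub>W\<^esub> y1"
      using V.grading_decomp[OF xy(1)] W.grading_decomp[OF xy(2)] by blast
    then have c: "x0 \<in> carrier V" "x1 \<in> carrier V" "y0 \<in> carrier W" "y1 \<in> carrier W"
      using V.grading_sub W.grading_sub by blast+
    have "pt x y = (pt x0 y0 \<oplus>\<^bsub>U\<^esub> pt x1 y1) \<oplus>\<^bsub>U\<^esub> (pt x0 y1 \<oplus>\<^bsub>U\<^esub> pt x1 y0)"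
      unfolding d using c by (simp add: pt_add_left pt_add_right U.M.a_ac)
    moreover have "pt x0 y0 \<oplus>\<^bsub>U\<^esub> pt x1 y1 \<in> UG False" "pt x0 y1 \<oplus>\<^bsub>U\<^esub> pt x1 y0 \<in> UG True"
      using in_UG[OF d(1,4)] in_UG[OF d(2,5)] in_UG[OF d(1,5)] in_UG[OF d(2,4)] by (auto intro: add_UG)
    ultimately show ?thesis by blast
  qed
  note q = graded_quotI[OF subspace_N free tensor_grading_def
      tensor_map_linear[OF end_par end_par', unfolded tensor_def] hom[unfolded tensor_def]]
  show "graded_space U UG" unfolding tensor_def by (rule q(1)) (use dec in \<open>auto simp: tensor_def\<close>)
  show "X \<in> UG d \<Longrightarrow> tensor_map N V.par W.par X = psign d \<odot>\<^bsub>U\<^esub> X"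
    unfolding tensor_def by (rule q(2)) (use dec in \<open>auto simp: tensor_def\<close>)
qed

sublocale U: graded_space U UG by (rule graded_U)

lemma U_parity: "X \<in> carrier U \<Longrightarrow> U.par X = tensor_map N V.par W.par X"
  using tensor_map_linear[OF end_par end_par'] graded_U(2) by (rule U.parity_eqI)

sublocale U: graded_clifford U UG "m + r" act
proof
  fix w :: "real vec" and X assume w: "w \<in> carrier_vec (m + r)" and X: "X \<in> carrier U"
  show "U.par (act w X) = \<ominus>\<^bsub>U\<^esub> act w (U.par X)"
  proof (rule U_linear_eq[OF real_space_U _ _ _ X])
    show "real_linear_on U U (\<lambda>X. U.par (act w X))"
      using w by (intro real_linear_on_comp[OF U.par_linear act_linear])
    have "real_linear_on U U (\<lambda>X. (- 1) \<odot>\<^bsub>U\<^esub> act w (U.par X))"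
      using w by (intro real_linear_on_smult[OF real_space_U] real_linear_on_comp[OF act_linear U.par_linear])
    then show "real_linear_on U U (\<lambda>X. \<ominus>\<^bsub>U\<^esub> act w (U.par X))"
      by (rule real_linear_on_cong[OF real_space_U]) (use w in \<open>simp add: U.minus_1_smult\<close>)
    fix x y assume xy: "x \<in> carrier V" "y \<in> carrier W"
    then show "U.par (act w (pt x y)) = \<ominus>\<^bsub>U\<^esub> act w (U.par (pt x y))"
      using w by (simp add: act_pt U_parity real_linear_onD(2)[OF tensor_map_linear[OF end_par end_par']]
          V.odd W.odd pt_minus_left pt_minus_right U.M.minus_add)
  qed
qed

end

section \<open>Irreducibility of tensor products\<close>

lemma (in clifford_space) opalg_linear_c:
  "f \<in> opalg V (c ` carrier_vec n) \<Longrightarrow> real_linear_on V V f"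
  by (rule opalg_linear[OF real_space_axioms]) (auto intro: c_linear)

lemma (in clifford_space) opalg_stable_c:
  assumes "submodule W real_ring V" "stable (carrier_vec n) c W" "f \<in> opalg V (c ` carrier_vec n)" "x \<in> W"
  shows "f x \<in> W"
  by (rule opalg_stable[OF assms(1) _ assms(3,4)]) (use assms(2) in \<open>auto simp: stable_def\<close>)

lemma (in clifford_space) opalg_closed:
  "f \<in> opalg V (c ` carrier_vec n) \<Longrightarrow> x \<in> carrier V \<Longrightarrow> f x \<in> carrier V"
  using opalg_linear_c real_linear_onD(1) by metis

context tensor_clifford_space
begin

abbreviation "AV \<equiv> opalg V (c ` carrier_vec m)"
abbreviation "AW \<equiv> opalg W (c' ` carrier_vec r)"
abbreviation "AU \<equiv> opalg U (act ` carrier_vec (m + r))"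

lemma tensor_map_add_left:
  assumes "end_l f" "end_l g" "end_l (\<lambda>x. f x \<oplus>\<^bsub>V\<^esub> g x)" "end_r S" "X \<in> carrier U"
  shows "tensor_map N (\<lambda>x. f x \<oplus>\<^bsub>V\<^esub> g x) S X = tensor_map N f S X \<oplus>\<^bsub>U\<^esub> tensor_map N g S X"
  by (rule U_linear_eq[OF real_space_U tensor_map_linear real_linear_on_add[OF real_space_U tensor_map_linear tensor_map_linear] _ assms(5)])
    (use assms in \<open>simp_all add: pt_add_left real_linear_onD(1)[OF end_l_linear] real_linear_onD(1)[OF end_r_linear]\<close>)

lemma tensor_map_add_right:
  assumes "end_r f" "end_r g" "end_r (\<lambda>x. f x \<oplus>\<^bsub>W\<^esub> g x)" "end_l T" "X \<in> carrier U"
  shows "tensor_map N T (\<lambda>x. f x \<oplus>\<^bsub>W\<^esub> g x) X = tensor_map N T f X \<oplus>\<^bsub>U\<^esub> tensor_map N T g X"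
  by (rule U_linear_eq[OF real_space_U tensor_map_linear real_linear_on_add[OF real_space_U tensor_map_linear tensor_map_linear] _ assms(5)])
    (use assms in \<open>simp_all add: pt_add_right real_linear_onD(1)[OF end_l_linear] real_linear_onD(1)[OF end_r_linear]\<close>)

lemma tensor_map_smult_left:
  assumes "end_l f" "end_l (\<lambda>x. t \<odot>\<^bsub>V\<^esub> f x)" "end_r S" "X \<in> carrier U"
  shows "tensor_map N (\<lambda>x. t \<odot>\<^bsub>V\<^esub> f x) S X = t \<odot>\<^bsub>U\<^esub> tensor_map N f S X"
  by (rule U_linear_eq[OF real_space_U tensor_map_linear real_linear_on_smult[OF real_space_U tensor_map_linear] _ assms(4)])
    (use assms in \<open>simp_all add: pt_smult_left real_linear_onD(1)[OF end_l_linear] real_linear_onD(1)[OF end_r_linear]\<close>)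

lemma tensor_map_smult_right:
  assumes "end_r f" "end_r (\<lambda>x. t \<odot>\<^bsub>W\<^esub> f x)" "end_l T" "X \<in> carrier U"
  shows "tensor_map N T (\<lambda>x. t \<odot>\<^bsub>W\<^esub> f x) X = t \<odot>\<^bsub>U\<^esub> tensor_map N T f X"
  by (rule U_linear_eq[OF real_space_U tensor_map_linear real_linear_on_smult[OF real_space_U tensor_map_linear] _ assms(4)])
    (use assms in \<open>simp_all add: pt_smult_right real_linear_onD(1)[OF end_l_linear] real_linear_onD(1)[OF end_r_linear]\<close>)

lemma end_l_opalg: "f \<in> AV \<Longrightarrow> end_l f"
proof -
  assume f: "f \<in> AV"
  have "\<forall>x\<in>carrier V. \<forall>a. f (rm x a) = rm (f x) a" using f
  proof (induction rule: opalg.induct)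
    case (add f g)
    then show ?case using V.opalg_closed real_linear_onD(2)[OF rm_linear] by simp
  next
    case (smult f t)
    then show ?case using V.opalg_closed real_linear_onD(3)[OF rm_linear] by simp
  qed (auto simp: c_rm V.opalg_closed)
  then show ?thesis using V.opalg_linear_c[OF f] by (simp add: end_l_def)
qed

lemma end_r_opalg: "f \<in> AW \<Longrightarrow> end_r f"
proof -
  assume f: "f \<in> AW"
  have "\<forall>x\<in>carrier W. \<forall>a. f (lm a x) = lm a (f x)" using f
  proof (induction rule: opalg.induct)
    case (add f g)
    then show ?case using W.opalg_closed real_linear_onD(2)[OF lm_linear] by simp
  next
    case (smult f t)
    then show ?case using W.opalg_closed real_linear_onD(3)[OF lm_linear] by simp
  qed (auto simp: c'_lm W.opalg_closed)
  then show ?thesis using W.opalg_linear_c[OF f] by (simp add: end_r_def)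
qed

lemma lift_c:
  assumes "u \<in> carrier_vec m" shows "tensor_map N (c u) (\<lambda>x. x) \<in> AU"
proof (rule opalg.cong[OF opalg.gen])
  let ?w = "u @\<^sub>v 0\<^sub>v r"
  have w: "?w \<in> carrier_vec (m + r)" and wu: "vec_first ?w m = u" "vec_last ?w r = 0\<^sub>v r"
    using assms by (simp_all add: vec_first_def vec_last_def) (auto intro!: eq_vecI)
  then show "act ?w \<in> act ` carrier_vec (m + r)" by blast
  fix X assume X: "X \<in> carrier U"
  show "tensor_map N (c u) (\<lambda>x. x) X = act ?w X"
  proof (rule U_linear_eq[OF real_space_U tensor_map_linear act_linear[OF w] _ X])
    fix x y assume "x \<in> carrier V" "y \<in> carrier W"
    then show "tensor_map N (c u) (\<lambda>x. x) (pt x y) = act ?w (pt x y)"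
      using assms by (simp add: act_pt[OF w] wu W.c_zero pt_zero_right)
  qed (use assms in simp_all)
qed

lemma lift_par_c':
  assumes "v \<in> carrier_vec r" shows "tensor_map N V.par (c' v) \<in> AU"
proof (rule opalg.cong[OF opalg.gen])
  let ?w = "0\<^sub>v m @\<^sub>v v"
  have w: "?w \<in> carrier_vec (m + r)" and wu: "vec_first ?w m = 0\<^sub>v m" "vec_last ?w r = v"
    using assms by (simp_all add: vec_first_def vec_last_def) (auto intro!: eq_vecI)
  then show "act ?w \<in> act ` carrier_vec (m + r)" by blast
  fix X assume X: "X \<in> carrier U"
  show "tensor_map N V.par (c' v) X = act ?w X"
  proof (rule U_linear_eq[OF real_space_U tensor_map_linear act_linear[OF w] _ X])
    fix x y assume "x \<in> carrier V" "y \<in> carrier W"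
    then show "tensor_map N V.par (c' v) (pt x y) = act ?w (pt x y)"
      using assms by (simp add: act_pt[OF w] wu V.c_zero pt_zero_left)
  qed (use assms in simp_all)
qed

sublocale left: operator_rep V "c ` carrier_vec m" U "\<lambda>f. tensor_map N f (\<lambda>x. x)"
proof unfold_locales
  show "tensor_map N g (\<lambda>x. x) X = tensor_map N f (\<lambda>x. x) X"
    if "f \<in> AV" "g \<in> AV" "\<And>x. x \<in> carrier V \<Longrightarrow> g x = f x" "X \<in> carrier U" for f g X
    using that by (intro tensor_map_cong) (auto simp: end_l_opalg)
qed (simp_all add: tensor_map_linear tensor_map_comp tensor_map_add_left tensor_map_smult_left end_l_opalg opalg.add opalg.smult)

sublocale right: operator_rep W "c' ` carrier_vec r" U "tensor_map N (\<lambda>x. x)"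
proof unfold_locales
  show "tensor_map N (\<lambda>x. x) g X = tensor_map N (\<lambda>x. x) f X"
    if "f \<in> AW" "g \<in> AW" "\<And>x. x \<in> carrier W \<Longrightarrow> g x = f x" "X \<in> carrier U" for f g X
    using that by (intro tensor_map_cong) (auto simp: end_r_opalg)
qed (simp_all add: tensor_map_linear tensor_map_comp tensor_map_add_right tensor_map_smult_right end_r_opalg opalg.add opalg.smult)

lemma lift_left: "f \<in> AV \<Longrightarrow> tensor_map N f (\<lambda>x. x) \<in> AU"
  by (rule left.rep_in_opalg) (use lift_c in blast)

text \<open>Once the parity of the first factor is available as an operator, it can be cancelled.\<close>

lemma lift_right:
  assumes par: "V.par \<in> AV" and "f \<in> AW" shows "tensor_map N (\<lambda>x. x) f \<in> AU"
proof (rule right.rep_in_opalg[OF _ assms(2)])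
  fix f assume "f \<in> c' ` carrier_vec r"
  then obtain v where v: "v \<in> carrier_vec r" "f = c' v" by blast
  show "tensor_map N (\<lambda>x. x) f \<in> AU" unfolding v(2)
  proof (rule opalg.cong[OF opalg.comp[OF lift_left[OF par] lift_par_c'[OF v(1)]]])
    fix X assume X: "X \<in> carrier U"
    then have "tensor_map N V.par (\<lambda>x. x) (tensor_map N V.par (c' v) X) = tensor_map N (\<lambda>x. V.par (V.par x)) (c' v) X"
      using v(1) by (simp add: tensor_map_comp)
    also have "\<dots> = tensor_map N (\<lambda>x. x) (c' v) X"
      using v(1) X by (intro tensor_map_cong) (simp_all add: end_l_comp)
    finally show "tensor_map N (\<lambda>x. x) (c' v) X = tensor_map N V.par (\<lambda>x. x) (tensor_map N V.par (c' v) X)" ..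
  qed
qed

text \<open>If every real-linear operator on the first factor comes from the Clifford action, a stable
  subspace of the tensor product is determined by its slice \<open>b \<otimes> W\<close>: the rank one operator \<open>p\<close>
  maps into that slice, and the ideal generated by \<open>p\<close> contains the identity.\<close>

lemma tensor_irreducible:
  assumes full: "full_real V (c ` carrier_vec m)" and par: "V.par \<in> AV" and irr: "irreducible_under W r c'"
  shows "irreducible_under U (m + r) act"
  unfolding irreducible_under_def
proof (intro allI impI)
  fix S assume S: "submodule S real_ring U" "stable (carrier_vec (m + r)) act S" "S \<noteq> {\<zero>\<^bsub>U\<^esub>}"
  obtain b \<beta> p where b: "b \<in> carrier V" and \<beta>: "real_linear_on V type_space \<beta>" and p: "p \<in> AV"
    and p_eq: "\<And>x. x \<in> carrier V \<Longrightarrow> p x = \<beta> x \<odot>\<^bsub>V\<^esub> b" and id: "(\<lambda>x. x) \<in> opideal V AV p"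
    using full unfolding full_real_def by blast
  note SD = U.subspaceD[OF S(1)]
  have S_op: "F X \<in> S" if "F \<in> AU" "X \<in> S" for F X
    by (rule U.opalg_stable_c[OF S(1,2) that])
  obtain w where w: "w \<in> S" "w \<noteq> \<zero>\<^bsub>U\<^esub>" using S(3) SD(2) by blast
  have wU: "w \<in> carrier U" using w SD(1) by blast
  obtain a where a: "a \<in> AV" "tensor_map N p (\<lambda>x. x) (tensor_map N a (\<lambda>x. x) w) \<noteq> \<zero>\<^bsub>U\<^esub>"
    using left.slice_nonzero[OF p id wU w(2)] by blast
  have pU: "\<exists>y\<in>carrier W. tensor_map N p (\<lambda>x. x) X = pt b y" if "X \<in> carrier U" for X
    using that
  proof (induction X rule: U_induct)
    case zero
    then show ?case using b pt_zero_right[OF b] W.M.zero_closed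
        real_linear_on_zero[OF real_space_U real_space_U tensor_map_linear[OF end_l_opalg[OF p] end_id(3)]] by metis
  next
    case (pt x y)
    then have "tensor_map N p (\<lambda>x. x) (pt x y) = pt b (\<beta> x \<odot>\<^bsub>W\<^esub> y)"
      using b p by (simp add: end_l_opalg p_eq pt_smult_left pt_smult_right)
    then show ?case using pt by blast
  next
    case (add X Y)
    then obtain y z where "y \<in> carrier W" "z \<in> carrier W"
      "tensor_map N p (\<lambda>x. x) X = pt b y" "tensor_map N p (\<lambda>x. x) Y = pt b z" by blast
    then show ?case using add(1,2) b p
      by (intro bexI[of _ "y \<oplus>\<^bsub>W\<^esub> z"])
        (simp_all add: pt_add_right real_linear_onD(2)[OF tensor_map_linear[OF end_l_opalg end_id(3)]])
  next
    case (smult t X)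
    then obtain y where "y \<in> carrier W" "tensor_map N p (\<lambda>x. x) X = pt b y" by blast
    then show ?case using smult(1) b p
      by (intro bexI[of _ "t \<odot>\<^bsub>W\<^esub> y"])
        (simp_all add: pt_smult_right real_linear_onD(3)[OF tensor_map_linear[OF end_l_opalg end_id(3)]])
  qed
  obtain y where y: "y \<in> carrier W" "tensor_map N p (\<lambda>x. x) (tensor_map N a (\<lambda>x. x) w) = pt b y"
    using pU[OF real_linear_onD(1)[OF left.rep_linear[OF a(1)] wU]] by blast
  have yS: "pt b y \<in> S"
    unfolding y(2)[symmetric] by (rule S_op[OF lift_left[OF p] S_op[OF lift_left[OF a(1)] w(1)]])
  have y0: "y \<noteq> \<zero>\<^bsub>W\<^esub>" using a(2) y(2) pt_zero_right[OF b] by auto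
  let ?W = "{y \<in> carrier W. pt b y \<in> S}"
  have "submodule ?W real_ring W"
    by (rule W.subspaceI) (use SD b in \<open>auto simp: pt_zero_right pt_add_right pt_smult_right\<close>)
  moreover have "stable (carrier_vec r) c' ?W"
    unfolding stable_def
  proof (intro ballI CollectI conjI)
    fix v :: "real vec" and z assume v: "v \<in> carrier_vec r" and z: "z \<in> ?W"
    then show "c' v z \<in> carrier W" by simp
    have "tensor_map N (\<lambda>x. x) (c' v) (pt b z) \<in> S"
      by (rule S_op[OF lift_right[OF par opalg.gen[OF imageI[OF v]]]]) (use z in simp)
    then show "pt b (c' v z) \<in> S" using v by simp
  qed
  ultimately have W: "?W = carrier W" using irr y y0 yS unfolding irreducible_under_def by blast
  show "S = carrier U"
  proof (rule left.slice_generates[OF p id S(1) S_op[OF lift_left]])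
    show "tensor_map N p (\<lambda>x. x) X \<in> S" if "X \<in> carrier U" for X
      using pU[OF that] W by auto
  qed
qed

text \<open>If every pure tensor can be rewritten as \<open>x \<otimes> 1\<close>, the tensor product is a quotient of the
  first factor.\<close>

lemma tensor_irreducible_quotient:
  assumes irr: "irreducible_under V m c" and e: "e \<in> carrier W"
    and pure: "\<And>x y. x \<in> carrier V \<Longrightarrow> y \<in> carrier W \<Longrightarrow> \<exists>x'\<in>carrier V. pt x y = pt x' e"
  shows "irreducible_under U (m + r) act"
  unfolding irreducible_under_def
proof (intro allI impI)
  fix S assume S: "submodule S real_ring U" "stable (carrier_vec (m + r)) act S" "S \<noteq> {\<zero>\<^bsub>U\<^esub>}"
  note SD = U.subspaceD[OF S(1)]
  have all: "\<exists>x\<in>carrier V. X = pt x e" if "X \<in> carrier U" for X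
    using that
  proof (induction X rule: U_induct)
    case zero
    then show ?case using pt_zero_left[OF e] V.M.zero_closed by metis
  next
    case (pt x y)
    then show ?case by (rule pure)
  next
    case (add X Y)
    then show ?case using pt_add_left[OF _ _ e] V.M.a_closed by metis
  next
    case (smult t X)
    then show ?case using pt_smult_left[OF _ e] V.smult_in by metis
  qed
  let ?V = "{x \<in> carrier V. pt x e \<in> S}"
  have "submodule ?V real_ring V"
    by (rule V.subspaceI) (use SD e in \<open>auto simp: pt_zero_left pt_add_left pt_smult_left\<close>)
  moreover have "stable (carrier_vec m) c ?V"
    unfolding stable_def
  proof (intro ballI CollectI conjI)
    fix u :: "real vec" and x assume u: "u \<in> carrier_vec m" and x: "x \<in> ?V"
    then show "c u x \<in> carrier V" by simp
    have "tensor_map N (c u) (\<lambda>x. x) (pt x e) \<in> S"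
      by (rule U.opalg_stable_c[OF S(1,2) lift_c[OF u]]) (use x in simp)
    then show "pt (c u x) e \<in> S" using u by simp
  qed
  moreover obtain X where X: "X \<in> S" "X \<noteq> \<zero>\<^bsub>U\<^esub>" using S(3) SD(2) by blast
  then obtain x where "x \<in> carrier V" "X = pt x e" using all SD(1) by blast
  then have "x \<in> ?V" "x \<noteq> \<zero>\<^bsub>V\<^esub>" using X pt_zero_left[OF e] by auto
  ultimately have "?V = carrier V" using irr unfolding irreducible_under_def by blast
  then show "S = carrier U" using all SD(1) by blast
qed

end

section \<open>Tensor powers\<close>

text \<open>A list of length \<open>k\<close> is written as a function on \<open>{..<k}\<close>, so that operators acting on single
  factors become function updates.\<close>

locale power_space = V: real_space V for V :: "(real, 'a) module" +
  fixes k :: nat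
begin

abbreviation "N \<equiv> power_null V k"
abbreviation "U \<equiv> tensor_power V k"
abbreviation "tuples \<equiv> {xs \<in> lists (carrier V). length xs = k}"

definition pw :: "(nat \<Rightarrow> 'a) \<Rightarrow> ('a list \<Rightarrow>\<^sub>0 real) set" where
  "pw \<xi> = coset N (gen (map \<xi> [0..<k]))"

definition pm :: "(nat \<Rightarrow> 'a \<Rightarrow> 'a) \<Rightarrow> ('a list \<Rightarrow>\<^sub>0 real) set \<Rightarrow> ('a list \<Rightarrow>\<^sub>0 real) set" where
  "pm \<tau> = power_map N (map \<tau> [0..<k])"

definition "vec_family \<xi> \<longleftrightarrow> (\<forall>i<k. \<xi> i \<in> carrier V)"
definition "op_family \<tau> \<longleftrightarrow> (\<forall>i<k. real_linear_on V V (\<tau> i))"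

lemma subspace_N: "subspace N"
  by (simp add: power_null_def)

lemma real_space_U: "real_space U"
  unfolding tensor_power_def by (rule real_space_quot_space[OF subspace_free_on subspace_N])

sublocale U: real_space U by (rule real_space_U)

lemma U_sel:
  "carrier U = coset N ` free_on tuples" "\<zero>\<^bsub>U\<^esub> = coset N 0"
  "coset N f \<oplus>\<^bsub>U\<^esub> coset N g = coset N (f + g)" "r \<odot>\<^bsub>U\<^esub> coset N f = coset N (r *\<^sub>R f)"
  by (simp_all add: tensor_power_def subspace_N)

lemma tuple_eq: "length xs = k \<Longrightarrow> map (\<lambda>i. xs ! i) [0..<k] = xs"
  by (auto intro: nth_equalityI)

lemma tuple_update: "i < k \<Longrightarrow> (map \<xi> [0..<k])[i := x] = map (\<xi>(i := x)) [0..<k]"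
  by (auto intro: nth_equalityI simp: nth_list_update)

lemma tuples_map: "map \<xi> [0..<k] \<in> tuples \<longleftrightarrow> vec_family \<xi>"
  by (auto simp: vec_family_def)

lemma power_relatorE:
  assumes "f \<in> power_relators V k"
  obtains \<xi> i x y where "vec_family \<xi>" "i < k" "x \<in> carrier V" "y \<in> carrier V"
      "f = gen (map (\<xi>(i := x \<oplus>\<^bsub>V\<^esub> y)) [0..<k]) - gen (map (\<xi>(i := x)) [0..<k]) - gen (map (\<xi>(i := y)) [0..<k])"
  | \<xi> i r x where "vec_family \<xi>" "i < k" "x \<in> carrier V"
      "f = gen (map (\<xi>(i := r \<odot>\<^bsub>V\<^esub> x)) [0..<k]) - r *\<^sub>R gen (map (\<xi>(i := x)) [0..<k])"
proof -
  have upd: "xs[i := x] = map ((\<lambda>i. xs ! i)(i := x)) [0..<k]" if "length xs = k" "i < k" for xs :: "'a list" and i x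
    using tuple_update[of i "\<lambda>i. xs ! i" x] that by (simp add: tuple_eq)
  have vf: "vec_family (\<lambda>i. xs ! i)" if "xs \<in> lists (carrier V)" "length xs = k" for xs
    using that by (auto simp: vec_family_def)
  consider xs i x y where "xs \<in> lists (carrier V)" "length xs = k" "i < k" "x \<in> carrier V" "y \<in> carrier V"
      "f = gen (xs[i := x \<oplus>\<^bsub>V\<^esub> y]) - gen (xs[i := x]) - gen (xs[i := y])"
    | xs i r x where "xs \<in> lists (carrier V)" "length xs = k" "i < k" "x \<in> carrier V"
      "f = gen (xs[i := r \<odot>\<^bsub>V\<^esub> x]) - r *\<^sub>R gen (xs[i := x])"
    using assms unfolding power_relators_def by blast
  then show ?thesis
  proof cases
    case 1
    then show ?thesis using that(1)[OF vf[OF 1(1,2)] 1(3-5)] by (simp add: upd)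
  next
    case 2
    then show ?thesis using that(2)[OF vf[OF 2(1,2)] 2(3,4)] by (simp add: upd)
  qed
qed

lemma in_N: "f \<in> power_relators V k \<Longrightarrow> f \<in> N"
  by (simp add: power_null_def span_base)

lemma relator_add:
  assumes "vec_family \<xi>" "i < k" "x \<in> carrier V" "y \<in> carrier V"
  shows "gen (map (\<xi>(i := x \<oplus>\<^bsub>V\<^esub> y)) [0..<k]) - gen (map (\<xi>(i := x)) [0..<k]) - gen (map (\<xi>(i := y)) [0..<k]) \<in> N"
proof (rule in_N)
  have "map \<xi> [0..<k] \<in> lists (carrier V)" "length (map \<xi> [0..<k]) = k"
    using assms(1) tuples_map[of \<xi>] by simp_all
  then show "gen (map (\<xi>(i := x \<oplus>\<^bsub>V\<^esub> y)) [0..<k]) - gen (map (\<xi>(i := x)) [0..<k]) - gen (map (\<xi>(i := y)) [0..<k])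
      \<in> power_relators V k"
    unfolding power_relators_def tuple_update[OF assms(2), symmetric] using assms(2-4) by blast
qed

lemma relator_smult:
  assumes "vec_family \<xi>" "i < k" "x \<in> carrier V"
  shows "gen (map (\<xi>(i := r \<odot>\<^bsub>V\<^esub> x)) [0..<k]) - r *\<^sub>R gen (map (\<xi>(i := x)) [0..<k]) \<in> N"
proof (rule in_N)
  have "map \<xi> [0..<k] \<in> lists (carrier V)" "length (map \<xi> [0..<k]) = k"
    using assms(1) tuples_map[of \<xi>] by simp_all
  then show "gen (map (\<xi>(i := r \<odot>\<^bsub>V\<^esub> x)) [0..<k]) - r *\<^sub>R gen (map (\<xi>(i := x)) [0..<k]) \<in> power_relators V k"
    unfolding power_relators_def tuple_update[OF assms(2), symmetric] using assms(2-3) by blast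
qed

lemma vec_family_upd [simp]: "vec_family \<xi> \<Longrightarrow> x \<in> carrier V \<Longrightarrow> vec_family (\<xi>(i := x))"
  by (auto simp: vec_family_def)

lemma pw_add:
  "vec_family \<xi> \<Longrightarrow> i < k \<Longrightarrow> x \<in> carrier V \<Longrightarrow> y \<in> carrier V \<Longrightarrow>
    pw (\<xi>(i := x \<oplus>\<^bsub>V\<^esub> y)) = pw (\<xi>(i := x)) \<oplus>\<^bsub>U\<^esub> pw (\<xi>(i := y))"
  using relator_add by (simp add: pw_def U_sel coset_eq_iff[OF subspace_N] diff_diff_add)

lemma pw_smult:
  "vec_family \<xi> \<Longrightarrow> i < k \<Longrightarrow> x \<in> carrier V \<Longrightarrow> pw (\<xi>(i := r \<odot>\<^bsub>V\<^esub> x)) = r \<odot>\<^bsub>U\<^esub> pw (\<xi>(i := x))"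
  using relator_smult by (simp add: pw_def U_sel coset_eq_iff[OF subspace_N])

lemma pw_cong: "(\<And>i. i < k \<Longrightarrow> \<xi> i = \<eta> i) \<Longrightarrow> pw \<xi> = pw \<eta>"
  unfolding pw_def by (metis (mono_tags, lifting) atLeastLessThan_iff map_cong set_upt)

lemma pw_closed [simp]: "vec_family \<xi> \<Longrightarrow> pw \<xi> \<in> carrier U"
  using tuples_map[of \<xi>] unfolding pw_def U_sel by (intro imageI single_in_free_on) simp

lemma U_induct [consumes 1, case_names zero pw add smult]:
  assumes "X \<in> carrier U" "P \<zero>\<^bsub>U\<^esub>" "\<And>\<xi>. vec_family \<xi> \<Longrightarrow> P (pw \<xi>)"
    and "\<And>X Y. X \<in> carrier U \<Longrightarrow> Y \<in> carrier U \<Longrightarrow> P X \<Longrightarrow> P Y \<Longrightarrow> P (X \<oplus>\<^bsub>U\<^esub> Y)"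
    and "\<And>r X. X \<in> carrier U \<Longrightarrow> P X \<Longrightarrow> P (r \<odot>\<^bsub>U\<^esub> X)"
  shows "P X"
proof -
  have "P (coset N (gen xs))" if "xs \<in> tuples" for xs
    using assms(3)[of "\<lambda>i. xs ! i"] that tuples_map[of "\<lambda>i. xs ! i"] by (simp add: pw_def tuple_eq)
  note gens = this
  show ?thesis
    using subspace_N assms(1) unfolding tensor_power_def
    by (induction rule: quot_free_induct) (use gens assms(2,4,5) in \<open>simp_all add: tensor_power_def\<close>)
qed

lemma U_linear_eq:
  assumes "real_space Z" "real_linear_on U Z f" "real_linear_on U Z g"
    and "\<And>\<xi>. vec_family \<xi> \<Longrightarrow> f (pw \<xi>) = g (pw \<xi>)" "X \<in> carrier U"
  shows "f X = g X"
proof (rule quot_free_linear_eq[OF subspace_N assms(1), of tuples])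
  fix xs assume "xs \<in> tuples"
  then show "f (coset N (gen xs)) = g (coset N (gen xs))"
    using assms(4)[of "\<lambda>i. xs ! i"] tuples_map[of "\<lambda>i. xs ! i"] by (simp add: pw_def tuple_eq)
qed (use assms in \<open>auto simp: tensor_power_def\<close>)

lemma op_familyD:
  assumes "op_family \<tau>" "i < k"
  shows "x \<in> carrier V \<Longrightarrow> \<tau> i x \<in> carrier V"
    "x \<in> carrier V \<Longrightarrow> y \<in> carrier V \<Longrightarrow> \<tau> i (x \<oplus>\<^bsub>V\<^esub> y) = \<tau> i x \<oplus>\<^bsub>V\<^esub> \<tau> i y"
    "x \<in> carrier V \<Longrightarrow> \<tau> i (r \<odot>\<^bsub>V\<^esub> x) = r \<odot>\<^bsub>V\<^esub> \<tau> i x"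
  using assms by (auto simp: op_family_def dest: real_linear_onD)

lemma op_vec_family [simp]: "op_family \<tau> \<Longrightarrow> vec_family \<xi> \<Longrightarrow> vec_family (\<lambda>i. \<tau> i (\<xi> i))"
  by (auto simp: vec_family_def dest: op_familyD)

lemma map2_family: "map2 (\<lambda>T x. T x) (map \<tau> [0..<k]) (map \<xi> [0..<k]) = map (\<lambda>i. \<tau> i (\<xi> i)) [0..<k]"
  by (simp add: map2_map_map)

lemma pm_coset:
  assumes "op_family \<tau>"
  shows "pm \<tau> (coset N f) = coset N (lin_ext (\<lambda>xs. gen (map2 (\<lambda>T x. T x) (map \<tau> [0..<k]) xs)) f)"
  unfolding pm_def power_map_def
proof (rule coset_lift[OF subspace_N linear_lin_ext])
  let ?L = "lin_ext (\<lambda>xs. gen (map2 (\<lambda>T x. T x) (map \<tau> [0..<k]) xs))"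
  note L = linear_diff[OF linear_lin_ext] linear_scale[OF linear_lin_ext]
  have upd: "?L (gen (map (\<xi>(i := x)) [0..<k])) = gen (map ((\<lambda>i. \<tau> i (\<xi> i))(i := \<tau> i x)) [0..<k])" for \<xi> i x
    unfolding lin_ext_single map2_family by (auto intro!: arg_cong[where f = gen])
  have rel: "?L f \<in> N" if "f \<in> power_relators V k" for f
    using that
  proof (cases rule: power_relatorE)
    case (1 \<xi> i x y)
    then show ?thesis
      using relator_add[of "\<lambda>i. \<tau> i (\<xi> i)" i "\<tau> i x" "\<tau> i y"] assms
      by (simp only: L upd op_familyD) (simp add: op_familyD)
  next
    case (2 \<xi> i r x)
    then show ?thesis
      using relator_smult[of "\<lambda>i. \<tau> i (\<xi> i)" i "\<tau> i x" r] assms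
      by (simp only: L upd op_familyD) (simp add: op_familyD)
  qed
  have "?L f \<in> N" if "f \<in> N" for f
    using that unfolding power_null_def
  proof (induction rule: span_induct_alt)
    case base
    then show ?case by (simp add: linear_0[OF linear_lin_ext] span_zero)
  next
    case (step c x y)
    then show ?case using rel[of x]
      by (auto simp: linear_add[OF linear_lin_ext] L power_null_def intro: span_add span_scale)
  qed
  then show "?L ` N \<subseteq> N" by blast
qed

lemma pm_pw [simp]: "op_family \<tau> \<Longrightarrow> pm \<tau> (pw \<xi>) = pw (\<lambda>i. \<tau> i (\<xi> i))"
  by (simp only: pw_def pm_coset lin_ext_single map2_family scaleR_one)

lemma pm_linear:
  assumes "op_family \<tau>" shows "real_linear_on U U (pm \<tau>)"
proof (rule real_linear_onI)
  let ?L = "lin_ext (\<lambda>xs. gen (map2 (\<lambda>T x. T x) (map \<tau> [0..<k]) xs))"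
  have "?L f \<in> free_on tuples" if "f \<in> free_on tuples" for f
    using that
  proof (induction rule: free_on_induct)
    case (single xs r)
    then have "map2 (\<lambda>T x. T x) (map \<tau> [0..<k]) xs = map (\<lambda>i. \<tau> i (xs ! i)) [0..<k]"
      using map2_family[of \<tau> "\<lambda>i. xs ! i"] by (simp add: tuple_eq)
    moreover have "map (\<lambda>i. \<tau> i (xs ! i)) [0..<k] \<in> tuples"
      unfolding tuples_map using assms single tuples_map[of "\<lambda>i. xs ! i"] by (simp add: tuple_eq)
    ultimately show ?case by (simp only: lin_ext_single scaleR_single single_in_free_on)
  qed (auto simp: linear_0[OF linear_lin_ext] linear_add[OF linear_lin_ext]
      intro: subspace_0[OF subspace_free_on] subspace_add[OF subspace_free_on])
  then show "pm \<tau> X \<in> carrier U" if "X \<in> carrier U" for X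
    using that by (auto simp: U_sel pm_coset[OF assms])
qed (auto simp: U_sel pm_coset[OF assms] linear_add[OF linear_lin_ext] linear_scale[OF linear_lin_ext])

lemmas pm_closed = real_linear_onD(1)[OF pm_linear]

lemma op_family_comp: "op_family \<sigma> \<Longrightarrow> op_family \<tau> \<Longrightarrow> op_family (\<lambda>i x. \<sigma> i (\<tau> i x))"
  by (auto simp: op_family_def intro: real_linear_on_comp)

lemma pm_comp:
  assumes "op_family \<sigma>" "op_family \<tau>" "X \<in> carrier U"
  shows "pm \<sigma> (pm \<tau> X) = pm (\<lambda>i x. \<sigma> i (\<tau> i x)) X"
  by (rule U_linear_eq[OF real_space_U real_linear_on_comp[OF pm_linear pm_linear] pm_linear _ assms(3)])
    (simp_all add: assms op_family_comp)

lemma pm_cong: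
  assumes "op_family \<sigma>" "op_family \<tau>" "X \<in> carrier U" "\<And>i x. i < k \<Longrightarrow> x \<in> carrier V \<Longrightarrow> \<sigma> i x = \<tau> i x"
  shows "pm \<sigma> X = pm \<tau> X"
  by (rule U_linear_eq[OF real_space_U pm_linear pm_linear _ assms(3)])
    (simp_all add: assms(1,2), rule pw_cong, simp add: assms(4) vec_family_def)

lemma pm_comp_eq:
  assumes "op_family \<sigma>" "op_family \<tau>" "op_family \<rho>" "X \<in> carrier U"
    and "\<And>i x. i < k \<Longrightarrow> x \<in> carrier V \<Longrightarrow> \<sigma> i (\<tau> i x) = \<rho> i x"
  shows "pm \<sigma> (pm \<tau> X) = pm \<rho> X"
  unfolding pm_comp[OF assms(1,2,4)] by (rule pm_cong[OF op_family_comp]) (use assms in blast)+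

lemma op_family_if: "real_linear_on V V T \<Longrightarrow> op_family (\<lambda>i x. if P i then T x else x)"
  by (auto simp: op_family_def real_linear_on_def)

lemma op_family_id [simp]: "op_family (\<lambda>i x. x)"
  by (simp add: op_family_def real_linear_on_id)

lemma pm_id [simp]: "X \<in> carrier U \<Longrightarrow> pm (\<lambda>i x. x) X = X"
  by (rule U_linear_eq[OF real_space_U pm_linear real_linear_on_id(1)]) simp_all

lemma pw_scale:
  assumes "vec_family \<xi>" shows "pw (\<lambda>i. r i \<odot>\<^bsub>V\<^esub> \<xi> i) = (\<Prod>i<k. r i) \<odot>\<^bsub>U\<^esub> pw \<xi>"
proof -
  have "pw (\<lambda>i. if i < m then r i \<odot>\<^bsub>V\<^esub> \<xi> i else \<xi> i) = (\<Prod>i<m. r i) \<odot>\<^bsub>U\<^esub> pw \<xi>" if "m \<le> k" for m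
    using that
  proof (induction m)
    case 0
    then show ?case using assms by simp
  next
    case (Suc m)
    let ?\<eta> = "\<lambda>i. if i < m then r i \<odot>\<^bsub>V\<^esub> \<xi> i else \<xi> i"
    have v: "vec_family ?\<eta>" "\<xi> m \<in> carrier V" using assms Suc by (auto simp: vec_family_def)
    have "pw (\<lambda>i. if i < Suc m then r i \<odot>\<^bsub>V\<^esub> \<xi> i else \<xi> i) = pw (?\<eta>(m := r m \<odot>\<^bsub>V\<^esub> \<xi> m))"
      by (rule pw_cong) (auto simp: less_Suc_eq)
    also have "\<dots> = r m \<odot>\<^bsub>U\<^esub> pw (?\<eta>(m := \<xi> m))" using v Suc by (intro pw_smult) auto
    also have "?\<eta>(m := \<xi> m) = ?\<eta>" by auto
    finally show ?case using Suc assms by (simp add: U.smult_smult mult.commute)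
  qed
  from this[of k] show ?thesis using pw_cong[of "\<lambda>i. if i < k then r i \<odot>\<^bsub>V\<^esub> \<xi> i else \<xi> i" "\<lambda>i. r i \<odot>\<^bsub>V\<^esub> \<xi> i"] by simp
qed

text \<open>The functional \<open>\<beta> \<otimes> \<dots> \<otimes> \<beta>\<close>.\<close>

lemma power_functional:
  assumes \<beta>: "real_linear_on V type_space (\<beta> :: 'a \<Rightarrow> real)"
  obtains \<gamma> where "real_linear_on U type_space \<gamma>" "\<And>\<xi>. vec_family \<xi> \<Longrightarrow> \<gamma> (pw \<xi>) = (\<Prod>i<k. \<beta> (\<xi> i))"
proof -
  let ?L = "lin_ext (\<lambda>xs. \<Prod>i<k. \<beta> (xs ! i))"
  note L = linear_diff[OF linear_lin_ext] linear_scale[OF linear_lin_ext]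
  have upd: "?L (gen (map (\<xi>(i := x)) [0..<k])) = \<beta> x * (\<Prod>j\<in>{..<k} - {i}. \<beta> (\<xi> j))" if "i < k" for \<xi> i x
  proof -
    have "?L (gen (map (\<xi>(i := x)) [0..<k])) = (\<Prod>j<k. \<beta> ((\<xi>(i := x)) j))"
      by (simp add: lin_ext_single)
    also have "\<dots> = \<beta> x * (\<Prod>j\<in>{..<k} - {i}. \<beta> ((\<xi>(i := x)) j))"
      using that by (subst prod.remove[of _ i]) auto
    also have "(\<Prod>j\<in>{..<k} - {i}. \<beta> ((\<xi>(i := x)) j)) = (\<Prod>j\<in>{..<k} - {i}. \<beta> (\<xi> j))"
      by (rule prod.cong) auto
    finally show ?thesis .
  qed
  have rel: "?L f = 0" if "f \<in> power_relators V k" for f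
    using that
  proof (cases rule: power_relatorE)
    case (1 \<xi> i x y)
    then show ?thesis using real_linear_onD(2)[OF \<beta>] by (simp only: L upd) (simp add: algebra_simps)
  next
    case (2 \<xi> i r x)
    then show ?thesis using real_linear_onD(3)[OF \<beta>] by (simp only: L upd) simp
  qed
  have N0: "?L f = 0" if "f \<in> N" for f
    using that unfolding power_null_def
  proof (induction rule: span_induct_alt)
    case base
    then show ?case by (rule linear_0[OF linear_lin_ext])
  next
    case (step c x y)
    then show ?case using rel[of x] by (simp add: linear_add[OF linear_lin_ext] L)
  qed
  have "N \<subseteq> free_on tuples" unfolding power_null_def
  proof (rule span_minimal[OF _ subspace_free_on])
    show "power_relators V k \<subseteq> free_on tuples"
    proof
      fix f assume "f \<in> power_relators V k"
      then show "f \<in> free_on tuples"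
        by (cases rule: power_relatorE)
          (auto intro!: subspace_diff[OF subspace_free_on] subspace_scale[OF subspace_free_on] single_in_free_on
            simp del: map_eq_conv simp: vec_family_def split: if_splits)
    qed
  qed
  note q = quot_lift_linear[OF subspace_N this subspace_free_on linear_lin_ext N0]
  show ?thesis
  proof (rule that[of "quot_lift ?L"])
    show "real_linear_on U type_space (quot_lift ?L)" using q(1) by (simp add: tensor_power_def)
    fix \<xi> assume "vec_family \<xi>"
    then have "gen (map \<xi> [0..<k]) \<in> free_on tuples" using tuples_map[of \<xi>] by (intro single_in_free_on) simp
    then show "quot_lift ?L (pw \<xi>) = (\<Prod>i<k. \<beta> (\<xi> i))"
      unfolding pw_def by (simp only: q(2)) (simp add: lin_ext_single)
  qed
qed

definition slot :: "nat \<Rightarrow> ('a \<Rightarrow> 'a) \<Rightarrow> ('a list \<Rightarrow>\<^sub>0 real) set \<Rightarrow> ('a list \<Rightarrow>\<^sub>0 real) set" where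
  "slot j T = pm (\<lambda>i x. if i = j then T x else x)"

lemma slot_pw: "real_linear_on V V T \<Longrightarrow> slot j T (pw \<xi>) = pw (\<xi>(j := T (\<xi> j)))"
  unfolding slot_def by (simp add: op_family_if) (rule pw_cong, simp)

lemma slot_linear: "real_linear_on V V T \<Longrightarrow> real_linear_on U U (slot j T)"
  unfolding slot_def by (intro pm_linear op_family_if)

lemma slot_add:
  assumes "real_linear_on V V f" "real_linear_on V V g" "j < k" "X \<in> carrier U"
  shows "slot j (\<lambda>x. f x \<oplus>\<^bsub>V\<^esub> g x) X = slot j f X \<oplus>\<^bsub>U\<^esub> slot j g X"
proof (rule U_linear_eq[OF real_space_U slot_linear real_linear_on_add[OF real_space_U slot_linear slot_linear] _ assms(4)])
  fix \<xi> assume \<xi>: "vec_family \<xi>"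
  then have "\<xi> j \<in> carrier V" using assms(3) by (simp add: vec_family_def)
  then show "slot j (\<lambda>x. f x \<oplus>\<^bsub>V\<^esub> g x) (pw \<xi>) = slot j f (pw \<xi>) \<oplus>\<^bsub>U\<^esub> slot j g (pw \<xi>)"
    using \<xi> assms real_linear_onD(1)[OF assms(1)] real_linear_onD(1)[OF assms(2)]
    by (simp add: slot_pw pw_add real_linear_on_add V.real_space_axioms)
qed (use assms in \<open>auto intro!: real_linear_on_add V.real_space_axioms\<close>)

lemma slot_smult:
  assumes "real_linear_on V V f" "j < k" "X \<in> carrier U"
  shows "slot j (\<lambda>x. t \<odot>\<^bsub>V\<^esub> f x) X = t \<odot>\<^bsub>U\<^esub> slot j f X"
proof (rule U_linear_eq[OF real_space_U slot_linear real_linear_on_smult[OF real_space_U slot_linear] _ assms(3)])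
  fix \<xi> assume \<xi>: "vec_family \<xi>"
  then have "\<xi> j \<in> carrier V" using assms(2) by (simp add: vec_family_def)
  then show "slot j (\<lambda>x. t \<odot>\<^bsub>V\<^esub> f x) (pw \<xi>) = t \<odot>\<^bsub>U\<^esub> slot j f (pw \<xi>)"
    using \<xi> assms real_linear_onD(1)[OF assms(1)]
    by (simp add: slot_pw pw_smult real_linear_on_smult V.real_space_axioms)
qed (use assms in \<open>auto intro!: real_linear_on_smult V.real_space_axioms\<close>)

end

locale power_clifford_space = power_space V k + V: graded_clifford V G n c
  for V :: "(real, 'a) module" and G n c k
begin

abbreviation "act \<equiv> power_clifford V G n c k"
abbreviation "UG \<equiv> power_grading V k G"

definition block :: "nat \<Rightarrow> real vec \<Rightarrow> real vec" where
  "block j u = vec n (\<lambda>i. u $ (n * j + i))"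

definition term_op :: "nat \<Rightarrow> real vec \<Rightarrow> nat \<Rightarrow> 'a \<Rightarrow> 'a" where
  "term_op j v i = (if i < j then V.par else if i = j then c v else (\<lambda>x. x))"

lemma block_in [simp]: "block j u \<in> carrier_vec n"
  by (simp add: block_def)

lemma op_family_term: "v \<in> carrier_vec n \<Longrightarrow> op_family (term_op j v)"
  by (auto simp: op_family_def term_op_def V.par_linear V.c_linear real_linear_on_id)

text \<open>The sum over the first \<open>m\<close> factors, for inductions on the number of factors.\<close>

definition partial_act :: "nat \<Rightarrow> real vec \<Rightarrow> ('a list \<Rightarrow>\<^sub>0 real) set \<Rightarrow> ('a list \<Rightarrow>\<^sub>0 real) set" where
  "partial_act m u X = (\<Oplus>\<^bsub>U\<^esub>j\<in>{..<m}. pm (term_op j (block j u)) X)"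

lemma partial_act_0: "partial_act 0 u X = \<zero>\<^bsub>U\<^esub>"
  by (simp add: partial_act_def)

lemma pm_term_closed [simp]: "v \<in> carrier_vec n \<Longrightarrow> X \<in> carrier U \<Longrightarrow> pm (term_op j v) X \<in> carrier U"
  by (rule pm_closed[OF op_family_term])

lemma act_eq:
  assumes X: "X \<in> carrier U" shows "act u X = partial_act k u X"
proof -
  have "replicate j V.par @ [c (block j u)] @ replicate (k - Suc j) id = map (term_op j (block j u)) [0..<k]" if "j < k" for j
    using that by (intro nth_equalityI) (auto simp: nth_append term_op_def nth_Cons' id_def)
  then show "act u X = partial_act k u X"
    unfolding power_clifford_def partial_act_def pm_def block_def[symmetric]
    by (intro U.M.finsum_cong) (auto simp: simp_implies_def X intro!: pm_term_closed[unfolded pm_def])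
qed

lemma partial_act_Suc:
  "X \<in> carrier U \<Longrightarrow> partial_act (Suc m) u X = pm (term_op m (block m u)) X \<oplus>\<^bsub>U\<^esub> partial_act m u X"
  unfolding partial_act_def lessThan_Suc by (subst U.M.finsum_insert) auto

lemma partial_act_linear: "real_linear_on U U (partial_act m u)"
proof (induction m)
  case 0
  then show ?case by (simp add: partial_act_0[abs_def] real_linear_on_def)
next
  case (Suc m)
  have "real_linear_on U U (\<lambda>X. pm (term_op m (block m u)) X \<oplus>\<^bsub>U\<^esub> partial_act m u X)"
    by (intro real_linear_on_add[OF real_space_U] pm_linear op_family_term Suc) simp
  then show ?case by (rule real_linear_on_cong[OF real_space_U]) (rule partial_act_Suc)
qed

lemmas partial_actD [simp] = real_linear_onD[OF partial_act_linear]

lemma pw_minus: "vec_family \<xi> \<Longrightarrow> i < k \<Longrightarrow> x \<in> carrier V \<Longrightarrow> pw (\<xi>(i := \<ominus>\<^bsub>V\<^esub> x)) = \<ominus>\<^bsub>U\<^esub> pw (\<xi>(i := x))"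
  using pw_smult[of \<xi> i x "- 1"] by (simp add: V.minus_1_smult U.minus_1_smult)

lemma pw_minus_same:
  assumes "vec_family \<xi>" "i < k" shows "pw (\<xi>(i := \<ominus>\<^bsub>V\<^esub> \<xi> i)) = \<ominus>\<^bsub>U\<^esub> pw \<xi>"
  using pw_minus[OF assms, of "\<xi> i", unfolded fun_upd_triv] assms by (simp add: vec_family_def)

lemma term_op_vec: "v \<in> carrier_vec n \<Longrightarrow> vec_family \<xi> \<Longrightarrow> vec_family (\<lambda>i. term_op j v i (\<xi> i))"
  by (rule op_vec_family[OF op_family_term])

text \<open>Terms for different factors anticommute, because the parity map in front of the later one
  meets the odd operator of the earlier one exactly once.\<close>

lemma term_anticommute:
  assumes "v \<in> carrier_vec n" "w \<in> carrier_vec n" "j < l" "l < k" "X \<in> carrier U"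
  shows "pm (term_op l w) (pm (term_op j v) X) = \<ominus>\<^bsub>U\<^esub> pm (term_op j v) (pm (term_op l w) X)"
proof (rule U_linear_eq[OF real_space_U _ _ _ assms(5)])
  show "real_linear_on U U (\<lambda>X. pm (term_op l w) (pm (term_op j v) X))"
    by (intro real_linear_on_comp[OF pm_linear pm_linear] op_family_term assms)
  show "real_linear_on U U (\<lambda>X. \<ominus>\<^bsub>U\<^esub> pm (term_op j v) (pm (term_op l w) X))"
    by (intro real_linear_on_minus real_space_U real_linear_on_comp[OF pm_linear pm_linear] op_family_term assms)
  fix \<xi> assume \<xi>: "vec_family \<xi>"
  let ?\<eta> = "\<lambda>i. term_op j v i (term_op l w i (\<xi> i))"
  have \<eta>: "vec_family ?\<eta>" by (intro term_op_vec assms \<xi>)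
  have "term_op l w i (term_op j v i (\<xi> i)) = (?\<eta>(j := \<ominus>\<^bsub>V\<^esub> ?\<eta> j)) i" if "i < k" for i
    using that \<xi> assms by (auto simp: term_op_def vec_family_def V.odd)
  then have "pw (\<lambda>i. term_op l w i (term_op j v i (\<xi> i))) = pw (?\<eta>(j := \<ominus>\<^bsub>V\<^esub> ?\<eta> j))"
    by (rule pw_cong)
  also have "\<dots> = \<ominus>\<^bsub>U\<^esub> pw ?\<eta>"
    using assms(3,4) by (intro pw_minus_same[OF \<eta>]) simp
  finally show "pm (term_op l w) (pm (term_op j v) (pw \<xi>)) = \<ominus>\<^bsub>U\<^esub> pm (term_op j v) (pm (term_op l w) (pw \<xi>))"
    using assms by (simp add: op_family_term)
qed

lemma term_clifford:
  assumes "v \<in> carrier_vec n" "w \<in> carrier_vec n" "j < k" "X \<in> carrier U"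
  shows "pm (term_op j v) (pm (term_op j w) X) \<oplus>\<^bsub>U\<^esub> pm (term_op j w) (pm (term_op j v) X) = (- 2 * scalar_prod v w) \<odot>\<^bsub>U\<^esub> X"
proof (rule U_linear_eq[OF real_space_U _ _ _ assms(4)])
  show "real_linear_on U U (\<lambda>X. pm (term_op j v) (pm (term_op j w) X) \<oplus>\<^bsub>U\<^esub> pm (term_op j w) (pm (term_op j v) X))"
    by (intro real_linear_on_add real_space_U real_linear_on_comp[OF pm_linear pm_linear] op_family_term assms)
  show "real_linear_on U U (\<lambda>X. (- 2 * scalar_prod v w) \<odot>\<^bsub>U\<^esub> X)"
    by (intro real_linear_on_smult real_space_U real_linear_on_id)
  fix \<xi> assume \<xi>: "vec_family \<xi>"
  then have x: "\<xi> j \<in> carrier V" using assms(3) by (simp add: vec_family_def)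
  have 1: "pw (\<lambda>i. term_op j v i (term_op j w i (\<xi> i))) = pw (\<xi>(j := c v (c w (\<xi> j))))" for v w
    by (rule pw_cong) (use \<xi> in \<open>auto simp: term_op_def vec_family_def\<close>)
  have "pm (term_op j v) (pm (term_op j w) (pw \<xi>)) \<oplus>\<^bsub>U\<^esub> pm (term_op j w) (pm (term_op j v) (pw \<xi>))
      = pw (\<xi>(j := c v (c w (\<xi> j)) \<oplus>\<^bsub>V\<^esub> c w (c v (\<xi> j))))"
    using assms \<xi> x by (simp add: op_family_term 1 pw_add)
  also have "\<dots> = (- 2 * scalar_prod v w) \<odot>\<^bsub>U\<^esub> pw (\<xi>(j := \<xi> j))"
    using assms \<xi> x by (simp only: V.c_rel pw_smult)
  finally show "pm (term_op j v) (pm (term_op j w) (pw \<xi>)) \<oplus>\<^bsub>U\<^esub> pm (term_op j w) (pm (term_op j v) (pw \<xi>))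
      = (- 2 * scalar_prod v w) \<odot>\<^bsub>U\<^esub> pw \<xi>" by simp
qed

lemma partial_act_anticommute:
  assumes "m < k" "p \<le> m" "w \<in> carrier_vec n" "X \<in> carrier U"
  shows "pm (term_op m w) (partial_act p u X) = \<ominus>\<^bsub>U\<^esub> partial_act p u (pm (term_op m w) X)"
  using assms(2)
proof (induction p)
  case 0
  then show ?case
    using real_linear_on_zero[OF real_space_U real_space_U pm_linear[OF op_family_term[OF assms(3)]]]
    by (simp add: partial_act_0)
next
  case (Suc p)
  then show ?case using assms
    by (simp add: partial_act_Suc real_linear_onD(2)[OF pm_linear[OF op_family_term]] term_anticommute U.M.minus_add)
qed

lemma partial_act_clifford:
  assumes "m \<le> k" "X \<in> carrier U"
  shows "partial_act m u (partial_act m u' X) \<oplus>\<^bsub>U\<^esub> partial_act m u' (partial_act m u X)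
    = (- 2 * (\<Sum>j<m. scalar_prod (block j u) (block j u'))) \<odot>\<^bsub>U\<^esub> X"
  using assms(1)
proof (induction m)
  case 0
  then show ?case using assms(2) by (simp add: partial_act_0)
next
  case (Suc m)
  have e: "partial_act (Suc m) u (partial_act (Suc m) u' X) =
      pm (term_op m (block m u)) (pm (term_op m (block m u')) X)
      \<oplus>\<^bsub>U\<^esub> \<ominus>\<^bsub>U\<^esub> partial_act m u' (pm (term_op m (block m u)) X)
      \<oplus>\<^bsub>U\<^esub> (partial_act m u (pm (term_op m (block m u')) X) \<oplus>\<^bsub>U\<^esub> partial_act m u (partial_act m u' X))" for u u'
    using assms(2) Suc(2)
    by (simp add: partial_act_Suc real_linear_onD(2)[OF pm_linear[OF op_family_term]] partial_act_anticommute)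
      (simp add: U.M.a_ac)
  have "partial_act (Suc m) u (partial_act (Suc m) u' X) \<oplus>\<^bsub>U\<^esub> partial_act (Suc m) u' (partial_act (Suc m) u X) =
    (pm (term_op m (block m u)) (pm (term_op m (block m u')) X) \<oplus>\<^bsub>U\<^esub> pm (term_op m (block m u')) (pm (term_op m (block m u)) X))
    \<oplus>\<^bsub>U\<^esub> (partial_act m u (partial_act m u' X) \<oplus>\<^bsub>U\<^esub> partial_act m u' (partial_act m u X))"
    unfolding e by (rule U.cancel_cross_terms) (use assms(2) in simp_all)
  also have "\<dots> = (- 2 * scalar_prod (block m u) (block m u')) \<odot>\<^bsub>U\<^esub> X
      \<oplus>\<^bsub>U\<^esub> (- 2 * (\<Sum>j<m. scalar_prod (block j u) (block j u'))) \<odot>\<^bsub>U\<^esub> X"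
    using Suc assms(2) term_clifford[of "block m u" "block m u'" m X] by simp
  also have "\<dots> = (- 2 * (\<Sum>j<Suc m. scalar_prod (block j u) (block j u'))) \<odot>\<^bsub>U\<^esub> X"
    using assms(2) by (simp add: algebra_simps flip: U.smult_add_left)
  finally show ?case .
qed

lemma scalar_prod_blocks:
  assumes "u' \<in> carrier_vec (n * k)"
  shows "scalar_prod u u' = (\<Sum>j<k. scalar_prod (block j u) (block j u'))"
proof -
  have "(\<Sum>j<k. scalar_prod (block j u) (block j u')) = (\<Sum>j<k. \<Sum>i<n. u $ (n * j + i) * u' $ (n * j + i))"
    by (simp add: scalar_prod_def block_def lessThan_atLeast0)
  also have "\<dots> = (\<Sum>j<k. \<Sum>i\<in>{j * n..<j * n + n}. u $ i * u' $ i)"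
  proof (rule sum.cong[OF refl])
    fix j
    show "(\<Sum>i<n. u $ (n * j + i) * u' $ (n * j + i)) = (\<Sum>i\<in>{j * n..<j * n + n}. u $ i * u' $ i)"
      using sum.shift_bounds_nat_ivl[of "\<lambda>i. u $ i * u' $ i" 0 "j * n" n]
      by (simp add: lessThan_atLeast0 ac_simps)
  qed
  also have "\<dots> = (\<Sum>i<k * n. u $ i * u' $ i)"
    by (rule sum.nat_group)
  finally show ?thesis using assms by (simp add: scalar_prod_def lessThan_atLeast0 mult.commute)
qed

lemma clifford_map_act: "clifford_map (n * k) U act"
proof (rule clifford_mapI)
  have bl: "block j (u + u') = block j u + block j u'" "block j (t \<cdot>\<^sub>v u) = t \<cdot>\<^sub>v block j u"
    if "u \<in> carrier_vec (n * k)" "u' \<in> carrier_vec (n * k)" "j < k" for u u' j t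
  proof -
    have "n * j + i < n * k" if "i < n" for i
    proof -
      have "n * j + i < n * Suc j" using that by simp
      also have "\<dots> \<le> n * k" using \<open>j < k\<close> by (intro mult_le_mono2) simp
      finally show ?thesis .
    qed
    then show "block j (u + u') = block j u + block j u'" "block j (t \<cdot>\<^sub>v u) = t \<cdot>\<^sub>v block j u"
      using that by (auto simp: block_def)
  qed
  show "real_linear_on U U (act u)" for u
    by (rule real_linear_on_cong[OF real_space_U partial_act_linear act_eq])
  show "act (u + u') X = act u X \<oplus>\<^bsub>U\<^esub> act u' X"
    if u: "u \<in> carrier_vec (n * k)" "u' \<in> carrier_vec (n * k)" and X: "X \<in> carrier U" for u u' X
  proof -
    have t: "pm (term_op j (block j (u + u'))) X = pm (term_op j (block j u)) X \<oplus>\<^bsub>U\<^esub> pm (term_op j (block j u')) X"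
      if j: "j < k" for j
    proof (rule U_linear_eq[OF real_space_U _ _ _ X])
      fix \<xi> assume \<xi>: "vec_family \<xi>"
      let ?\<eta> = "\<lambda>i. term_op j (block j u) i (\<xi> i)"
      have \<eta>: "vec_family ?\<eta>" and xj: "\<xi> j \<in> carrier V"
        using term_op_vec \<xi> j by (simp_all add: vec_family_def)
      have e: "pw (\<lambda>i. term_op j v i (\<xi> i)) = pw (?\<eta>(j := c v (\<xi> j)))" for v
        by (rule pw_cong) (auto simp: term_op_def)
      show "pm (term_op j (block j (u + u'))) (pw \<xi>) = pm (term_op j (block j u)) (pw \<xi>) \<oplus>\<^bsub>U\<^esub> pm (term_op j (block j u')) (pw \<xi>)"
        using \<eta> xj j by (simp only: pm_pw[OF op_family_term] add_carrier_vec block_in e bl(1)[OF u j] V.c_vadd[OF block_in block_in xj])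
          (simp add: pw_add)
    qed (intro real_linear_on_add[OF real_space_U] pm_linear op_family_term block_in)+
    have "partial_act m (u + u') X = partial_act m u X \<oplus>\<^bsub>U\<^esub> partial_act m u' X" if "m \<le> k" for m
      using that by (induction m) (use X t in \<open>simp_all add: partial_act_0 partial_act_Suc U.M.a_ac\<close>)
    then show ?thesis by (simp add: act_eq X)
  qed
  show "act (s \<cdot>\<^sub>v u) X = s \<odot>\<^bsub>U\<^esub> act u X"
    if u: "u \<in> carrier_vec (n * k)" and X: "X \<in> carrier U" for u s X
  proof -
    have t: "pm (term_op j (block j (s \<cdot>\<^sub>v u))) X = s \<odot>\<^bsub>U\<^esub> pm (term_op j (block j u)) X"
      if j: "j < k" for j
    proof (rule U_linear_eq[OF real_space_U _ _ _ X])
      fix \<xi> assume \<xi>: "vec_family \<xi>"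
      let ?\<eta> = "\<lambda>i. term_op j (block j u) i (\<xi> i)"
      have \<eta>: "vec_family ?\<eta>" and xj: "\<xi> j \<in> carrier V"
        using term_op_vec \<xi> j by (simp_all add: vec_family_def)
      have e: "pw (\<lambda>i. term_op j v i (\<xi> i)) = pw (?\<eta>(j := c v (\<xi> j)))" for v
        by (rule pw_cong) (auto simp: term_op_def)
      show "pm (term_op j (block j (s \<cdot>\<^sub>v u))) (pw \<xi>) = s \<odot>\<^bsub>U\<^esub> pm (term_op j (block j u)) (pw \<xi>)"
        using \<eta> xj j by (simp only: pm_pw[OF op_family_term] smult_carrier_vec block_in e bl(2)[OF u u j] V.c_vsmult[OF block_in xj])
          (simp add: pw_smult)
    qed (use real_linear_on_smult[OF real_space_U] pm_linear op_family_term block_in in blast)+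
    have "partial_act m (s \<cdot>\<^sub>v u) X = s \<odot>\<^bsub>U\<^esub> partial_act m u X" if "m \<le> k" for m
      using that by (induction m) (use X t in \<open>simp_all add: partial_act_0 partial_act_Suc U.smult_add_right\<close>)
    then show ?thesis by (simp add: act_eq X)
  qed
  show "act u (act u' X) \<oplus>\<^bsub>U\<^esub> act u' (act u X) = (- 2 * scalar_prod u u') \<odot>\<^bsub>U\<^esub> X"
    if "u \<in> carrier_vec (n * k)" "u' \<in> carrier_vec (n * k)" "X \<in> carrier U" for u u' X
    using partial_act_clifford[of k X u u'] that by (simp add: act_eq scalar_prod_blocks[OF that(2), of u])
qed

sublocale U: clifford_space U "n * k" act
  by unfold_locales (rule clifford_map_act)

lemma op_family_par [simp]: "op_family (\<lambda>_. V.par)"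
  by (simp add: op_family_def V.par_linear)

lemma prod_psign: "(\<Prod>i<length ps. psign (ps ! i)) = psign (odd (count_list ps True))"
proof (induction ps)
  case Nil
  then show ?case by (simp add: psign_def)
next
  case (Cons p ps)
  then show ?case
    by (simp only: length_Cons prod.lessThan_Suc_shift nth_Cons_0 nth_Cons_Suc) (auto simp: psign_def)
qed

lemma graded_U:
  "graded_space U UG" "X \<in> UG d \<Longrightarrow> pm (\<lambda>_. V.par) X = psign d \<odot>\<^bsub>U\<^esub> X"
proof -
  let ?H = "\<lambda>d. {gen xs |xs ps. length xs = k \<and> list_all2 (\<lambda>x p. x \<in> G p) xs ps \<and> odd (count_list ps True) = d}"
  have tup: "xs \<in> tuples" if "length xs = k" "list_all2 (\<lambda>x p. x \<in> G p) xs ps" for xs ps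
    using that V.grading_sub by (fastforce simp: list_all2_conv_all_nth in_set_conv_nth)
  have free: "?H d \<subseteq> free_on tuples" for d
    using tup by (auto intro!: single_in_free_on)
  have hom: "pm (\<lambda>_. V.par) (coset N h) = psign d \<odot>\<^bsub>U\<^esub> coset N h" if "h \<in> ?H d" for h d
  proof -
    obtain xs ps where xs: "h = gen xs" "length xs = k" "list_all2 (\<lambda>x p. x \<in> G p) xs ps" "odd (count_list ps True) = d"
      using \<open>h \<in> ?H d\<close> by blast
    have l: "length ps = k" using xs(2,3) by (simp add: list_all2_lengthD)
    have h: "coset N h = pw (\<lambda>i. xs ! i)" using xs by (simp add: pw_def tuple_eq)
    have v: "vec_family (\<lambda>i. xs ! i)" using tup[OF xs(2,3)] tuples_map[of "\<lambda>i. xs ! i"] xs(2) by (simp add: tuple_eq)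
    have "pm (\<lambda>_. V.par) (coset N h) = pw (\<lambda>i. psign (ps ! i) \<odot>\<^bsub>V\<^esub> xs ! i)"
      unfolding h pm_pw[OF op_family_par]
      by (rule pw_cong) (use xs l in \<open>auto simp: list_all2_conv_all_nth intro: V.par_homogeneous\<close>)
    also have "\<dots> = (\<Prod>i<k. psign (ps ! i)) \<odot>\<^bsub>U\<^esub> coset N h"
      unfolding h by (rule pw_scale[OF v])
    finally show ?thesis using prod_psign[of ps] l xs(4) by simp
  qed
  have UG_pw: "pw \<xi> \<in> UG (odd (count_list ps True))" if "length ps = k" "\<And>i. i < k \<Longrightarrow> \<xi> i \<in> G (ps ! i)" for \<xi> ps
    unfolding power_grading_def pw_def
    by (intro imageI span_base CollectI exI[of _ "map \<xi> [0..<k]"] exI[of _ ps]) (use that in \<open>auto simp: list_all2_conv_all_nth\<close>)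
  have UG_add: "X \<oplus>\<^bsub>U\<^esub> Y \<in> UG d" if "X \<in> UG d" "Y \<in> UG d" for X Y d
    using that unfolding power_grading_def by (auto simp: U_sel intro: span_add)
  have UG_zero: "\<zero>\<^bsub>U\<^esub> \<in> UG d" for d
    unfolding power_grading_def U_sel by (intro imageI span_zero)
  have UG_sub: "UG d \<subseteq> carrier U" for d
    using span_minimal[OF free subspace_free_on] by (auto simp: power_grading_def U_sel)
  \<comment> \<open>The factors are decomposed one after the other; those from \<open>m\<close> on are homogeneous already.\<close>
  have dec: "\<exists>X0\<in>UG False. \<exists>X1\<in>UG True. pw \<xi> = X0 \<oplus>\<^bsub>U\<^esub> X1"
    if "m \<le> k" "vec_family \<xi>" "\<And>i. m \<le> i \<Longrightarrow> i < k \<Longrightarrow> \<exists>p. \<xi> i \<in> G p" for m \<xi>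
    using that
  proof (induction m arbitrary: \<xi>)
    case 0
    then have "\<forall>i. \<exists>p. i < k \<longrightarrow> \<xi> i \<in> G p" by blast
    then obtain p where p: "\<And>i. i < k \<Longrightarrow> \<xi> i \<in> G (p i)" by metis
    let ?d = "odd (count_list (map p [0..<k]) True)"
    have "pw \<xi> \<in> UG ?d" by (rule UG_pw) (use p in auto)
    moreover have "pw \<xi> = pw \<xi> \<oplus>\<^bsub>U\<^esub> \<zero>\<^bsub>U\<^esub>" "pw \<xi> = \<zero>\<^bsub>U\<^esub> \<oplus>\<^bsub>U\<^esub> pw \<xi>" using 0(2) by simp_all
    ultimately show ?case using UG_zero by (cases ?d) metis+
  next
    case (Suc m)
    obtain x0 x1 where x: "x0 \<in> G False" "x1 \<in> G True" "\<xi> m = x0 \<oplus>\<^bsub>V\<^esub> x1"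
      using V.grading_decomp[of "\<xi> m"] Suc(2,3) by (auto simp: vec_family_def)
    then have xc: "x0 \<in> carrier V" "x1 \<in> carrier V" using V.grading_sub by blast+
    have h: "\<exists>X0\<in>UG False. \<exists>X1\<in>UG True. pw (\<xi>(m := y)) = X0 \<oplus>\<^bsub>U\<^esub> X1" if "y \<in> G p" "y \<in> carrier V" for y p
    proof (rule Suc.IH)
      show "m \<le> k" using Suc.prems by simp
      show "vec_family (\<xi>(m := y))" by (rule vec_family_upd[OF Suc.prems(2) that(2)])
      show "\<exists>p. (\<xi>(m := y)) i \<in> G p" if "m \<le> i" "i < k" for i
        using Suc.prems(3)[of i] that \<open>y \<in> G p\<close> by (cases "i = m") auto
    qed
    obtain X0 X1 Y0 Y1 where d: "X0 \<in> UG False" "X1 \<in> UG True" "pw (\<xi>(m := x0)) = X0 \<oplus>\<^bsub>U\<^esub> X1"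
      "Y0 \<in> UG False" "Y1 \<in> UG True" "pw (\<xi>(m := x1)) = Y0 \<oplus>\<^bsub>U\<^esub> Y1"
      using h[OF x(1) xc(1)] h[OF x(2) xc(2)] by blast
    then have c: "X0 \<in> carrier U" "X1 \<in> carrier U" "Y0 \<in> carrier U" "Y1 \<in> carrier U" using UG_sub by blast+
    have "pw \<xi> = pw (\<xi>(m := x0 \<oplus>\<^bsub>V\<^esub> x1))" using x(3) by (metis fun_upd_triv)
    also have "\<dots> = (X0 \<oplus>\<^bsub>U\<^esub> Y0) \<oplus>\<^bsub>U\<^esub> (X1 \<oplus>\<^bsub>U\<^esub> Y1)"
      using Suc(2,3) xc c by (simp add: pw_add d(3,6) U.M.a_ac)
    finally show ?case using UG_add d by blast
  qed
  have dec': "\<exists>X0\<in>UG False. \<exists>X1\<in>UG True. coset N (gen xs) = X0 \<oplus>\<^bsub>U\<^esub> X1" if "xs \<in> tuples" for xs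
    using dec[of k "\<lambda>i. xs ! i"] that tuples_map[of "\<lambda>i. xs ! i"] by (simp add: pw_def tuple_eq)
  note q = graded_quotI[OF subspace_N free power_grading_def
      pm_linear[OF op_family_par, unfolded tensor_power_def] hom[unfolded tensor_power_def] dec'[unfolded tensor_power_def]]
  show "graded_space U UG" unfolding tensor_power_def by (rule q(1))
  show "X \<in> UG d \<Longrightarrow> pm (\<lambda>_. V.par) X = psign d \<odot>\<^bsub>U\<^esub> X"
    unfolding tensor_power_def by (rule q(2))
qed

sublocale U: graded_space U UG by (rule graded_U)

lemma U_parity: "X \<in> carrier U \<Longrightarrow> U.par X = pm (\<lambda>_. V.par) X"
  using pm_linear[OF op_family_par] graded_U(2) by (rule U.parity_eqI)

lemma par_term:
  assumes "v \<in> carrier_vec n" "j < k" "X \<in> carrier U"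
  shows "pm (\<lambda>_. V.par) (pm (term_op j v) X) = \<ominus>\<^bsub>U\<^esub> pm (term_op j v) (pm (\<lambda>_. V.par) X)"
proof (rule U_linear_eq[OF real_space_U _ _ _ assms(3)])
  show "real_linear_on U U (\<lambda>X. pm (\<lambda>_. V.par) (pm (term_op j v) X))"
    by (intro real_linear_on_comp[OF pm_linear pm_linear] op_family_term assms op_family_par)
  show "real_linear_on U U (\<lambda>X. \<ominus>\<^bsub>U\<^esub> pm (term_op j v) (pm (\<lambda>_. V.par) X))"
    by (intro real_linear_on_minus real_space_U real_linear_on_comp[OF pm_linear pm_linear] op_family_term assms op_family_par)
  fix \<xi> assume \<xi>: "vec_family \<xi>"
  let ?\<eta> = "\<lambda>i. term_op j v i (V.par (\<xi> i))"
  have \<eta>: "vec_family ?\<eta>" by (rule term_op_vec[OF assms(1) op_vec_family[OF op_family_par \<xi>]])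
  have "V.par (term_op j v i (\<xi> i)) = (?\<eta>(j := \<ominus>\<^bsub>V\<^esub> ?\<eta> j)) i" if "i < k" for i
    using that \<xi> assms by (auto simp: term_op_def vec_family_def V.odd)
  then have "pw (\<lambda>i. V.par (term_op j v i (\<xi> i))) = pw (?\<eta>(j := \<ominus>\<^bsub>V\<^esub> ?\<eta> j))"
    by (rule pw_cong)
  also have "\<dots> = \<ominus>\<^bsub>U\<^esub> pw ?\<eta>"
    using assms(2) by (intro pw_minus_same[OF \<eta>])
  finally show "pm (\<lambda>_. V.par) (pm (term_op j v) (pw \<xi>)) = \<ominus>\<^bsub>U\<^esub> pm (term_op j v) (pm (\<lambda>_. V.par) (pw \<xi>))"
    using assms by (simp add: op_family_term)
qed

sublocale U: graded_clifford U UG "n * k" act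
proof
  fix u :: "real vec" and X assume X: "X \<in> carrier U"
  have P: "pm (\<lambda>_. V.par) X \<in> carrier U" using X by (rule pm_closed[OF op_family_par])
  have "pm (\<lambda>_. V.par) (partial_act m u X) = \<ominus>\<^bsub>U\<^esub> partial_act m u (pm (\<lambda>_. V.par) X)" if "m \<le> k" for m
    using that
  proof (induction m)
    case 0
    then show ?case using real_linear_on_zero[OF real_space_U real_space_U pm_linear[OF op_family_par]]
      by (simp add: partial_act_0)
  next
    case (Suc m)
    then show ?case using X P
      by (simp add: partial_act_Suc real_linear_onD(2)[OF pm_linear[OF op_family_par]] par_term U.M.minus_add)
  qed
  then show "U.par (act u X) = \<ominus>\<^bsub>U\<^esub> act u (U.par X)"
    using X by (simp add: act_eq U_parity P)
qed

section \<open>Generation of all operators on a tensor power\<close>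

abbreviation "AV \<equiv> opalg V (c ` carrier_vec n)"
abbreviation "AU \<equiv> opalg U (act ` carrier_vec (n * k))"

lemma term_in_AU:
  assumes j: "j < k" and v: "v \<in> carrier_vec n" shows "pm (term_op j v) \<in> AU"
proof (rule opalg.cong[OF opalg.gen])
  let ?u = "vec (n * k) (\<lambda>i. if i div n = j then v $ (i mod n) else 0)"
  show "act ?u \<in> act ` carrier_vec (n * k)" by (intro imageI) simp
  have bl: "block l ?u = (if l = j then v else 0\<^sub>v n)" if l: "l < k" for l
  proof -
    have "n * l + i < n * k" if "i < n" for i
    proof -
      have "n * l + i < n * Suc l" using that by simp
      also have "\<dots> \<le> n * k" using l by (intro mult_le_mono2) simp
      finally show ?thesis .
    qed
    then show ?thesis using v by (auto simp: block_def)
  qed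
  fix X assume X: "X \<in> carrier U"
  have z: "pm (term_op l (0\<^sub>v n)) X = \<zero>\<^bsub>U\<^esub>" if "l < k" for l
  proof (rule U_linear_eq[OF real_space_U _ _ _ X])
    fix \<xi> assume \<xi>: "vec_family \<xi>"
    let ?\<eta> = "\<lambda>i. term_op l (0\<^sub>v n) i (\<xi> i)"
    have \<eta>: "vec_family ?\<eta>" using \<xi> by (intro term_op_vec) simp
    have "pw ?\<eta> = pw (?\<eta>(l := 0 \<odot>\<^bsub>V\<^esub> \<zero>\<^bsub>V\<^esub>))"
      by (rule pw_cong) (use \<xi> in \<open>auto simp: term_op_def vec_family_def V.c_zero\<close>)
    also have "\<dots> = 0 \<odot>\<^bsub>U\<^esub> pw (?\<eta>(l := \<zero>\<^bsub>V\<^esub>))"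
      using \<eta> that by (intro pw_smult) auto
    also have "\<dots> = \<zero>\<^bsub>U\<^esub>" using \<eta> by simp
    finally show "pm (term_op l (0\<^sub>v n)) (pw \<xi>) = \<zero>\<^bsub>U\<^esub>" by (simp add: op_family_term)
  next
    show "real_linear_on U U (\<lambda>X. \<zero>\<^bsub>U\<^esub>)" by (simp add: real_linear_on_def)
  qed (intro pm_linear op_family_term zero_carrier_vec)
  have "partial_act m ?u X = (if j < m then pm (term_op j v) X else \<zero>\<^bsub>U\<^esub>)" if "m \<le> k" for m
    using that by (induction m) (use X v in \<open>auto simp: partial_act_0 partial_act_Suc bl z less_Suc_eq\<close>)
  from this[of k] show "pm (term_op j v) X = act ?u X" using j X by (simp add: act_eq)
qed

lemma prefix_in_AU:
  assumes "m \<le> k" "\<And>j. j < m \<Longrightarrow> slot j T \<in> AU" "real_linear_on V V T"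
  shows "pm (\<lambda>i x. if i < m then T x else x) \<in> AU"
  using assms(1,2)
proof (induction m)
  case 0
  then show ?case by (intro opalg.cong[OF opalg.one]) simp
next
  case (Suc m)
  show ?case
  proof (rule opalg.cong[OF opalg.comp[OF Suc.prems(2)[of m] Suc.IH]])
    fix X assume X: "X \<in> carrier U"
    show "pm (\<lambda>i x. if i < Suc m then T x else x) X = slot m T (pm (\<lambda>i x. if i < m then T x else x) X)"
      unfolding slot_def
      by (rule pm_comp_eq[symmetric]) (use X assms(3) in \<open>simp_all add: op_family_if less_Suc_eq\<close>)
  qed (use Suc in auto)
qed

lemma opalg_lin: "f \<in> AV \<Longrightarrow> real_linear_on V V f"
  by (rule opalg_linear[OF V.real_space_axioms]) (auto intro: V.c_linear)

lemma slot_rep: "j < k \<Longrightarrow> operator_rep V (c ` carrier_vec n) U (slot j)"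
proof unfold_locales
  show "slot j (\<lambda>x. x) X = X" if "X \<in> carrier U" for X using that by (simp add: slot_def)
  show "slot j (\<lambda>x. f (g x)) X = slot j f (slot j g X)" if "f \<in> AV" "g \<in> AV" "X \<in> carrier U" for f g X
    unfolding slot_def
    by (rule pm_comp_eq[symmetric])
      (use opalg_lin[OF that(1)] opalg_lin[OF that(2)] that(3)
         real_linear_on_comp[OF opalg_lin[OF that(1)] opalg_lin[OF that(2)]] in \<open>simp_all add: op_family_if\<close>)
  show "slot j g X = slot j f X" if "f \<in> AV" "g \<in> AV" "\<And>x. x \<in> carrier V \<Longrightarrow> g x = f x" "X \<in> carrier U" for f g X
    unfolding slot_def
    by (rule pm_cong) (use opalg_lin[OF that(1)] opalg_lin[OF that(2)] that(3,4) in \<open>simp_all add: op_family_if\<close>)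
qed (simp_all add: slot_linear slot_add slot_smult opalg_lin)

text \<open>Induction on the position: the parity maps in front of the \<open>j\<close>-th operator act on earlier
  factors, where they are available by induction and can be cancelled.\<close>

lemma slot_in_AU:
  assumes par: "V.par \<in> AV" and "j < k" "f \<in> AV" shows "slot j f \<in> AU"
  using assms(2,3)
proof (induction j arbitrary: f rule: less_induct)
  case (less j)
  have "slot j (c v) \<in> AU" if v: "v \<in> carrier_vec n" for v
  proof (rule opalg.cong[OF opalg.comp[OF _ term_in_AU[OF less.prems(1) v]]])
    show "pm (\<lambda>i x. if i < j then V.par x else x) \<in> AU"
      using less V.par_linear par by (intro prefix_in_AU) auto
    show "slot j (c v) X = pm (\<lambda>i x. if i < j then V.par x else x) (pm (term_op j v) X)" if "X \<in> carrier U" for X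
      unfolding slot_def
    proof (rule pm_comp_eq[symmetric])
      show "(if i < j then V.par (term_op j v i x) else term_op j v i x) = (if i = j then c v x else x)"
        if "x \<in> carrier V" for i x using that by (simp add: term_op_def)
    qed (use that v in \<open>simp_all add: op_family_if op_family_term V.par_linear V.c_linear\<close>)
  qed
  then have "slot j f \<in> AU" if "f \<in> c ` carrier_vec n" for f using that by blast
  then show ?case by (rule operator_rep.rep_in_opalg[OF slot_rep[OF less.prems(1)] _ less.prems(2)])
qed

lemma power_par: "V.par \<in> AV \<Longrightarrow> U.par \<in> AU"
proof (rule opalg.cong)
  assume "V.par \<in> AV"
  then show "pm (\<lambda>i x. if i < k then V.par x else x) \<in> AU"
    using slot_in_AU V.par_linear by (intro prefix_in_AU) auto
  show "U.par X = pm (\<lambda>i x. if i < k then V.par x else x) X" if "X \<in> carrier U" for X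
    unfolding U_parity[OF that] by (rule pm_cong) (use that in \<open>simp_all add: op_family_if V.par_linear\<close>)
qed

text \<open>The rank one operator of the power is \<open>p \<otimes> \<dots> \<otimes> p\<close>. The ideals generated by
  \<open>p \<otimes> \<dots> \<otimes> p \<otimes> 1 \<otimes> \<dots> \<otimes> 1\<close> all contain the identity, since \<open>1\<close> in the next factor may be
  expanded in the ideal of \<open>p\<close>.\<close>

lemma power_full:
  assumes par: "V.par \<in> AV" and full: "full_real V (c ` carrier_vec n)"
  shows "full_real U (act ` carrier_vec (n * k))"
proof -
  obtain b \<beta> p where b: "b \<in> carrier V" and \<beta>: "real_linear_on V type_space \<beta>" "\<beta> b = 1" and p: "p \<in> AV"
    and p_eq: "\<And>x. x \<in> carrier V \<Longrightarrow> p x = \<beta> x \<odot>\<^bsub>V\<^esub> b" and id: "(\<lambda>x. x) \<in> opideal V AV p"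
    using full unfolding full_real_def by blast
  obtain \<gamma> where \<gamma>: "real_linear_on U type_space \<gamma>" "\<And>\<xi>. vec_family \<xi> \<Longrightarrow> \<gamma> (pw \<xi>) = (\<Prod>i<k. \<beta> (\<xi> i))"
    using power_functional[OF \<beta>(1)] by blast
  let ?P = "\<lambda>m. pm (\<lambda>i x. if i < m then p x else x)"
  note f = op_family_if[OF opalg_lin[OF p]]
  have P: "?P m \<in> AU" if "m \<le> k" for m
    using that slot_in_AU[OF par _ p] opalg_lin[OF p] by (intro prefix_in_AU) auto
  have bv: "vec_family (\<lambda>_. b)" using b by (simp add: vec_family_def)
  have step: "?P m \<in> opideal U AU (?P (Suc m))" if m: "m < k" for m
  proof -
    interpret R: operator_rep V "c ` carrier_vec n" U "slot m" by (rule slot_rep[OF m])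
    have commute: "?P m (slot m a X) = slot m a (?P m X)" if a: "a \<in> AV" and X: "X \<in> carrier U" for a X
    proof -
      let ?Q = "\<lambda>i x. if i = m then a x else if i < m then p x else x"
      have Q: "op_family ?Q"
        using opalg_lin[OF a] opalg_lin[OF p] by (auto simp: op_family_def real_linear_on_def)
      have "?P m (slot m a X) = pm ?Q X" "slot m a (?P m X) = pm ?Q X"
        unfolding slot_def by (rule pm_comp_eq; use X opalg_lin[OF a] f Q in \<open>simp add: op_family_if\<close>)+
      then show ?thesis by simp
    qed
    have "(\<lambda>X. ?P m (slot m (\<lambda>x. x) X)) \<in> opideal U AU (\<lambda>X. ?P m (slot m p X))"
      by (rule R.ideal_transport[OF p id slot_in_AU[OF par m] pm_linear[OF f] commute])
    then have "?P m \<in> opideal U AU (\<lambda>X. ?P m (slot m p X))"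
      by (rule opideal.cong) (simp add: R.rep_one)
    moreover have "(\<lambda>X. ?P m (slot m p X)) \<in> opideal U AU (?P (Suc m))"
    proof (rule opideal.cong[OF opideal.base])
      fix X assume "X \<in> carrier U"
      then show "?P m (slot m p X) = ?P (Suc m) X"
        unfolding slot_def by (intro pm_comp_eq f) (simp_all add: less_Suc_eq)
    qed
    ultimately show ?thesis by (rule opideal_trans)
  qed
  have ideal: "(\<lambda>X. X) \<in> opideal U AU (?P m)" if "m \<le> k" for m
    using that
  proof (induction m)
    case 0
    show ?case by (rule opideal.cong[OF opideal.base]) simp
  next
    case (Suc m)
    show ?case by (rule opideal_trans[OF Suc.IH step]) (use Suc.prems in simp_all)
  qed
  have "?P k X = \<gamma> X \<odot>\<^bsub>U\<^esub> pw (\<lambda>_. b)" if "X \<in> carrier U" for X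
  proof (rule U_linear_eq[OF real_space_U pm_linear[OF f] _ _ that])
    show "real_linear_on U U (\<lambda>X. \<gamma> X \<odot>\<^bsub>U\<^esub> pw (\<lambda>_. b))"
      by (rule real_linear_onI) (use bv real_linear_onD[OF \<gamma>(1)] in \<open>auto simp: U.smult_add_left U.smult_smult\<close>)
    fix \<xi> assume \<xi>: "vec_family \<xi>"
    have "?P k (pw \<xi>) = pw (\<lambda>i. \<beta> (\<xi> i) \<odot>\<^bsub>V\<^esub> b)"
      unfolding pm_pw[OF f] by (rule pw_cong) (use \<xi> in \<open>simp add: p_eq vec_family_def\<close>)
    also have "\<dots> = \<gamma> (pw \<xi>) \<odot>\<^bsub>U\<^esub> pw (\<lambda>_. b)" using pw_scale[OF bv] \<gamma>(2)[OF \<xi>] by simp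
    finally show "?P k (pw \<xi>) = \<gamma> (pw \<xi>) \<odot>\<^bsub>U\<^esub> pw (\<lambda>_. b)" .
  qed
  moreover have "\<gamma> (pw (\<lambda>_. b)) = 1" using \<gamma>(2)[OF bv] \<beta>(2) by simp
  ultimately show ?thesis
    unfolding full_real_def using bv \<gamma>(1) P[of k] ideal[of k]
    by (intro bexI[of _ "pw (\<lambda>_. b)"] exI[of _ \<gamma>] bexI[of _ "?P k"]) auto
qed

end

section \<open>Quaternions and the basic modules\<close>

lemma quat_eq_iff: "x = y \<longleftrightarrow> qRe x = qRe y \<and> qI x = qI y \<and> qJ x = qJ y \<and> qK x = qK y"
  by (cases x; cases y) simp

lemma quat_sel [simp]:
  "qRe 0 = 0" "qI 0 = 0" "qJ 0 = 0" "qK 0 = 0"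
  "qRe 1 = 1" "qI 1 = 0" "qJ 1 = 0" "qK 1 = 0"
  "qRe (x + y) = qRe x + qRe y" "qI (x + y) = qI x + qI y" "qJ (x + y) = qJ x + qJ y" "qK (x + y) = qK x + qK y"
  "qRe (x - y) = qRe x - qRe y" "qI (x - y) = qI x - qI y" "qJ (x - y) = qJ x - qJ y" "qK (x - y) = qK x - qK y"
  "qRe (- x) = - qRe x" "qI (- x) = - qI x" "qJ (- x) = - qJ x" "qK (- x) = - qK x"
  "qRe (r *\<^sub>R x) = r * qRe x" "qI (r *\<^sub>R x) = r * qI x" "qJ (r *\<^sub>R x) = r * qJ x" "qK (r *\<^sub>R x) = r * qK x"
  "qRe (qcnj x) = qRe x" "qI (qcnj x) = - qI x" "qJ (qcnj x) = - qJ x" "qK (qcnj x) = - qK x"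
  by (simp_all add: zero_quat_def one_quat_def plus_quat_def minus_quat_def uminus_quat_def scaleR_quat_def qcnj_def)

lemma quat_mult_sel:
  "qRe (x * y) = qRe x * qRe y - qI x * qI y - qJ x * qJ y - qK x * qK y"
  "qI (x * y) = qRe x * qI y + qI x * qRe y + qJ x * qK y - qK x * qJ y"
  "qJ (x * y) = qRe x * qJ y - qI x * qK y + qJ x * qRe y + qK x * qI y"
  "qK (x * y) = qRe x * qK y + qI x * qJ y - qJ x * qI y + qK x * qRe y"
  by (simp_all add: times_quat_def)

abbreviation "qi \<equiv> Quat 0 1 0 0"
abbreviation "qj \<equiv> Quat 0 0 1 0"
abbreviation "qk \<equiv> Quat 0 0 0 1"

lemma quat_left_inverse:
  assumes "x \<noteq> (0 :: quat)" obtains y where "y * x = 1"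
proof -
  let ?n = "(qRe x)\<^sup>2 + (qI x)\<^sup>2 + (qJ x)\<^sup>2 + (qK x)\<^sup>2"
  have n: "?n \<noteq> 0"
    using assms unfolding quat_eq_iff[of x 0] by (auto simp: add_nonneg_eq_0_iff)
  have "qcnj x * x = ?n *\<^sub>R 1"
    by (simp add: quat_eq_iff quat_mult_sel power2_eq_square algebra_simps)
  then have "((1 / ?n) *\<^sub>R qcnj x) * x = 1" using n by simp
  then show ?thesis by (rule that)
qed

lemma quat_expand: "x = qRe x *\<^sub>R 1 + (qI x *\<^sub>R qi + (qJ x *\<^sub>R qj + qK x *\<^sub>R qk))"
  by (simp add: quat_eq_iff)

text \<open>A left ideal, since \<open>k = ij\<close>; and \<open>\<bbbH>\<close> is a division algebra.\<close>

lemma quat_left_ideal: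
  assumes W: "submodule W real_ring type_space" "W \<noteq> {0}"
    and ij: "\<And>s. s \<in> W \<Longrightarrow> qi * s \<in> W" "\<And>s. s \<in> W \<Longrightarrow> qj * s \<in> W"
  shows "W = UNIV"
proof -
  interpret real_space "type_space :: (real, quat) module" by (rule real_space_type_space)
  note D = subspaceD(2-4)[OF W(1), simplified]
  obtain x where x: "x \<in> W" "x \<noteq> 0" using W(2) D(1) by blast
  obtain y where y: "y * x = 1" using x(2) by (rule quat_left_inverse)
  have qk: "qk * s \<in> W" if "s \<in> W" for s
  proof -
    have "qk = qi * qj" by (simp add: quat_eq_iff quat_mult_sel)
    then show ?thesis using ij that by (simp add: mult.assoc)
  qed
  have "z \<in> W" for z
  proof -
    have "(z * y) * x = qRe (z * y) *\<^sub>R x + (qI (z * y) *\<^sub>R (qi * x) + (qJ (z * y) *\<^sub>R (qj * x) + qK (z * y) *\<^sub>R (qk * x)))"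
      by (subst quat_expand[of "z * y"]) (simp only: distrib_right mult_scaleR_left mult_1_left)
    also have "\<dots> \<in> W" by (intro D ij qk x)
    finally show ?thesis using y by (simp add: mult.assoc)
  qed
  then show ?thesis by auto
qed

definition mat2 :: "quat \<Rightarrow> quat \<Rightarrow> quat \<Rightarrow> quat \<Rightarrow> ext \<Rightarrow> ext" where
  "mat2 a b c d s = (a * fst s + b * snd s, c * fst s + d * snd s)"

lemma linear_mat2: "linear (mat2 a b c d)"
  by (auto intro!: linearI simp: mat2_def algebra_simps)

lemma c4_mat2: "c4 v = mat2 0 (- qcnj (quat_of_vec v)) (quat_of_vec v) 0"
  by (rule ext) (simp add: c4_def mat2_def eps_L_def iota_L_def)

lemma mat2_mat2: "mat2 a b c d (mat2 a' b' c' d' s) = mat2 (a * a' + b * c') (a * b' + b * d') (c * a' + d * c') (c * b' + d * d') s"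
  by (simp add: mat2_def algebra_simps)

lemma sum_less_4: "(\<Sum>i = 0..<4. f i) = f 0 + f 1 + f 2 + f (3 :: nat)" for f :: "nat \<Rightarrow> real"
  by (simp add: eval_nat_numeral)

lemma clifford_c1: "clifford_map 1 type_space c1"
proof (rule clifford_mapI)
  fix v w :: "real vec" and s :: complex assume "v \<in> carrier_vec 1" "w \<in> carrier_vec 1"
  then show "c1 v (c1 w s) \<oplus>\<^bsub>type_space\<^esub> c1 w (c1 v s) = (- 2 * scalar_prod v w) \<odot>\<^bsub>type_space\<^esub> s"
    by (simp add: c1_def scalar_prod_def complex_eq_iff)
qed (auto intro!: linearI simp: c1_def algebra_simps scaleR_conv_of_real)

lemma clifford_c2: "clifford_map 2 type_space c2"
proof (rule clifford_mapI)
  fix v w :: "real vec" and s :: quat assume "v \<in> carrier_vec 2" "w \<in> carrier_vec 2"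
  then show "c2 v (c2 w s) \<oplus>\<^bsub>type_space\<^esub> c2 w (c2 v s) = (- 2 * scalar_prod v w) \<odot>\<^bsub>type_space\<^esub> s"
    by (simp add: c2_def scalar_prod_def quat_eq_iff quat_mult_sel eval_nat_numeral algebra_simps)
qed (auto intro!: linearI simp: c2_def quat_eq_iff quat_mult_sel algebra_simps)

lemma clifford_c3: "clifford_map 3 type_space c3"
proof (rule clifford_mapI)
  fix v w :: "real vec" and s :: quat assume "v \<in> carrier_vec 3" "w \<in> carrier_vec 3"
  then show "c3 v (c3 w s) \<oplus>\<^bsub>type_space\<^esub> c3 w (c3 v s) = (- 2 * scalar_prod v w) \<odot>\<^bsub>type_space\<^esub> s"
    by (simp add: c3_def scalar_prod_def quat_eq_iff quat_mult_sel eval_nat_numeral algebra_simps)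
qed (auto intro!: linearI simp: c3_def quat_eq_iff quat_mult_sel algebra_simps)

lemma clifford_minus_c3: "clifford_map 3 type_space (\<lambda>v s. - c3 v s)"
proof (rule clifford_mapI)
  fix v w :: "real vec" and s :: quat assume "v \<in> carrier_vec 3" "w \<in> carrier_vec 3"
  then show "- c3 v (- c3 w s) \<oplus>\<^bsub>type_space\<^esub> - c3 w (- c3 v s) = (- 2 * scalar_prod v w) \<odot>\<^bsub>type_space\<^esub> s"
    by (simp add: c3_def scalar_prod_def quat_eq_iff quat_mult_sel eval_nat_numeral algebra_simps)
qed (auto intro!: linearI simp: c3_def quat_eq_iff quat_mult_sel algebra_simps)

lemma clifford_c4: "clifford_map 4 type_space c4"
proof (rule clifford_mapI)
  fix v w :: "real vec" and s :: ext assume vw: "v \<in> carrier_vec 4" "w \<in> carrier_vec 4"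
  have sp: "scalar_prod v w = v $ 0 * w $ 0 + v $ 1 * w $ 1 + v $ 2 * w $ 2 + v $ 3 * w $ 3"
    using vw by (simp add: scalar_prod_def sum_less_4)
  show "c4 v (c4 w s) \<oplus>\<^bsub>type_space\<^esub> c4 w (c4 v s) = (- 2 * scalar_prod v w) \<odot>\<^bsub>type_space\<^esub> s"
    unfolding sp by (simp add: c4_mat2 mat2_def quat_of_vec_def prod_eq_iff quat_eq_iff quat_mult_sel algebra_simps)
next
  fix v :: "real vec"
  show "real_linear_on type_space type_space (c4 v)" by (simp add: c4_mat2 linear_mat2)
qed (auto simp: c4_mat2 mat2_def quat_of_vec_def prod_eq_iff quat_eq_iff quat_mult_sel algebra_simps)

lemma irreducible_c1: "irreducible_under type_space 1 c1"
  unfolding irreducible_under_def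
proof (intro allI impI)
  fix W :: "complex set"
  assume W: "submodule W real_ring type_space" "stable (carrier_vec 1) c1 W" "W \<noteq> {\<zero>\<^bsub>type_space\<^esub>}"
  interpret real_space "type_space :: (real, complex) module" by (rule real_space_type_space)
  note D = subspaceD(2-4)[OF W(1), simplified]
  obtain x where x: "x \<in> W" "x \<noteq> 0" using W(3) D(1) by auto
  have "c1 (vec 1 (\<lambda>_. 1)) x \<in> W" using W(2) x(1) unfolding stable_def by auto
  then have i: "\<i> * x \<in> W" by (simp add: c1_def)
  have "z \<in> W" for z
  proof -
    have "z = Re (z / x) *\<^sub>R x + Im (z / x) *\<^sub>R (\<i> * x)"
      using x(2) by (metis complex_eq distrib_right mult.commute nonzero_eq_divide_eq scaleR_conv_of_real mult.assoc)
    then show ?thesis using D(2,3) i x(1) by metis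
  qed
  then show "W = carrier type_space" by auto
qed

lemma irreducible_c2: "irreducible_under type_space 2 c2"
  unfolding irreducible_under_def
proof (intro allI impI)
  fix W :: "quat set"
  assume W: "submodule W real_ring type_space" "stable (carrier_vec 2) c2 W" "W \<noteq> {\<zero>\<^bsub>type_space\<^esub>}"
  have st: "c2 v s \<in> W" if "v \<in> carrier_vec 2" "s \<in> W" for v s using W(2) that unfolding stable_def by blast
  have "W = UNIV"
  proof (rule quat_left_ideal[OF W(1)])
    fix s assume "s \<in> W"
    then show "qi * s \<in> W" "qj * s \<in> W"
      using st[of "vec 2 (\<lambda>i. if i = 0 then 1 else 0)" s] st[of "vec 2 (\<lambda>i. if i = 1 then 1 else 0)" s]
      by (simp_all add: c2_def)
  qed (use W(3) in simp)
  then show "W = carrier type_space" by simp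
qed

lemma irreducible_sign_c3:
  assumes "\<sigma> = 1 \<or> \<sigma> = - 1" shows "irreducible_under type_space 3 (\<lambda>v s. \<sigma> *\<^sub>R c3 v s)"
  unfolding irreducible_under_def
proof (intro allI impI)
  fix W :: "quat set"
  assume W: "submodule W real_ring type_space" "stable (carrier_vec 3) (\<lambda>v s. \<sigma> *\<^sub>R c3 v s) W" "W \<noteq> {\<zero>\<^bsub>type_space\<^esub>}"
  interpret real_space "type_space :: (real, quat) module" by (rule real_space_type_space)
  have st: "c3 v s \<in> W" if "v \<in> carrier_vec 3" "s \<in> W" for v s
  proof -
    have "\<sigma> *\<^sub>R c3 v s \<in> W" using W(2) that unfolding stable_def by blast
    then have "\<sigma> \<odot>\<^bsub>type_space\<^esub> (\<sigma> *\<^sub>R c3 v s) \<in> W" by (rule subspaceD(4)[OF W(1)])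
    moreover have "\<sigma> \<odot>\<^bsub>type_space\<^esub> (\<sigma> *\<^sub>R c3 v s) = c3 v s" using assms by auto
    ultimately show ?thesis by simp
  qed
  have "W = UNIV"
  proof (rule quat_left_ideal[OF W(1)])
    fix s assume "s \<in> W"
    then show "qi * s \<in> W" "qj * s \<in> W"
      using st[of "vec 3 (\<lambda>i. if i = 0 then 1 else 0)" s] st[of "vec 3 (\<lambda>i. if i = 1 then 1 else 0)" s]
      by (simp_all add: c3_def)
  qed (use W(3) in simp)
  then show "W = carrier type_space" by simp
qed

lemma irreducible_c3: "irreducible_under type_space 3 c3"
  and irreducible_minus_c3: "irreducible_under type_space 3 (\<lambda>v s. - c3 v s)"
  using irreducible_sign_c3[of 1] irreducible_sign_c3[of "- 1"] by simp_all

text \<open>The volume element \<open>e\<^sub>1 e\<^sub>2 e\<^sub>3\<close> acts as \<open>ijk = - 1\<close> in one module and as \<open>1\<close> in the other.\<close>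

lemma c3_not_isomorphic: "\<not> isomorphic_via 3 type_space (\<lambda>v s. - c3 v s) type_space c3"
proof
  assume "isomorphic_via 3 type_space (\<lambda>v s. - c3 v s) type_space c3"
  then obtain \<rho> \<sigma> f where ext: "extends_to_Cl 3 type_space (\<lambda>v s. - c3 v s) \<rho>" "extends_to_Cl 3 type_space c3 \<sigma>"
    and iso: "left_module_iso (Cl 3) type_space \<rho> type_space \<sigma> f"
    unfolding isomorphic_via_def by blast
  have lin: "linear f" and bij: "bij f" using iso by (auto simp: left_module_iso_def)
  have f: "f (- c3 v s) = c3 v (f s)" if "v \<in> carrier_vec 3" for v s
  proof -
    have "f (\<rho> (Cl_vec 3 v) s) = \<sigma> (Cl_vec 3 v) (f s)"
      using iso Cl_vec_in[OF that] by (simp add: left_module_iso_def)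
    then show ?thesis using ext that by (simp add: extends_to_Cl_def)
  qed
  have ijk: "f (- (Quat 0 a b c * s)) = Quat 0 a b c * f s" for a b c s
    using f[of "vec 3 (\<lambda>i. if i = 0 then a else if i = 1 then b else c)" s] by (simp add: c3_def)
  have "f 1 = f (- (qi * (- (qj * (- (qk * 1))))))"
    by (rule arg_cong[where f = f]) (simp add: quat_eq_iff quat_mult_sel)
  also have "\<dots> = qi * (qj * (qk * f 1))" by (simp only: ijk)
  also have "\<dots> = - f 1" by (simp add: quat_eq_iff quat_mult_sel)
  finally have "f 1 = 0" by (simp add: quat_eq_iff)
  then have "f 1 = f 0" using linear_0[OF lin] by simp
  then have "(1 :: quat) = 0" using bij by (metis bij_betw_def inj_eq)
  then show False by (simp add: quat_eq_iff)
qed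

subsection \<open>The operators generated by \<open>c4\<close>\<close>

abbreviation "A4 \<equiv> opalg type_space (c4 ` carrier_vec 4)"

interpretation ext: clifford_space type_space 4 c4
  by (simp add: clifford_space_def clifford_space_axioms_def real_space_type_space clifford_c4)

lemma A4_comp:
  assumes "mat2 a b c d \<in> A4" "mat2 a' b' c' d' \<in> A4"
  shows "mat2 (a * a' + b * c') (a * b' + b * d') (c * a' + d * c') (c * b' + d * d') \<in> A4"
  by (rule opalg.cong[OF opalg.comp[OF assms]]) (simp add: mat2_mat2)

lemma A4_add:
  assumes "mat2 a b c d \<in> A4" "mat2 a' b' c' d' \<in> A4"
  shows "mat2 (a + a') (b + b') (c + c') (d + d') \<in> A4"
  by (rule opalg.cong[OF opalg.add[OF assms]]) (simp add: mat2_def algebra_simps)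

lemma A4_scale:
  assumes "mat2 a b c d \<in> A4" shows "mat2 (r *\<^sub>R a) (r *\<^sub>R b) (r *\<^sub>R c) (r *\<^sub>R d) \<in> A4"
  by (rule opalg.cong[OF opalg.smult[OF assms, of r]]) (simp add: mat2_def algebra_simps)

text \<open>\<open>c4 1 c4 r\<close> is \<open>diag(- r, - r*)\<close>, which is \<open>diag(- r, r)\<close> for imaginary \<open>r\<close>. The product for
  \<open>i\<close> and \<open>j\<close> is \<open>diag(k, k)\<close>, and with \<open>diag(- k, k)\<close> this separates the two diagonal entries.\<close>

lemma mat2_in_A4: "mat2 a b c d \<in> A4"
proof -
  have op: "mat2 0 (- qcnj q) q 0 \<in> A4" for q
  proof -
    have "quat_of_vec (vec 4 (\<lambda>i. [qRe q, qI q, qJ q, qK q] ! i)) = q"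
      by (simp add: quat_of_vec_def quat_eq_iff eval_nat_numeral)
    then have "mat2 0 (- qcnj q) q 0 \<in> c4 ` carrier_vec 4"
      by (intro image_eqI[of _ _ "vec 4 (\<lambda>i. [qRe q, qI q, qJ q, qK q] ! i)"]) (simp_all add: c4_mat2)
    then show ?thesis by (rule opalg.gen)
  qed
  have swap: "mat2 0 (- 1) 1 0 \<in> A4" using op[of 1] by (simp add: qcnj_def one_quat_def)
  have im: "mat2 (- r) 0 0 r \<in> A4" if "qcnj r = - r" for r
    using A4_comp[OF swap op[of r]] that by simp
  have im_ijk: "qcnj qi = - qi" "qcnj qj = - qj" "qcnj qk = - qk" by (simp_all add: quat_eq_iff)
  have "qi * qj = qk" by (simp add: quat_eq_iff quat_mult_sel)
  then have "mat2 qk 0 0 qk \<in> A4" using A4_comp[OF im[OF im_ijk(1)] im[OF im_ijk(2)]] by simp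
  from A4_scale[OF A4_add[OF this A4_scale[OF im[OF im_ijk(3)], of "- 1"]], of "1 / 2"]
  have "mat2 qk 0 0 0 \<in> A4" by (simp add: scaleR_2[symmetric])
  from A4_scale[OF A4_comp[OF this this], of "- 1"] have e: "mat2 1 0 0 0 \<in> A4"
    by (simp add: times_quat_def one_quat_def uminus_quat_def scaleR_quat_def zero_quat_def)
  have one: "mat2 1 0 0 1 \<in> A4" by (rule opalg.cong[OF opalg.one]) (simp add: mat2_def)
  from A4_add[OF one A4_scale[OF e, of "- 1"]] have e': "mat2 0 0 0 1 \<in> A4" by simp
  have im1: "mat2 r 0 0 0 \<in> A4" and im2: "mat2 0 0 0 r \<in> A4" if "qcnj r = - r" for r
    using A4_scale[OF A4_comp[OF im[OF that] e], of "- 1"] A4_comp[OF im[OF that] e'] by simp_all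
  have d1: "mat2 q 0 0 0 \<in> A4" and d2: "mat2 0 0 0 q \<in> A4" for q
    using A4_add[OF A4_scale[OF e, of "qRe q"] A4_add[OF A4_scale[OF im1[OF im_ijk(1)], of "qI q"]
          A4_add[OF A4_scale[OF im1[OF im_ijk(2)], of "qJ q"] A4_scale[OF im1[OF im_ijk(3)], of "qK q"]]]]
      A4_add[OF A4_scale[OF e', of "qRe q"] A4_add[OF A4_scale[OF im2[OF im_ijk(1)], of "qI q"]
          A4_add[OF A4_scale[OF im2[OF im_ijk(2)], of "qJ q"] A4_scale[OF im2[OF im_ijk(3)], of "qK q"]]]]
    by (simp_all flip: quat_expand[of q])
  have "mat2 0 b 0 0 \<in> A4" "mat2 0 0 c 0 \<in> A4"
    using A4_comp[OF d1[of "- b"] swap] A4_comp[OF d2[of c] swap] by simp_all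
  from A4_add[OF A4_add[OF d1[of a] d2[of d]] A4_add[OF this]] show ?thesis by simp
qed

lemma irreducible_c4: "irreducible_under type_space 4 c4"
  unfolding irreducible_under_def
proof (intro allI impI)
  fix W :: "ext set"
  assume W: "submodule W real_ring type_space" "stable (carrier_vec 4) c4 W" "W \<noteq> {\<zero>\<^bsub>type_space\<^esub>}"
  have st: "mat2 a b c d s \<in> W" if "s \<in> W" for a b c d s
    by (rule ext.opalg_stable_c[OF W(1,2) mat2_in_A4 that])
  obtain x where x: "x \<in> W" "x \<noteq> 0" using W(3) ext.subspaceD(2)[OF W(1)] by auto
  have "z \<in> W" for z
  proof (cases "fst x = 0")
    case False
    then obtain y where "y * fst x = 1" by (rule quat_left_inverse)
    then have "mat2 (fst z * y) 0 (snd z * y) 0 x = z" by (simp add: mat2_def mult.assoc)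
    then show ?thesis using st[OF x(1)] by metis
  next
    case True
    then have "snd x \<noteq> 0" using x(2) by (simp add: prod_eq_iff)
    then obtain y where "y * snd x = 1" by (rule quat_left_inverse)
    then have "mat2 0 (fst z * y) 0 (snd z * y) x = z" by (simp add: mat2_def mult.assoc)
    then show ?thesis using st[OF x(1)] by metis
  qed
  then show "W = carrier type_space" by auto
qed

definition ext_par :: "ext \<Rightarrow> ext" where
  "ext_par = mat2 1 0 0 (- 1)"

lemma graded_ext: "graded_clifford type_space ext_grading 4 c4"
  and parity_ext [simp]: "parity_map type_space ext_grading = ext_par"
proof -
  have e: "real_linear_on type_space type_space ext_par" "\<And>d x. x \<in> ext_grading d \<Longrightarrow> ext_par x = psign d \<odot>\<^bsub>type_space\<^esub> x"
    by (auto simp: ext_par_def linear_mat2) (auto simp: mat2_def ext_grading_def psign_def prod_eq_iff split: if_splits)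
  interpret G: graded_space type_space ext_grading
  proof
    show "\<exists>x0\<in>ext_grading False. \<exists>x1\<in>ext_grading True. x = x0 \<oplus>\<^bsub>type_space\<^esub> x1" for x
      by (rule bexI[of _ "(fst x, 0)"], rule bexI[of _ "(0, snd x)"]) (auto simp: ext_grading_def)
  qed (use e in auto)
  show p: "parity_map type_space ext_grading = ext_par"
    using G.parity_eqI[OF e] by auto
  show "graded_clifford type_space ext_grading 4 c4"
    by unfold_locales (simp add: p ext_par_def c4_mat2 mat2_def)
qed

subsection \<open>\<open>Cl 4\<close> as an algebra of endomorphisms\<close>

context clifford_space
begin

lemma Cl_act_in_opalg:
  assumes "X \<in> carrier (Cl n)" shows "Cl_act V c X \<in> opalg V (c ` carrier_vec n)"
proof -
  obtain f where f: "f \<in> clifford_words n" "X = coset (clifford_ideal n) f" using assms by (auto simp: Cl_sel)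
  have w: "word_act c w \<in> opalg V (c ` carrier_vec n)" if "w \<in> lists (carrier_vec n)" for w
    using that
  proof (induction w)
    case Nil
    show ?case by (rule opalg.cong[OF opalg.one]) (simp add: word_act_def)
  next
    case (Cons v w)
    then show ?case
      by (intro opalg.cong[OF opalg.comp[OF opalg.gen[OF imageI[OF Cons(1)]] Cons(3)]]) (simp add: word_act_def)
  qed
  have "poly_act V c f \<in> opalg V (c ` carrier_vec n)" using f(1)
  proof (induction rule: free_on_induct)
    case zero
    show ?case by (rule opalg.cong[OF opalg.smult[OF opalg.one, where r = 0]]) (simp add: poly_act_0)
  next
    case (single w r)
    show ?case by (rule opalg.cong[OF opalg.smult[OF w[OF single], of r]]) (simp add: poly_act_single single)
  next
    case (add f g)
    show ?case by (rule opalg.cong[OF opalg.add[OF add(3,4)]]) (simp add: poly_act_add add)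
  qed
  then show ?thesis by (rule opalg.cong) (simp add: f Cl_act_coset)
qed

lemma opalg_in_Cl_act:
  assumes "F \<in> opalg V (c ` carrier_vec n)" shows "\<exists>X\<in>carrier (Cl n). \<forall>s\<in>carrier V. Cl_act V c X s = F s"
  using assms
proof (induction rule: opalg.induct)
  case (gen F)
  then obtain v where "v \<in> carrier_vec n" "F = c v" by blast
  then show ?case using extends_Cl_act by (intro bexI[of _ "Cl_vec n v"]) (auto simp: extends_to_Cl_def)
next
  case one
  then show ?case using left_module_Cl_act
    by (intro bexI[of _ "\<one>\<^bsub>Cl n\<^esub>"]) (auto simp: left_module_def Cl_sel one_in_free_on_lists)
next
  case (comp F H)
  then obtain X Y where XY: "X \<in> carrier (Cl n)" "Y \<in> carrier (Cl n)" "\<forall>s\<in>carrier V. Cl_act V c X s = F s"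
    "\<forall>s\<in>carrier V. Cl_act V c Y s = H s" by blast
  then have "X \<otimes>\<^bsub>Cl n\<^esub> Y \<in> carrier (Cl n)" using real_algebra_Cl[of n] by (simp add: real_algebra_def ring.ring_simprules)
  then show ?case using XY left_module_Cl_act opalg_closed[OF comp(2)]
    by (intro bexI[of _ "X \<otimes>\<^bsub>Cl n\<^esub> Y"]) (auto simp: left_module_def)
next
  case (add F H)
  then obtain X Y where XY: "X \<in> carrier (Cl n)" "Y \<in> carrier (Cl n)" "\<forall>s\<in>carrier V. Cl_act V c X s = F s"
    "\<forall>s\<in>carrier V. Cl_act V c Y s = H s" by blast
  interpret C: real_space "Cl n" by (rule real_space_Cl)
  show ?case using XY left_module_Cl_act
    by (intro bexI[of _ "X \<oplus>\<^bsub>Cl n\<^esub> Y"]) (auto simp: left_module_def real_linear_on_def)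
next
  case (smult F r)
  then obtain X where X: "X \<in> carrier (Cl n)" "\<forall>s\<in>carrier V. Cl_act V c X s = F s" by blast
  interpret C: real_space "Cl n" by (rule real_space_Cl)
  show ?case using X left_module_Cl_act
    by (intro bexI[of _ "r \<odot>\<^bsub>Cl n\<^esub> X"]) (auto simp: left_module_def real_linear_on_def)
next
  case (cong F H)
  then show ?case by auto
qed

end

text \<open>The span of the ordered products of the first \<open>m\<close> basis vectors; whether the last one occurs
  separates \<open>x + y e\<close> into its two parts.\<close>

primrec monomials :: "nat \<Rightarrow> nat \<Rightarrow> (real vec list \<Rightarrow>\<^sub>0 real) set set" where
  "monomials n 0 = {r \<odot>\<^bsub>Cl n\<^esub> \<one>\<^bsub>Cl n\<^esub> |r. True}"
| "monomials n (Suc m) = {x \<oplus>\<^bsub>Cl n\<^esub> y \<otimes>\<^bsub>Cl n\<^esub> Cl_vec n (unit_vec n m) |x y. x \<in> monomials n m \<and> y \<in> monomials n m}"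

lemma Cl_vec_add: "v \<in> carrier_vec n \<Longrightarrow> w \<in> carrier_vec n \<Longrightarrow> Cl_vec n (v + w) = Cl_vec n v \<oplus>\<^bsub>Cl n\<^esub> Cl_vec n w"
  unfolding Cl_vec_def Cl_sel coset_eq_iff[OF subspace_clifford_ideal]
  by (rule clifford_relator_in_ideal) (unfold clifford_relators_def diff_diff_add[symmetric], blast)

lemma Cl_vec_smult: "v \<in> carrier_vec n \<Longrightarrow> Cl_vec n (r \<cdot>\<^sub>v v) = r \<odot>\<^bsub>Cl n\<^esub> Cl_vec n v"
  unfolding Cl_vec_def Cl_sel coset_eq_iff[OF subspace_clifford_ideal]
  by (rule clifford_relator_in_ideal) (unfold clifford_relators_def, blast)

lemma Cl_vec_clifford:
  assumes "v \<in> carrier_vec n" "w \<in> carrier_vec n"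
  shows "Cl_vec n v \<otimes>\<^bsub>Cl n\<^esub> Cl_vec n w \<oplus>\<^bsub>Cl n\<^esub> Cl_vec n w \<otimes>\<^bsub>Cl n\<^esub> Cl_vec n v = (- 2 * scalar_prod v w) \<odot>\<^bsub>Cl n\<^esub> \<one>\<^bsub>Cl n\<^esub>"
proof -
  have "gen [v] * gen [w] + gen [w] * gen [v] + (2 * scalar_prod v w) *\<^sub>R 1 \<in> clifford_ideal n"
    by (rule clifford_relator_in_ideal) (use assms in \<open>unfold clifford_relators_def, blast\<close>)
  then show ?thesis using assms
    by (simp add: Cl_vec_def Cl_mult Cl_sel coset_eq_iff[OF subspace_clifford_ideal])
qed

locale Cl_locale =
  fixes n :: nat

sublocale Cl_locale \<subseteq> C: real_space "Cl n" by (rule real_space_Cl)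
sublocale Cl_locale \<subseteq> R: ring "Cl n" using real_algebra_Cl[of n] by (simp add: real_algebra_def)

context Cl_locale
begin

abbreviation "e j \<equiv> Cl_vec n (unit_vec n j)"

lemma mult_smult:
  "a \<in> carrier (Cl n) \<Longrightarrow> b \<in> carrier (Cl n) \<Longrightarrow> (r \<odot>\<^bsub>Cl n\<^esub> a) \<otimes>\<^bsub>Cl n\<^esub> b = r \<odot>\<^bsub>Cl n\<^esub> (a \<otimes>\<^bsub>Cl n\<^esub> b)"
  "a \<in> carrier (Cl n) \<Longrightarrow> b \<in> carrier (Cl n) \<Longrightarrow> a \<otimes>\<^bsub>Cl n\<^esub> (r \<odot>\<^bsub>Cl n\<^esub> b) = r \<odot>\<^bsub>Cl n\<^esub> (a \<otimes>\<^bsub>Cl n\<^esub> b)"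
  using real_algebra_Cl[of n] by (simp_all add: real_algebra_def)

lemma e_anticommute:
  assumes "i < n" "j < n" "i \<noteq> j" shows "e i \<otimes>\<^bsub>Cl n\<^esub> e j = (- 1) \<odot>\<^bsub>Cl n\<^esub> (e j \<otimes>\<^bsub>Cl n\<^esub> e i)"
proof -
  have "e i \<otimes>\<^bsub>Cl n\<^esub> e j \<oplus>\<^bsub>Cl n\<^esub> e j \<otimes>\<^bsub>Cl n\<^esub> e i = \<zero>\<^bsub>Cl n\<^esub>"
    using assms Cl_vec_clifford[of "unit_vec n i" n "unit_vec n j"] by (simp add: scalar_prod_left_unit)
  then show ?thesis by (simp add: C.minus_1_smult C.M.minus_equality)
qed

lemma e_square:
  assumes "j < n" shows "e j \<otimes>\<^bsub>Cl n\<^esub> e j = (- 1) \<odot>\<^bsub>Cl n\<^esub> \<one>\<^bsub>Cl n\<^esub>"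
proof -
  have "2 \<odot>\<^bsub>Cl n\<^esub> (e j \<otimes>\<^bsub>Cl n\<^esub> e j) = (- 2) \<odot>\<^bsub>Cl n\<^esub> \<one>\<^bsub>Cl n\<^esub>"
    using assms Cl_vec_clifford[of "unit_vec n j" n "unit_vec n j"] C.smult_add_left[of "e j \<otimes>\<^bsub>Cl n\<^esub> e j" 1 1]
    by (simp add: scalar_prod_left_unit)
  then have "(1/2) \<odot>\<^bsub>Cl n\<^esub> (2 \<odot>\<^bsub>Cl n\<^esub> (e j \<otimes>\<^bsub>Cl n\<^esub> e j)) = (1/2) \<odot>\<^bsub>Cl n\<^esub> ((- 2) \<odot>\<^bsub>Cl n\<^esub> \<one>\<^bsub>Cl n\<^esub>)" by simp
  then show ?thesis by (simp add: C.smult_smult)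
qed

text \<open>Right multiplication by an earlier vector \<open>e i\<close> passes \<open>e m\<close> at the cost of a sign, and \<open>e m\<close>
  itself exchanges the two summands up to sign.\<close>

lemma monomials_closed:
  assumes "m \<le> n"
  shows "monomials n m \<subseteq> carrier (Cl n)"
    and "x \<in> monomials n m \<Longrightarrow> y \<in> monomials n m \<Longrightarrow> x \<oplus>\<^bsub>Cl n\<^esub> y \<in> monomials n m"
    and "x \<in> monomials n m \<Longrightarrow> r \<odot>\<^bsub>Cl n\<^esub> x \<in> monomials n m"
    and "\<one>\<^bsub>Cl n\<^esub> \<in> monomials n m"
    and "x \<in> monomials n m \<Longrightarrow> i < m \<Longrightarrow> x \<otimes>\<^bsub>Cl n\<^esub> e i \<in> monomials n m"
proof -
  have "monomials n m \<subseteq> carrier (Cl n) \<and>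
    (\<forall>x\<in>monomials n m. \<forall>y\<in>monomials n m. x \<oplus>\<^bsub>Cl n\<^esub> y \<in> monomials n m) \<and>
    (\<forall>x\<in>monomials n m. \<forall>r. r \<odot>\<^bsub>Cl n\<^esub> x \<in> monomials n m) \<and> \<one>\<^bsub>Cl n\<^esub> \<in> monomials n m \<and>
    (\<forall>x\<in>monomials n m. \<forall>i<m. x \<otimes>\<^bsub>Cl n\<^esub> e i \<in> monomials n m)"
    using assms
  proof (induction m)
    case 0
    have "\<exists>r. \<one>\<^bsub>Cl n\<^esub> = r \<odot>\<^bsub>Cl n\<^esub> \<one>\<^bsub>Cl n\<^esub>" by (rule exI[of _ 1]) simp
    then show ?case by (auto simp: C.smult_smult simp flip: C.smult_add_left)
  next
    case (Suc m)
    let ?M = "monomials n m" and ?M' = "monomials n (Suc m)"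
    have sub: "?M \<subseteq> carrier (Cl n)" and add: "\<And>x y. x \<in> ?M \<Longrightarrow> y \<in> ?M \<Longrightarrow> x \<oplus>\<^bsub>Cl n\<^esub> y \<in> ?M"
      and sm: "\<And>x r. x \<in> ?M \<Longrightarrow> r \<odot>\<^bsub>Cl n\<^esub> x \<in> ?M" and one: "\<one>\<^bsub>Cl n\<^esub> \<in> ?M"
      and mult: "\<And>x i. x \<in> ?M \<Longrightarrow> i < m \<Longrightarrow> x \<otimes>\<^bsub>Cl n\<^esub> e i \<in> ?M"
      using Suc by auto
    have c [simp]: "x \<in> carrier (Cl n)" if "x \<in> ?M" for x using that sub by blast
    have I: "z \<in> ?M'" if "x \<in> ?M" "y \<in> ?M" "z = x \<oplus>\<^bsub>Cl n\<^esub> y \<otimes>\<^bsub>Cl n\<^esub> e m" for x y z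
      using that by auto
    have zero: "\<zero>\<^bsub>Cl n\<^esub> \<in> ?M" using sm[OF one, of 0] by simp
    show ?case
    proof (intro conjI ballI allI impI)
      show "?M' \<subseteq> carrier (Cl n)" by auto
      show "\<one>\<^bsub>Cl n\<^esub> \<in> ?M'" by (rule I[OF one zero]) simp
      fix z assume "z \<in> ?M'"
      then obtain x y where z: "x \<in> ?M" "y \<in> ?M" "z = x \<oplus>\<^bsub>Cl n\<^esub> y \<otimes>\<^bsub>Cl n\<^esub> e m" by auto
      show "r \<odot>\<^bsub>Cl n\<^esub> z \<in> ?M'" for r
        by (rule I[OF sm[OF z(1)] sm[OF z(2)]]) (use z in \<open>simp add: C.smult_add_right mult_smult\<close>)
      show "z \<oplus>\<^bsub>Cl n\<^esub> z' \<in> ?M'" if "z' \<in> ?M'" for z'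
      proof -
        obtain x' y' where z': "x' \<in> ?M" "y' \<in> ?M" "z' = x' \<oplus>\<^bsub>Cl n\<^esub> y' \<otimes>\<^bsub>Cl n\<^esub> e m" using \<open>z' \<in> ?M'\<close> by auto
        show ?thesis
          by (rule I[OF add[OF z(1) z'(1)] add[OF z(2) z'(2)]]) (use z z' in \<open>simp add: R.l_distr C.M.a_ac\<close>)
      qed
      show "z \<otimes>\<^bsub>Cl n\<^esub> e i \<in> ?M'" if "i < Suc m" for i
      proof (cases "i = m")
        case True
        have "y \<otimes>\<^bsub>Cl n\<^esub> e m \<otimes>\<^bsub>Cl n\<^esub> e m = (- 1) \<odot>\<^bsub>Cl n\<^esub> y"
          using z Suc(2) by (simp add: R.m_assoc e_square mult_smult)
        then show ?thesis unfolding True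
          by (intro I[OF sm[OF z(2), of "- 1"] z(1)]) (use z in \<open>simp add: R.l_distr C.M.a_ac\<close>)
      next
        case False
        then have i: "i < m" using that by simp
        have "y \<otimes>\<^bsub>Cl n\<^esub> e m \<otimes>\<^bsub>Cl n\<^esub> e i = ((- 1) \<odot>\<^bsub>Cl n\<^esub> (y \<otimes>\<^bsub>Cl n\<^esub> e i)) \<otimes>\<^bsub>Cl n\<^esub> e m"
          using z Suc(2) i by (simp add: R.m_assoc e_anticommute[of m i] mult_smult)
        then show ?thesis
          by (intro I[OF mult[OF z(1) i] sm[OF mult[OF z(2) i], of "- 1"]]) (use z in \<open>simp add: R.l_distr\<close>)
      qed
    qed
  qed
  then show "monomials n m \<subseteq> carrier (Cl n)"
    and "x \<in> monomials n m \<Longrightarrow> y \<in> monomials n m \<Longrightarrow> x \<oplus>\<^bsub>Cl n\<^esub> y \<in> monomials n m"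
    and "x \<in> monomials n m \<Longrightarrow> r \<odot>\<^bsub>Cl n\<^esub> x \<in> monomials n m"
    and "\<one>\<^bsub>Cl n\<^esub> \<in> monomials n m"
    and "x \<in> monomials n m \<Longrightarrow> i < m \<Longrightarrow> x \<otimes>\<^bsub>Cl n\<^esub> e i \<in> monomials n m" by blast+
qed

text \<open>Coefficients: the one of the product over \<open>I\<close> has index \<open>\<Sum>i\<in>I. 2 ^ i\<close>.\<close>

primrec comb :: "nat \<Rightarrow> (nat \<Rightarrow> real) \<Rightarrow> (real vec list \<Rightarrow>\<^sub>0 real) set" where
  "comb 0 a = a 0 \<odot>\<^bsub>Cl n\<^esub> \<one>\<^bsub>Cl n\<^esub>"
| "comb (Suc m) a = comb m a \<oplus>\<^bsub>Cl n\<^esub> comb m (\<lambda>i. a (i + 2 ^ m)) \<otimes>\<^bsub>Cl n\<^esub> e m"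

lemma comb_closed [simp]: "comb m a \<in> carrier (Cl n)"
  by (induction m arbitrary: a) simp_all

lemma comb_cong: "(\<And>i. i < 2 ^ m \<Longrightarrow> a i = b i) \<Longrightarrow> comb m a = comb m b"
proof (induction m arbitrary: a b)
  case (Suc m)
  have "comb m a = comb m b" "comb m (\<lambda>i. a (i + 2 ^ m)) = comb m (\<lambda>i. b (i + 2 ^ m))"
    by (rule Suc.IH, rule Suc.prems, simp)+
  then show ?case by simp
qed simp

lemma comb_0: "comb m (\<lambda>i. 0) = \<zero>\<^bsub>Cl n\<^esub>"
  by (induction m) simp_all

lemma monomials_comb: "x \<in> monomials n m \<Longrightarrow> \<exists>a. x = comb m a"
proof (induction m arbitrary: x)
  case 0
  then obtain r where "x = r \<odot>\<^bsub>Cl n\<^esub> \<one>\<^bsub>Cl n\<^esub>" by auto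
  then show ?case by (intro exI[of _ "\<lambda>_. r"]) simp
next
  case (Suc m)
  then obtain a b where x: "x = comb m a \<oplus>\<^bsub>Cl n\<^esub> comb m b \<otimes>\<^bsub>Cl n\<^esub> e m" by auto blast
  let ?c = "\<lambda>i. if i < 2 ^ m then a i else b (i - 2 ^ m)"
  have "comb m ?c = comb m a" "comb m (\<lambda>i. ?c (i + 2 ^ m)) = comb m b"
    by (rule comb_cong, simp)+
  then have "x = comb (Suc m) ?c" using x by simp
  then show ?case by blast
qed

lemma Cl_eq_monomials: "carrier (Cl n) = monomials n n"
proof (rule equalityI)
  note M = monomials_closed[of n, OF order_refl]
  show "monomials n n \<subseteq> carrier (Cl n)" by (rule M)
  have zero_in: "\<zero>\<^bsub>Cl n\<^esub> \<in> monomials n n" using M(3)[OF M(4), of 0] by simp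
  have mult: "x \<otimes>\<^bsub>Cl n\<^esub> Cl_vec n v \<in> monomials n n" if x: "x \<in> monomials n n" and v: "v \<in> carrier_vec n" for x v
  proof -
    have xc: "x \<in> carrier (Cl n)" using M(1) x by blast
    have "x \<otimes>\<^bsub>Cl n\<^esub> Cl_vec n (vec n (\<lambda>i. if i < m then v $ i else 0)) \<in> monomials n n" if "m \<le> n" for m
      using that
    proof (induction m)
      case 0
      have "vec n (\<lambda>i. 0 :: real) = 0 \<cdot>\<^sub>v 0\<^sub>v n" by auto
      then have "Cl_vec n (vec n (\<lambda>i. 0)) = \<zero>\<^bsub>Cl n\<^esub>" by (simp only: Cl_vec_smult zero_carrier_vec) simp
      then show ?case using xc zero_in by simp
    next
      case (Suc m)
      have "vec n (\<lambda>i. if i < Suc m then v $ i else 0) = vec n (\<lambda>i. if i < m then v $ i else 0) + v $ m \<cdot>\<^sub>v unit_vec n m"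
        using Suc(2) by (auto simp: less_Suc_eq)
      then have "x \<otimes>\<^bsub>Cl n\<^esub> Cl_vec n (vec n (\<lambda>i. if i < Suc m then v $ i else 0))
        = x \<otimes>\<^bsub>Cl n\<^esub> Cl_vec n (vec n (\<lambda>i. if i < m then v $ i else 0)) \<oplus>\<^bsub>Cl n\<^esub> v $ m \<odot>\<^bsub>Cl n\<^esub> (x \<otimes>\<^bsub>Cl n\<^esub> e m)"
        using xc by (simp add: Cl_vec_add Cl_vec_smult R.r_distr mult_smult)
      then show ?case using Suc M(2,3) M(5)[OF x, of m] by simp
    qed
    from this[of n] have "x \<otimes>\<^bsub>Cl n\<^esub> Cl_vec n (vec n (\<lambda>i. if i < n then v $ i else 0)) \<in> monomials n n" by simp
    also have "vec n (\<lambda>i. if i < n then v $ i else 0) = v" using v by auto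
    finally show ?thesis .
  qed
  have word: "coset (clifford_ideal n) (gen w) \<in> monomials n n" if "w \<in> lists (carrier_vec n)" for w
    using that
  proof (induction w rule: rev_induct)
    case Nil
    then show ?case using M(4) by (simp add: Cl_sel one_eq_gen_Nil)
  next
    case (snoc v w)
    have "coset (clifford_ideal n) (gen (w @ [v])) = coset (clifford_ideal n) (gen w) \<otimes>\<^bsub>Cl n\<^esub> Cl_vec n v"
      using snoc(2) by (simp add: Cl_vec_def Cl_mult mult_single plus_list_def)
    then show ?case using snoc mult by simp
  qed
  show "carrier (Cl n) \<subseteq> monomials n n"
  proof
    fix X assume "X \<in> carrier (Cl n)"
    then obtain f where f: "f \<in> clifford_words n" "X = coset (clifford_ideal n) f" by (auto simp: Cl_sel)
    from f(1) have "coset (clifford_ideal n) f \<in> monomials n n"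
    proof (induction rule: free_on_induct)
      case zero
      then show ?case using zero_in by (simp add: Cl_sel)
    next
      case (single w r)
      then show ?case using M(3)[OF word[OF single], of r] by (simp add: Cl_sel scaleR_single)
    next
      case (add f g)
      then show ?case using M(2)[OF add(3,4)] by (simp add: Cl_sel)
    qed
    then show "X \<in> monomials n n" using f by simp
  qed
qed

end

lemma opalg_ext_right: "F \<in> A4 \<Longrightarrow> F (ext_right s q) = ext_right (F s) q"
proof (induction arbitrary: s rule: opalg.induct)
  case (gen F)
  then show ?case by (auto simp: c4_mat2 mat2_def ext_right_def algebra_simps)
qed (auto simp: ext_right_def algebra_simps)

lemma End_ext_eq_mat2:
  assumes "F \<in> carrier End_ext" obtains a b c d where "F = mat2 a b c d"
proof -
  have lin: "linear F" and r: "F (ext_right s q) = ext_right (F s) q" for s q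
    using assms unfolding End_ext_def by (simp_all del: split_paired_All)
  have "F s = mat2 (fst (F (1, 0))) (fst (F (0, 1))) (snd (F (1, 0))) (snd (F (0, 1))) s" for s
  proof -
    have "s = ext_right (1, 0) (fst s) + ext_right (0, 1) (snd s)" by (simp add: ext_right_def prod_eq_iff)
    then have "F s = ext_right (F (1, 0)) (fst s) + ext_right (F (0, 1)) (snd s)"
      using linear_add[OF lin] r by metis
    then show ?thesis by (simp add: mat2_def ext_right_def)
  qed
  then show ?thesis by (intro that) (rule ext)
qed

text \<open>Surjectivity holds because a right \<open>\<bbbH>\<close>-linear map is a matrix and all matrices are generated.
  For injectivity, the action of a combination of the sixteen products on \<open>(1, 0)\<close> and \<open>(0, 1)\<close> gives
  sixteen real equations for its coefficients.\<close>

theorem Cl_4_iso_End: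
  "\<exists>h \<in> ring_iso (Cl 4) End_ext.
     (\<forall>r. \<forall>x \<in> carrier (Cl 4). h (r \<odot>\<^bsub>Cl 4\<^esub> x) = r \<odot>\<^bsub>End_ext\<^esub> h x) \<and>
     (\<forall>v \<in> carrier_vec 4. h (Cl_vec 4 v) = c4 v)"
proof -
  interpret Cl_locale 4 .
  let ?h = "Cl_act type_space c4"
  have mod: "left_module (Cl 4) type_space ?h" by (rule ext.left_module_Cl_act)
  have gen: "?h (Cl_vec 4 v) s = c4 v s" if "v \<in> carrier_vec 4" for v s
    using ext.extends_Cl_act that by (simp add: extends_to_Cl_def del: split_paired_All)
  have h_add: "?h (x \<oplus>\<^bsub>Cl 4\<^esub> y) s = ?h x s + ?h y s" if "x \<in> carrier (Cl 4)" "y \<in> carrier (Cl 4)" for x y s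
    using mod that by (simp add: left_module_def real_linear_on_def del: split_paired_All)
  have h_smult: "?h (r \<odot>\<^bsub>Cl 4\<^esub> x) s = r *\<^sub>R ?h x s" if "x \<in> carrier (Cl 4)" for x r s
    using mod that by (simp add: left_module_def real_linear_on_def del: split_paired_All)
  have h_mult: "?h (x \<otimes>\<^bsub>Cl 4\<^esub> y) s = ?h x (?h y s)" if "x \<in> carrier (Cl 4)" "y \<in> carrier (Cl 4)" for x y s
    using mod that by (simp add: left_module_def del: split_paired_All)
  have h_one: "?h \<one>\<^bsub>Cl 4\<^esub> s = s" for s
    using mod by (simp add: left_module_def del: split_paired_All)
  have into: "?h x \<in> carrier End_ext" if "x \<in> carrier (Cl 4)" for x
    using ext.Cl_act_in_opalg[OF that] ext.opalg_linear_c opalg_ext_right by (simp add: End_ext_def)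
  have onto: "F \<in> ?h ` carrier (Cl 4)" if "F \<in> carrier End_ext" for F
  proof -
    obtain a b c d where "F = mat2 a b c d" using \<open>F \<in> carrier End_ext\<close> by (rule End_ext_eq_mat2)
    then have "F \<in> A4" by (simp add: mat2_in_A4)
    then obtain X where X: "X \<in> carrier (Cl 4)" "\<forall>s\<in>carrier type_space. ?h X s = F s"
      using ext.opalg_in_Cl_act[of F] by blast
    then have "F = ?h X" by (intro ext) (simp del: split_paired_All)
    then show ?thesis using X(1) by blast
  qed
  have inj: "x = \<zero>\<^bsub>Cl 4\<^esub>" if x: "x \<in> carrier (Cl 4)" and h0: "\<And>s. ?h x s = 0" for x
  proof -
    obtain a where a: "x = comb 4 a" using x Cl_eq_monomials monomials_comb[of x 4] by auto
    have h_comb: "?h (comb 0 b) s = b 0 *\<^sub>R s"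
      "m < 4 \<Longrightarrow> ?h (comb (Suc m) b) s = ?h (comb m b) s + ?h (comb m (\<lambda>i. b (i + 2 ^ m))) (c4 (unit_vec 4 m) s)" for m b s
      by (simp_all add: h_add h_mult h_smult h_one gen)
    have "?h (comb (Suc (Suc (Suc (Suc 0)))) a) (1, 0) = 0" "?h (comb (Suc (Suc (Suc (Suc 0)))) a) (0, 1) = 0"
      using h0 a by (simp_all add: eval_nat_numeral)
    then have eqs: "a 0 = 0 \<and> a 1 = 0 \<and> a 2 = 0 \<and> a 3 = 0 \<and> a 4 = 0 \<and> a 5 = 0 \<and> a 6 = 0 \<and> a 7 = 0 \<and>
      a 8 = 0 \<and> a 9 = 0 \<and> a 10 = 0 \<and> a 11 = 0 \<and> a 12 = 0 \<and> a 13 = 0 \<and> a 14 = 0 \<and> a 15 = 0"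
      by (simp add: h_comb c4_mat2 mat2_def quat_of_vec_def prod_eq_iff quat_eq_iff quat_mult_sel del: comb.simps)
        (simp add: eval_nat_numeral)
    have "a i = 0" if "i < 2 ^ 4" for i
    proof -
      have "i \<in> {0, 1, 2, 3, 4, 5, 6, 7, 8, 9, 10, 11, 12, 13, 14, 15}" using that by (auto simp: eval_nat_numeral less_Suc_eq)
      then show ?thesis using eqs by auto
    qed
    then have "x = comb 4 (\<lambda>i. 0)" unfolding a by (intro comb_cong) simp
    then show ?thesis by (simp add: comb_0)
  qed
  have "inj_on ?h (carrier (Cl 4))"
  proof (rule inj_onI)
    fix x y assume xy: "x \<in> carrier (Cl 4)" "y \<in> carrier (Cl 4)" "?h x = ?h y"
    have "?h (x \<oplus>\<^bsub>Cl 4\<^esub> (- 1) \<odot>\<^bsub>Cl 4\<^esub> y) s = 0" for s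
      using xy by (simp add: h_add h_smult)
    then have "x \<oplus>\<^bsub>Cl 4\<^esub> (- 1) \<odot>\<^bsub>Cl 4\<^esub> y = \<zero>\<^bsub>Cl 4\<^esub>" using xy by (intro inj) auto
    then have "\<ominus>\<^bsub>Cl 4\<^esub> (\<ominus>\<^bsub>Cl 4\<^esub> y) = x"
      using xy by (intro C.M.minus_equality) (simp_all add: C.minus_1_smult)
    then show "x = y" using xy by (simp add: C.M.minus_minus)
  qed
  then have "?h \<in> ring_iso (Cl 4) End_ext"
    unfolding ring_iso_def bij_betw_def using into onto
    by (auto intro!: ring_hom_memI simp: End_ext_def h_add h_mult h_one fun_eq_iff)
  then show ?thesis
    by (intro bexI[of _ ?h]) (auto simp: h_smult gen End_ext_def fun_eq_iff)
qed

text \<open>A nonzero stable subspace contains a nonzero vector in the image of \<open>p\<close>, hence \<open>b\<close>, hence the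
  whole image of \<open>p\<close>.\<close>

lemma (in clifford_space) full_irreducible:
  assumes full: "full_real V (c ` carrier_vec n)"
  shows "irreducible_under V n c" "carrier V \<noteq> {\<zero>}"
proof -
  obtain b \<beta> p where b: "b \<in> carrier V" and \<beta>: "real_linear_on V type_space \<beta>" "\<beta> b = (1 :: real)"
    and p: "p \<in> opalg V (c ` carrier_vec n)" and p_eq: "\<And>x. x \<in> carrier V \<Longrightarrow> p x = \<beta> x \<odot> b"
    and id: "(\<lambda>x. x) \<in> opideal V (opalg V (c ` carrier_vec n)) p"
    using full unfolding full_real_def by blast
  have "\<beta> \<zero> = 0" using real_linear_on_zero[OF real_space_axioms real_space_type_space \<beta>(1)] by simp
  then show "carrier V \<noteq> {\<zero>}" using b \<beta>(2) by auto
  show "irreducible_under V n c"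
    unfolding irreducible_under_def
  proof (intro allI impI)
    fix W assume W: "submodule W real_ring V" "stable (carrier_vec n) c W" "W \<noteq> {\<zero>}"
    note D = subspaceD[OF W(1)]
    note st = opalg_stable_c[OF W(1,2)]
    interpret R: operator_rep V "c ` carrier_vec n" V "\<lambda>f. f"
      by unfold_locales (auto intro: opalg_linear_c)
    obtain w where w: "w \<in> W" "w \<noteq> \<zero>" using W(3) D(2) by blast
    then have "w \<in> carrier V" using D(1) by blast
    then obtain a where a: "a \<in> R.A" "p (a w) \<noteq> \<zero>" using R.slice_nonzero[OF p id _ w(2)] by blast
    have ac: "a w \<in> carrier V" using opalg_closed[OF a(1)] w D(1) by blast
    have "p (a w) \<in> W" by (rule st[OF p st[OF a(1) w(1)]])
    then have "(inverse (\<beta> (a w)) * \<beta> (a w)) \<odot> b \<in> W" using D(4) ac b by (simp add: p_eq flip: smult_smult)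
    moreover have "\<beta> (a w) \<noteq> 0" using a(2) ac b by (auto simp: p_eq)
    ultimately have bW: "b \<in> W" using b by simp
    show "W = carrier V"
    proof (rule R.slice_generates[OF p id W(1)])
      show "f x \<in> W" if "f \<in> R.A" "x \<in> W" for f x using that by (rule st)
      show "p x \<in> W" if "x \<in> carrier V" for x using that D(4)[OF bW] by (simp add: p_eq)
    qed
  qed
qed

lemma type_space_nonzero: "carrier (type_space :: (real, 'a :: real_algebra_1) module) \<noteq> {\<zero>\<^bsub>type_space\<^esub>}"
proof
  assume "carrier (type_space :: (real, 'a) module) = {\<zero>\<^bsub>type_space\<^esub>}"
  then have "(1 :: 'a) \<in> {0}" by (simp add: set_eq_iff)
  then show False by simp
qed

section \<open>The eight-dimensional case\<close>

lemma opp_inv: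
  assumes "real_alg_opp_iso \<psi>"
  shows "linear (inv_into UNIV \<psi>)" "inv_into UNIV \<psi> (\<psi> x) = x" "\<psi> (inv_into UNIV \<psi> x) = x" "inv_into UNIV \<psi> (x * y) = inv_into UNIV \<psi> y * inv_into UNIV \<psi> x" "inv_into UNIV \<psi> 1 = 1"
proof -
  have lin: "linear \<psi>" and bij: "bij \<psi>" and mult: "\<psi> (x * y) = \<psi> y * \<psi> x" and one: "\<psi> 1 = 1" for x y
    using assms by (auto simp: real_alg_opp_iso_def)
  show i1: "inv_into UNIV \<psi> (\<psi> x) = x" for x using bij by (simp add: bij_is_inj)
  show i2: "\<psi> (inv_into UNIV \<psi> x) = x" for x using bij by (simp add: bij_is_surj surj_f_inv_f)
  show "linear (inv_into UNIV \<psi>)"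
  proof (rule linearI)
    show "inv_into UNIV \<psi> (x + y) = inv_into UNIV \<psi> x + inv_into UNIV \<psi> y" for x y
      using i1[of "inv_into UNIV \<psi> x + inv_into UNIV \<psi> y"] by (simp add: linear_add[OF lin] i2)
    show "inv_into UNIV \<psi> (r *\<^sub>R x) = r *\<^sub>R inv_into UNIV \<psi> x" for r x
      using i1[of "r *\<^sub>R inv_into UNIV \<psi> x"] by (simp add: linear_scale[OF lin] i2)
  qed
  show "inv_into UNIV \<psi> (x * y) = inv_into UNIV \<psi> y * inv_into UNIV \<psi> x" 
    using i1[of "inv_into UNIV \<psi> y * inv_into UNIV \<psi> x"] by (simp add: mult i2)
  show "inv_into UNIV \<psi> 1 = 1" using i1[of 1] by (simp add: one)
qed

locale quat_opp =
  fixes \<phi> :: "quat \<Rightarrow> quat"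
  assumes opp: "real_alg_opp_iso \<phi>"
begin

abbreviation "\<phi>' \<equiv> inv_into UNIV \<phi>"
lemmas \<phi>'_simps = opp_inv(2-5)[OF opp]
lemmas \<phi>'_linear = opp_inv(1)[OF opp]

end

sublocale quat_opp \<subseteq> S: tensor_graded_clifford type_space ext_grading 4 c4 ext_right type_space ext_grading 4 c4 "ext_left \<phi>"
proof -
  interpret E: graded_clifford type_space ext_grading 4 c4 by (rule graded_ext)
  show "tensor_graded_clifford type_space ext_grading 4 c4 ext_right type_space ext_grading 4 c4 (ext_left \<phi>)"
    by unfold_locales
      (auto intro!: linearI simp: ext_left_def ext_right_def c4_mat2 mat2_def ext_par_def algebra_simps)
qed

context quat_opp
begin

lemma S8: "graded_clifford (S8 \<phi>) (S8_grading \<phi>) 8 (c8 \<phi>)"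
  using S.U.graded_clifford_axioms unfolding S8_def S8_grading_def c8_def by simp

lemma par_in_A4: "S.V.par \<in> A4"
  by (simp add: ext_par_def mat2_in_A4)

lemma end_mat2 [simp]: "S.end_l (mat2 a b c d)" "S.end_r (mat2 a b c d)"
  by (rule S.end_l_opalg S.end_r_opalg, rule mat2_in_A4)+

abbreviation "tm \<equiv> tensor_map S.N"

lemma tm_in: "tm (mat2 a b c d) (mat2 a' b' c' d') \<in> S.AU"
  by (rule opalg.cong[OF opalg.comp[OF S.lift_left[OF mat2_in_A4[of a b c d]] S.lift_right[OF par_in_A4 mat2_in_A4[of a' b' c' d']]]])
    (simp add: S.tensor_map_comp)

lemma par_in_AU: "S.U.par \<in> S.AU"
  by (rule opalg.cong[OF tm_in[of 1 0 0 "- 1" 1 0 0 "- 1"]]) (simp add: S.U_parity ext_par_def)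

lemma corner: "S.pt (x, 0) (y, 0) = S.pt (x * \<phi>' y, 0) (1, 0)"
  using S.pt_balanced[of "(x, 0)" "(1, 0)" "\<phi>' y"] by (simp add: ext_right_def ext_left_def \<phi>'_simps)

lemma corner_add: "S.pt (x, 0) s \<oplus>\<^bsub>S.U\<^esub> S.pt (y, 0) s = S.pt (x + y, 0) s"
  using S.pt_add_left[of "(x, 0)" "(y, 0)" s] by simp

lemma corner_smult: "r \<odot>\<^bsub>S.U\<^esub> S.pt (x, 0) s = S.pt (r *\<^sub>R x, 0) s"
  using S.pt_smult_left[of "(x, 0)" s r] by simp

text \<open>The corner \<open>\<bbbH> \<otimes>\<^sub>\<bbbH> \<bbbH>\<close> is a copy of \<open>\<bbbH>\<close> on which left and right multiplications are available;
  \<open>z - izi - jzj - kzk = 4 Re z\<close> makes the projection onto the real part one of the operators.\<close>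

definition re_proj :: "ext2 \<Rightarrow> ext2" where
  "re_proj X = (1 / 4) \<odot>\<^bsub>S.U\<^esub> (tm (mat2 1 0 0 0) (mat2 (\<phi> 1) 0 0 0) X \<oplus>\<^bsub>S.U\<^esub>
     ((- 1) \<odot>\<^bsub>S.U\<^esub> tm (mat2 qi 0 0 0) (mat2 (\<phi> qi) 0 0 0) X \<oplus>\<^bsub>S.U\<^esub>
     ((- 1) \<odot>\<^bsub>S.U\<^esub> tm (mat2 qj 0 0 0) (mat2 (\<phi> qj) 0 0 0) X \<oplus>\<^bsub>S.U\<^esub>
      (- 1) \<odot>\<^bsub>S.U\<^esub> tm (mat2 qk 0 0 0) (mat2 (\<phi> qk) 0 0 0) X)))"

lemma re_proj_in: "re_proj \<in> S.AU"
  unfolding re_proj_def[abs_def] by (rule opalg.smult opalg.add tm_in)+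

lemma re_proj_linear: "real_linear_on S.U S.U re_proj"
  by (rule S.U.opalg_linear_c[OF re_proj_in])

lemma re_proj_pt: "re_proj (S.pt s t) = qRe (fst s * \<phi>' (fst t)) \<odot>\<^bsub>S.U\<^esub> S.pt (1, 0) (1, 0)"
proof -
  let ?z = "fst s * \<phi>' (fst t)"
  have t: "tm (mat2 q 0 0 0) (mat2 (\<phi> q) 0 0 0) (S.pt s t) = S.pt (q * ?z * q, 0) (1, 0)" for q
  proof -
    have "tm (mat2 q 0 0 0) (mat2 (\<phi> q) 0 0 0) (S.pt s t) = S.pt (q * fst s, 0) (\<phi> q * fst t, 0)"
      by (simp add: mat2_def)
    then show ?thesis using corner[of "q * fst s" "\<phi> q * fst t"] by (simp add: \<phi>'_simps mult.assoc)
  qed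
  have "(1 / 4) *\<^sub>R (1 * ?z * 1 + ((- 1) *\<^sub>R (qi * ?z * qi) + ((- 1) *\<^sub>R (qj * ?z * qj) + (- 1) *\<^sub>R (qk * ?z * qk)))) = qRe ?z *\<^sub>R 1"
    by (simp add: quat_eq_iff quat_mult_sel)
  then show ?thesis unfolding re_proj_def t corner_smult corner_add by simp
qed

lemma S8_full_U: "full_real S.U (S.act ` carrier_vec (4 + 4))"
proof -
  let ?I = "opideal S.U S.AU re_proj"
  obtain \<beta> where \<beta>: "real_linear_on S.U type_space \<beta>" "\<And>s t :: ext. \<beta> (S.pt s t) = qRe (fst s * \<phi>' (fst t))"
    by (rule S.tensor_functional[of "\<lambda>s t. qRe (fst s * \<phi>' (fst t))"])
      (auto simp: linear_add[OF \<phi>'_linear] linear_scale[OF \<phi>'_linear] ext_right_def ext_left_def \<phi>'_simps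
        distrib_left distrib_right mult.assoc)
  have rank1: "re_proj X = \<beta> X \<odot>\<^bsub>S.U\<^esub> S.pt (1, 0) (1, 0)" if "X \<in> carrier S.U" for X
  proof (rule S.U_linear_eq[OF S.real_space_U re_proj_linear _ _ that])
    show "real_linear_on S.U S.U (\<lambda>X. \<beta> X \<odot>\<^bsub>S.U\<^esub> S.pt (1, 0) (1, 0))"
      by (rule real_linear_onI) (auto simp: real_linear_onD[OF \<beta>(1)] S.U.smult_add_left S.U.smult_smult)
  qed (simp add: re_proj_pt \<beta>)
  \<comment> \<open>\<open>z\<close> is the sum of \<open>q Re(q* z)\<close> over the four units \<open>q\<close>.\<close>
  have corner_in: "tm (mat2 1 0 0 0) (mat2 1 0 0 0) \<in> ?I"
  proof -
    let ?F = "\<lambda>q X. tm (mat2 q 0 0 0) (mat2 1 0 0 0) (re_proj (tm (mat2 (qcnj q) 0 0 0) (mat2 1 0 0 0) X))"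
    have F: "?F q \<in> ?I" for q
      by (rule opideal.left[OF tm_in opideal.right[OF opideal.base tm_in]])
    have F_lin: "real_linear_on S.U S.U (?F q)" for q
      by (intro real_linear_on_comp[OF S.tensor_map_linear] real_linear_on_comp[OF re_proj_linear S.tensor_map_linear] end_mat2)
    have F_pt: "?F q (S.pt s t) = S.pt (qRe (qcnj q * (fst s * \<phi>' (fst t))) *\<^sub>R q, 0) (1, 0)" for q s t
      by (simp add: mat2_def re_proj_pt mult.assoc corner_smult real_linear_onD(3)[OF S.tensor_map_linear])
    show ?thesis
    proof (rule opideal.cong[OF opideal.add[OF F[of 1] opideal.add[OF F[of qi] opideal.add[OF F[of qj] F[of qk]]]]])
      fix X assume X: "X \<in> carrier S.U"
      show "tm (mat2 1 0 0 0) (mat2 1 0 0 0) X = ?F 1 X \<oplus>\<^bsub>S.U\<^esub> (?F qi X \<oplus>\<^bsub>S.U\<^esub> (?F qj X \<oplus>\<^bsub>S.U\<^esub> ?F qk X))"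
      proof (rule S.U_linear_eq[OF S.real_space_U S.tensor_map_linear _ _ X])
        fix s t :: ext
        let ?z = "fst s * \<phi>' (fst t)"
        have "?F 1 (S.pt s t) \<oplus>\<^bsub>S.U\<^esub> (?F qi (S.pt s t) \<oplus>\<^bsub>S.U\<^esub> (?F qj (S.pt s t) \<oplus>\<^bsub>S.U\<^esub> ?F qk (S.pt s t)))
          = S.pt (qRe (qcnj 1 * ?z) *\<^sub>R 1 + (qRe (qcnj qi * ?z) *\<^sub>R qi + (qRe (qcnj qj * ?z) *\<^sub>R qj + qRe (qcnj qk * ?z) *\<^sub>R qk)), 0) (1, 0)"
          unfolding F_pt corner_add ..
        also have "qRe (qcnj 1 * ?z) *\<^sub>R 1 + (qRe (qcnj qi * ?z) *\<^sub>R qi + (qRe (qcnj qj * ?z) *\<^sub>R qj + qRe (qcnj qk * ?z) *\<^sub>R qk)) = ?z"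
          by (simp add: quat_eq_iff quat_mult_sel)
        also have "S.pt (?z, 0) (1, 0) = S.pt (fst s, 0) (fst t, 0)" by (rule corner[symmetric])
        also have "\<dots> = tm (mat2 1 0 0 0) (mat2 1 0 0 0) (S.pt s t)" by (simp add: mat2_def)
        finally show "tm (mat2 1 0 0 0) (mat2 1 0 0 0) (S.pt s t) =
            ?F 1 (S.pt s t) \<oplus>\<^bsub>S.U\<^esub> (?F qi (S.pt s t) \<oplus>\<^bsub>S.U\<^esub> (?F qj (S.pt s t) \<oplus>\<^bsub>S.U\<^esub> ?F qk (S.pt s t)))" ..
      qed (intro real_linear_on_add[OF S.real_space_U] F_lin end_mat2)+
    qed
  qed
  have "(\<lambda>X. X) \<in> ?I"
  proof -
    let ?H = "\<lambda>a b a' b' X. tm (mat2 a 0 b 0) (mat2 a' 0 b' 0) (tm (mat2 1 0 0 0) (mat2 1 0 0 0) (tm (mat2 a b 0 0) (mat2 a' b' 0 0) X))"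
    have H: "?H a b a' b' \<in> ?I" for a b a' b'
      by (rule opideal.left[OF tm_in opideal.right[OF corner_in tm_in]])
    have H_lin: "real_linear_on S.U S.U (?H a b a' b')" for a b a' b'
      by (intro real_linear_on_comp[OF S.tensor_map_linear] real_linear_on_comp[OF S.tensor_map_linear S.tensor_map_linear] end_mat2)
    show ?thesis
    proof (rule opideal.cong[OF opideal.add[OF opideal.add[OF H[of 1 0 1 0] H[of 1 0 0 1]] opideal.add[OF H[of 0 1 1 0] H[of 0 1 0 1]]]])
      fix X assume X: "X \<in> carrier S.U"
      show "X = (?H 1 0 1 0 X \<oplus>\<^bsub>S.U\<^esub> ?H 1 0 0 1 X) \<oplus>\<^bsub>S.U\<^esub> (?H 0 1 1 0 X \<oplus>\<^bsub>S.U\<^esub> ?H 0 1 0 1 X)"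
      proof (rule S.U_linear_eq[OF S.real_space_U real_linear_on_id(1) _ _ X])
        fix s t :: ext
        have H_pt: "?H 1 0 1 0 (S.pt s t) = S.pt (fst s, 0) (fst t, 0)" "?H 1 0 0 1 (S.pt s t) = S.pt (fst s, 0) (0, snd t)"
          "?H 0 1 1 0 (S.pt s t) = S.pt (0, snd s) (fst t, 0)" "?H 0 1 0 1 (S.pt s t) = S.pt (0, snd s) (0, snd t)"
          by (simp_all add: mat2_def)
        have "S.pt s t = S.pt ((fst s, 0) + (0, snd s)) ((fst t, 0) + (0, snd t))" by simp
        also have "\<dots> = (S.pt (fst s, 0) (fst t, 0) \<oplus>\<^bsub>S.U\<^esub> S.pt (fst s, 0) (0, snd t)) \<oplus>\<^bsub>S.U\<^esub>
            (S.pt (0, snd s) (fst t, 0) \<oplus>\<^bsub>S.U\<^esub> S.pt (0, snd s) (0, snd t))"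
          using S.pt_add_left[of "(fst s, 0)" "(0, snd s)"] S.pt_add_right[of _ "(fst t, 0)" "(0, snd t)"]
          by (simp add: S.U.M.a_ac del: add_Pair)
        finally show "S.pt s t = (?H 1 0 1 0 (S.pt s t) \<oplus>\<^bsub>S.U\<^esub> ?H 1 0 0 1 (S.pt s t)) \<oplus>\<^bsub>S.U\<^esub>
            (?H 0 1 1 0 (S.pt s t) \<oplus>\<^bsub>S.U\<^esub> ?H 0 1 0 1 (S.pt s t))"
          unfolding H_pt .
      qed (intro real_linear_on_add[OF S.real_space_U] H_lin)
    qed
  qed
  then show ?thesis
    unfolding full_real_def using \<beta> rank1 re_proj_in
    by (intro bexI[of _ "S.pt (1, 0) (1, 0)"] exI[of _ \<beta>] bexI[of _ re_proj]) (auto simp: \<phi>'_simps)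
qed

lemma S8_full: "full_real (S8 \<phi>) (c8 \<phi> ` carrier_vec 8)"
  using S8_full_U unfolding S8_def c8_def by simp

lemma S8_par: "parity_map (S8 \<phi>) (S8_grading \<phi>) \<in> opalg (S8 \<phi>) (c8 \<phi> ` carrier_vec 8)"
  using par_in_AU unfolding S8_def S8_grading_def c8_def by simp

section \<open>The periodic family\<close>

lemma spin_0:
  "graded_clifford (spin_0 \<phi> k) (grading_0 \<phi> k) (8 * k) (act_0 \<phi> k)"
  "full_real (spin_0 \<phi> k) (act_0 \<phi> k ` carrier_vec (8 * k))"
  "parity_map (spin_0 \<phi> k) (grading_0 \<phi> k) \<in> opalg (spin_0 \<phi> k) (act_0 \<phi> k ` carrier_vec (8 * k))"
proof -
  interpret G: graded_clifford "S8 \<phi>" "S8_grading \<phi>" 8 "c8 \<phi>" by (rule S8)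
  interpret P: power_clifford_space "S8 \<phi>" "S8_grading \<phi>" 8 "c8 \<phi>" k by unfold_locales
  show "graded_clifford (spin_0 \<phi> k) (grading_0 \<phi> k) (8 * k) (act_0 \<phi> k)"
    unfolding spin_0_def grading_0_def act_0_def by (rule P.U.graded_clifford_axioms)
  show "full_real (spin_0 \<phi> k) (act_0 \<phi> k ` carrier_vec (8 * k))"
    unfolding spin_0_def act_0_def by (rule P.power_full[OF S8_par S8_full])
  show "parity_map (spin_0 \<phi> k) (grading_0 \<phi> k) \<in> opalg (spin_0 \<phi> k) (act_0 \<phi> k ` carrier_vec (8 * k))"
    unfolding spin_0_def grading_0_def act_0_def by (rule P.power_par[OF S8_par])
qed

end

lemma real_tensor_space:
  fixes W :: "(real, 'b::real_vector) module"
  defines "W \<equiv> type_space"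
  assumes "graded_clifford V G m c" "clifford_map r W c'"
  shows "tensor_clifford_space V G m c (right_real V) W r c' (*\<^sub>R)"
proof -
  interpret V: graded_clifford V G m c by fact
  interpret W: clifford_space W r c'
    using assms(3) by (simp add: W_def clifford_space_def clifford_space_axioms_def real_space_type_space)
  show ?thesis
  proof unfold_locales
    show "real_linear_on V V (\<lambda>x. right_real V x a)" for a
      unfolding right_real_def by (intro real_linear_on_smult V.real_space_axioms real_linear_on_id)
    show "real_linear_on W W ((*\<^sub>R) a)" for a by (auto simp: W_def intro!: linearI simp: scaleR_add_right)
    show "V.par (right_real V x a) = right_real V (V.par x) a" if "x \<in> carrier V" for x a
      using that by (simp add: right_real_def real_linear_onD(3)[OF V.par_linear])
    show "c u (right_real V x a) = right_real V (c u x) a" if "u \<in> carrier_vec m" "x \<in> carrier V" for u x a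
      using that by (simp add: right_real_def V.c_smult)
    show "c' v (a *\<^sub>R y) = a *\<^sub>R c' v y" if "v \<in> carrier_vec r" "y \<in> carrier W" for v a y
      using W.c_smult[OF that, of a] by (simp add: W_def)
  qed
qed

text \<open>The map \<open>\<beta> \<otimes> 1\<close>, by which tensor products are seen to be nonzero.\<close>

lemma real_tensor_functional:
  fixes V :: "(real, 'a) module"
  defines "T \<equiv> (type_space :: (real, 'b::real_vector) module)"
  assumes "real_space V" "full_real V C"
  obtains b \<gamma> \<beta> where "b \<in> carrier V" "real_linear_on (tensor V (right_real V) T (*\<^sub>R)) type_space \<gamma>"
    "\<And>s. \<gamma> (coset (tensor_null V (right_real V) T (*\<^sub>R)) (gen (b, s))) = s"
    "\<And>x s. x \<in> carrier V \<Longrightarrow> \<gamma> (coset (tensor_null V (right_real V) T (*\<^sub>R)) (gen (x, s))) = \<beta> x *\<^sub>R (s :: 'b)"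
proof -
  interpret V: real_space V by fact
  interpret W: real_space T unfolding T_def by (rule real_space_type_space)
  interpret T: tensor_space V "right_real V" T "(*\<^sub>R)"
  proof
    show "real_linear_on V V (\<lambda>x. right_real V x a)" for a
      unfolding right_real_def by (intro real_linear_on_smult V.real_space_axioms real_linear_on_id)
    show "real_linear_on T T ((*\<^sub>R) a)" for a by (auto simp: T_def intro!: linearI simp: scaleR_add_right)
  qed
  obtain b \<beta> where b: "b \<in> carrier V" and \<beta>: "real_linear_on V type_space \<beta>" "\<beta> b = (1 :: real)"
    using assms(3) unfolding full_real_def by blast
  obtain \<gamma> where \<gamma>: "real_linear_on T.U type_space \<gamma>"
    "\<And>x s. x \<in> carrier V \<Longrightarrow> s \<in> carrier T \<Longrightarrow> \<gamma> (T.pt x s) = \<beta> x *\<^sub>R s"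
    by (rule T.tensor_functional[of "\<lambda>x s. \<beta> x *\<^sub>R s"])
      (auto simp: T_def real_linear_onD[OF \<beta>(1)] right_real_def algebra_simps)
  show ?thesis by (rule that[of b \<gamma> \<beta>]) (use b \<beta>(2) \<gamma> in \<open>simp_all add: T_def\<close>)
qed

lemma real_tensor_irreducible:
  fixes c' :: "real vec \<Rightarrow> 'b::real_vector \<Rightarrow> 'b"
  assumes V: "graded_clifford V G m c" and full: "full_real V (c ` carrier_vec m)"
    and par: "parity_map V G \<in> opalg V (c ` carrier_vec m)"
    and c': "clifford_map r type_space c'" "irreducible_under type_space r c'" and y: "(y :: 'b) \<noteq> 0"
  shows "irreducible_under (tensor V (right_real V) (type_space :: (real, 'b) module) (*\<^sub>R)) (m + r)
           (tensor_clifford V G (right_real V) type_space (*\<^sub>R) m c r c')"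
    and "irreducible_via (m + r) (tensor V (right_real V) (type_space :: (real, 'b) module) (*\<^sub>R))
           (tensor_clifford V G (right_real V) type_space (*\<^sub>R) m c r c')"
proof -
  interpret T: tensor_clifford_space V G m c "right_real V" type_space r c' "(*\<^sub>R)"
    by (rule real_tensor_space[OF V c'(1)])
  show irr: "irreducible_under T.U (m + r) T.act" by (rule T.tensor_irreducible[OF full par c'(2)])
  obtain b \<beta> \<gamma> where b: "b \<in> carrier V"
    and \<gamma>: "real_linear_on T.U type_space \<gamma>" "\<And>s. \<gamma> (T.pt b s) = s"
      "\<And>x s. x \<in> carrier V \<Longrightarrow> \<gamma> (T.pt x s) = \<beta> x *\<^sub>R (s :: 'b)"
    by (rule real_tensor_functional[where 'b = 'b, OF T.V.real_space_axioms full]) (rule that)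
  have "\<gamma> (T.pt b y) \<noteq> 0" using \<gamma>(2) y by simp
  moreover have "\<gamma> \<zero>\<^bsub>T.U\<^esub> = 0" using real_linear_on_zero[OF T.real_space_U real_space_type_space \<gamma>(1)] by simp
  moreover have "T.pt b y \<in> carrier T.U" using b by simp
  ultimately have "carrier T.U \<noteq> {\<zero>\<^bsub>T.U\<^esub>}" by (metis singletonD)
  then show "irreducible_via (m + r) T.U T.act"
    by (rule irreducible_viaI[OF T.real_space_U T.clifford_map_act _ irr])
qed

lemma real_tensor_graded_space:
  assumes "graded_clifford V G m c"
  shows "tensor_graded_clifford V G m c (right_real V) type_space ext_grading 4 c4 (*\<^sub>R)"
proof -
  interpret V: graded_clifford V G m c by fact
  interpret E: graded_clifford type_space ext_grading 4 c4 by (rule graded_ext)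
  interpret T: tensor_clifford_space V G m c "right_real V" type_space 4 c4 "(*\<^sub>R)"
    by (rule real_tensor_space[OF assms clifford_c4])
  show ?thesis by unfold_locales (simp add: ext_par_def mat2_def algebra_simps)
qed

context quat_opp
begin

lemma irreducible_spin_1: "irreducible_via (8 * k + 1) (spin_1 \<phi> k) (act_1 \<phi> k)"
  unfolding spin_1_def act_1_def spin_0_tensor_def act_0_tensor_def
  by (rule real_tensor_irreducible(2)[OF spin_0 clifford_c1 irreducible_c1 one_neq_zero])

lemma irreducible_spin_2: "irreducible_via (8 * k + 2) (spin_2 \<phi> k) (act_2 \<phi> k)"
  unfolding spin_2_def act_2_def spin_0_tensor_def act_0_tensor_def
  by (rule real_tensor_irreducible(2)[OF spin_0 clifford_c2 irreducible_c2 one_neq_zero])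

lemma irreducible_spin_3: "irreducible_via (8 * k + 3) (spin_3 \<phi> k) (act_3 \<phi> k)"
  unfolding spin_3_def act_3_def spin_0_tensor_def act_0_tensor_def
  by (rule real_tensor_irreducible(2)[OF spin_0 clifford_c3 irreducible_c3 one_neq_zero])

lemma ext_nonzero: "(1, 0) \<noteq> (0 :: ext)"
  by (simp add: prod_eq_iff)

lemma irreducible_spin_4: "irreducible_via (8 * k + 4) (spin_4 \<phi> k) (act_4 \<phi> k)"
  and irreducible_under_spin_4: "irreducible_under (spin_4 \<phi> k) (8 * k + 4) (act_4 \<phi> k)"
  unfolding spin_4_def act_4_def spin_0_tensor_def act_0_tensor_def
  by (rule real_tensor_irreducible[OF spin_0 clifford_c4 irreducible_c4 ext_nonzero])+

lemma irreducible_spin_8: "irreducible_via (8 * k) (spin_0 \<phi> k) (act_0 \<phi> k)"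
proof -
  interpret graded_clifford "spin_0 \<phi> k" "grading_0 \<phi> k" "8 * k" "act_0 \<phi> k" by (rule spin_0)
  show ?thesis
    using full_irreducible[OF spin_0(2)] by (intro irreducible_viaI real_space_axioms clifford)
qed

text \<open>With \<open>X \<otimes> t = (X \<cdot> \<psi>\<^sup>-\<^sup>1 t) \<otimes> 1\<close> the tensor product is a quotient of \<open>S\<^bsub>8k+4\<^esub>\<close>. It is not zero because
  \<open>X \<otimes> t \<mapsto> \<gamma> X \<cdot> \<psi>\<^sup>-\<^sup>1 t\<close> is well defined, where \<open>\<gamma> = \<beta> \<otimes> 1\<close> takes values in \<open>S\<^sub>4\<close>. The letter \<open>\<psi>\<close> stands for
  the identification of \<open>\<complex>\<close> or \<open>\<bbbH>\<close> with its opposite, and \<open>e\<close> for the embedding into \<open>\<bbbH>\<close>.\<close>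

lemma irreducible_spin_4_tensor:
  fixes \<psi> :: "'k::real_algebra_1 \<Rightarrow> 'k" and e :: "'k \<Rightarrow> quat" and c' :: "real vec \<Rightarrow> 'k \<Rightarrow> 'k" and k :: nat
  assumes \<psi>: "real_alg_opp_iso \<psi>" and e: "linear e" "e 1 = 1" "\<And>x y. e (x * y) = e x * e y"
    and c': "clifford_map r type_space c'" "\<And>v s a. v \<in> carrier_vec r \<Longrightarrow> c' v (s * a) = c' v s * a"
    and n: "n = 8 * k + 4 + r"
  defines "rm \<equiv> \<lambda>X z. spin_4_right \<phi> k X (e z)" and "lm \<equiv> \<lambda>z s. s * \<psi> z"
  shows "irreducible_via n (tensor (spin_4 \<phi> k) rm type_space lm)
    (tensor_clifford (spin_4 \<phi> k) (grading_4 \<phi> k) rm type_space lm (8 * k + 4) (act_4 \<phi> k) r c')"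
proof -
  let ?V = "spin_0 \<phi> k"
  interpret T: tensor_graded_clifford ?V "grading_0 \<phi> k" "8 * k" "act_0 \<phi> k" "right_real ?V" type_space ext_grading 4 c4 "(*\<^sub>R)"
    by (rule real_tensor_graded_space[OF spin_0(1)])
  have defs: "spin_4 \<phi> k = T.U" "act_4 \<phi> k = T.act" "grading_4 \<phi> k = T.UG" "spin_4_null \<phi> k = T.N"
    by (simp_all add: spin_4_def act_4_def grading_4_def spin_4_null_def spin_0_tensor_def act_0_tensor_def)
  have right: "spin_4_right \<phi> k X q = tensor_map T.N id (\<lambda>s. ext_right s q) X" for X q
    by (simp add: spin_4_right_def defs)
  have ext_r: "T.end_r (\<lambda>s. ext_right s q)" for q
    by (auto simp: T.end_r_def ext_right_def algebra_simps intro!: linearI)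
  have right_linear: "real_linear_on T.U T.U (\<lambda>X. spin_4_right \<phi> k X q)" for q
    unfolding right by (intro T.tensor_map_linear ext_r T.end_id)
  have right_pt: "spin_4_right \<phi> k (T.pt x s) q = T.pt x (ext_right s q)" for x s q
    unfolding right by (simp add: ext_r)
  obtain b \<beta> \<gamma> where b: "b \<in> carrier ?V" and \<gamma>: "real_linear_on T.U type_space \<gamma>"
    and \<gamma>_b: "\<And>s. \<gamma> (T.pt b s) = s" and \<gamma>_pt: "\<And>x s. x \<in> carrier ?V \<Longrightarrow> \<gamma> (T.pt x s) = \<beta> x *\<^sub>R (s :: ext)"
    by (rule real_tensor_functional[where 'b = ext, OF T.V.real_space_axioms spin_0(2)]) (rule that)
  have \<gamma>_right: "\<gamma> (spin_4_right \<phi> k X q) = ext_right (\<gamma> X) q" if "X \<in> carrier T.U" for X q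
  proof (rule T.U_linear_eq[OF real_space_type_space real_linear_on_comp[OF \<gamma> right_linear] _ _ that])
    show "real_linear_on T.U type_space (\<lambda>X. ext_right (\<gamma> X) q)"
      using ext_r[of q] by (intro real_linear_on_comp[OF _ \<gamma>]) (simp add: T.end_r_def)
  qed (simp add: right_pt \<gamma>_pt, simp add: ext_right_def)
  interpret W: clifford_space type_space r c'
    using c'(1) by (simp add: clifford_space_def clifford_space_axioms_def real_space_type_space)
  interpret Q: tensor_clifford_space T.U T.UG "8 * k + 4" T.act rm type_space r c' lm
  proof unfold_locales
    show "real_linear_on T.U T.U (\<lambda>x. rm x a)" for a unfolding rm_def by (rule right_linear)
    show "real_linear_on type_space type_space (lm a)" for a
      by (auto simp: lm_def algebra_simps intro!: linearI)
    show "T.U.par (rm X a) = rm (T.U.par X) a" if X: "X \<in> carrier T.U" for X a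
    proof (rule T.U_linear_eq[OF T.real_space_U _ _ _ X])
      show "real_linear_on T.U T.U (\<lambda>X. T.U.par (rm X a))" "real_linear_on T.U T.U (\<lambda>X. rm (T.U.par X) a)"
        unfolding rm_def by (intro real_linear_on_comp[OF T.U.par_linear right_linear] real_linear_on_comp[OF right_linear T.U.par_linear])+
      fix x and s :: ext assume "x \<in> carrier ?V" "s \<in> carrier type_space"
      then show "T.U.par (rm (T.pt x s) a) = rm (T.U.par (T.pt x s)) a"
        using T.end_par' by (simp add: rm_def right_pt T.U_parity) (simp add: ext_right_def ext_par_def mat2_def)
    qed
    show "T.act w (rm X a) = rm (T.act w X) a" if w: "w \<in> carrier_vec (8 * k + 4)" and X: "X \<in> carrier T.U" for w X a
    proof (rule T.U_linear_eq[OF T.real_space_U _ _ _ X])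
      show "real_linear_on T.U T.U (\<lambda>X. T.act w (rm X a))" "real_linear_on T.U T.U (\<lambda>X. rm (T.act w X) a)"
        unfolding rm_def by (intro real_linear_on_comp[OF T.act_linear right_linear] real_linear_on_comp[OF right_linear T.act_linear] w)+
      fix x and s :: ext assume xs: "x \<in> carrier ?V" "s \<in> carrier type_space"
      have "c4 v (ext_right s q) = ext_right (c4 v s) q" for v q
        by (simp add: c4_mat2 mat2_def ext_right_def algebra_simps)
      then show "T.act w (rm (T.pt x s) a) = rm (T.act w (T.pt x s)) a"
        using w xs by (simp add: rm_def right_pt T.act_pt real_linear_onD(2)[OF right_linear])
    qed
    show "c' v (lm a s) = lm a (c' v s)" if "v \<in> carrier_vec r" for v a s
      using that by (simp add: lm_def c'(2))
  qed
  note \<psi>' = opp_inv[OF \<psi>]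
  have "irreducible_under Q.U (8 * k + 4 + r) Q.act"
  proof (rule Q.tensor_irreducible_quotient)
    show "irreducible_under T.U (8 * k + 4) T.act" using irreducible_under_spin_4[of k] by (simp add: defs)
    show "1 \<in> carrier type_space" by simp
    show "\<exists>X'\<in>carrier T.U. Q.pt X t = Q.pt X' 1" if "X \<in> carrier T.U" for X t
      using Q.pt_balanced[OF that, of 1 "inv_into UNIV \<psi> t"] that \<psi>'(3) by (intro bexI[of _ "rm X (inv_into UNIV \<psi> t)"]) (simp_all add: lm_def)
  qed
  moreover have "carrier Q.U \<noteq> {\<zero>\<^bsub>Q.U\<^esub>}"
  proof -
    have e\<psi>: "linear (\<lambda>t. e (inv_into UNIV \<psi> t))" using linear_compose[OF \<psi>'(1) e(1)] by (simp add: o_def)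
    obtain \<delta> where \<delta>: "real_linear_on Q.U type_space \<delta>"
      "\<And>X t. X \<in> carrier T.U \<Longrightarrow> \<delta> (Q.pt X t) = ext_right (\<gamma> X) (e (inv_into UNIV \<psi> t))"
    proof (rule Q.tensor_functional[of "\<lambda>X t. ext_right (\<gamma> X) (e (inv_into UNIV \<psi> t))"])
      show "ext_right (\<gamma> (rm X a)) (e (inv_into UNIV \<psi> t)) = ext_right (\<gamma> X) (e (inv_into UNIV \<psi> (lm a t)))" if "X \<in> carrier T.U" for X a t
        using that by (simp add: rm_def lm_def \<gamma>_right \<psi>' e(3)) (simp add: ext_right_def mult.assoc)
    qed (auto simp: real_linear_onD[OF \<gamma>] linear_add[OF e\<psi>] linear_scale[OF e\<psi>] ext_right_def algebra_simps)
    have "\<delta> (Q.pt (T.pt b (1, 0)) 1) = (1, 0)"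
      using b by (simp add: \<delta>(2) \<gamma>_b \<psi>' e(2)) (simp add: ext_right_def)
    moreover have "\<delta> \<zero>\<^bsub>Q.U\<^esub> = 0" using real_linear_on_zero[OF Q.real_space_U real_space_type_space \<delta>(1)] by simp
    moreover have "Q.pt (T.pt b (1, 0)) 1 \<in> carrier Q.U" using b by simp
    ultimately show ?thesis using ext_nonzero by (metis singletonD)
  qed
  ultimately have "irreducible_via (8 * k + 4 + r) Q.U Q.act"
    by (intro irreducible_viaI Q.real_space_U Q.clifford_map_act)
  then show ?thesis by (simp add: defs n)
qed

end

theorem mainTheorem2:
  fixes \<phi> :: "quat \<Rightarrow> quat" and \<psi> :: "complex \<Rightarrow> complex" and e :: "complex \<Rightarrow> quat"
  assumes "real_alg_opp_iso \<phi>" and "real_alg_opp_iso \<psi>" and "real_alg_embedding e"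
  shows
    "irreducible_via 1 type_space c1 \<and>
     irreducible_via 2 type_space c2 \<and>
     irreducible_via 3 type_space c3 \<and>
     irreducible_via 4 type_space c4 \<and>
     irreducible_via 3 type_space (\<lambda>v s. - c3 v s) \<and>
     \<not> isomorphic_via 3 type_space (\<lambda>v s. - c3 v s) type_space c3 \<and>
     (\<exists>h \<in> ring_iso (Cl 4) End_ext.
        (\<forall>r. \<forall>x \<in> carrier (Cl 4). h (r \<odot>\<^bsub>Cl 4\<^esub> x) = r \<odot>\<^bsub>End_ext\<^esub> h x) \<and>
        (\<forall>v \<in> carrier_vec 4. h (Cl_vec 4 v) = c4 v)) \<and>
     (\<forall>k.
        irreducible_via (8 * k + 1) (spin_1 \<phi> k) (act_1 \<phi> k) \<and>
        irreducible_via (8 * k + 2) (spin_2 \<phi> k) (act_2 \<phi> k) \<and>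
        irreducible_via (8 * k + 3) (spin_3 \<phi> k) (act_3 \<phi> k) \<and>
        irreducible_via (8 * k + 4) (spin_4 \<phi> k) (act_4 \<phi> k) \<and>
        irreducible_via (8 * k + 5) (spin_5 \<phi> \<psi> e k) (act_5 \<phi> \<psi> e k) \<and>
        irreducible_via (8 * k + 6) (spin_6 \<phi> k) (act_6 \<phi> k) \<and>
        irreducible_via (8 * k + 7) (spin_7 \<phi> k) (act_7 \<phi> k) \<and>
        irreducible_via (8 * k + 8) (spin_0 \<phi> (k + 1)) (act_0 \<phi> (k + 1)))"
proof -
  interpret quat_opp \<phi> by unfold_locales (rule assms(1))
  have e: "linear e" "e 1 = 1" "\<And>x y. e (x * y) = e x * e y"
    using assms(3) by (auto simp: real_alg_embedding_def)
  have basic: "irreducible_via 1 type_space c1" "irreducible_via 2 type_space c2" "irreducible_via 3 type_space c3"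
    "irreducible_via 3 type_space (\<lambda>v s. - c3 v s)"
    by (intro irreducible_viaI real_space_type_space type_space_nonzero clifford_c1 irreducible_c1
        clifford_c2 irreducible_c2 clifford_c3 irreducible_c3 clifford_minus_c3 irreducible_minus_c3)+
  have "carrier (type_space :: (real, ext) module) \<noteq> {\<zero>\<^bsub>type_space\<^esub>}"
    using ext_nonzero by (metis UNIV_I singletonD type_space_sel(1,2))
  then have basic4: "irreducible_via 4 type_space c4"
    by (intro irreducible_viaI real_space_type_space clifford_c4 irreducible_c4)
  have spin_5: "irreducible_via (8 * k + 5) (spin_5 \<phi> \<psi> e k) (act_5 \<phi> \<psi> e k)" for k
    unfolding spin_5_def act_5_def
    by (rule irreducible_spin_4_tensor[OF assms(2) e clifford_c1]) (simp_all add: c1_def)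
  have spin_6: "irreducible_via (8 * k + 6) (spin_6 \<phi> k) (act_6 \<phi> k)" for k
    using irreducible_spin_4_tensor[OF assms(1), of "\<lambda>q. q" 2 c2 "8 * k + 6" k]
    by (simp add: spin_6_def act_6_def clifford_c2 c2_def linear_ident mult.assoc)
  have spin_7: "irreducible_via (8 * k + 7) (spin_7 \<phi> k) (act_7 \<phi> k)" for k
    using irreducible_spin_4_tensor[OF assms(1), of "\<lambda>q. q" 3 c3 "8 * k + 7" k]
    by (simp add: spin_7_def act_7_def clifford_c3 c3_def linear_ident mult.assoc)
  have spin_8: "irreducible_via (8 * k + 8) (spin_0 \<phi> (k + 1)) (act_0 \<phi> (k + 1))" for k
    using irreducible_spin_8[of "k + 1"] by (simp add: algebra_simps)
  show ?thesis
    using basic basic4 c3_not_isomorphic Cl_4_iso_End irreducible_spin_1 irreducible_spin_2 irreducible_spin_3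
      irreducible_spin_4 spin_5 spin_6 spin_7 spin_8 by blast
qed

end
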